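(* Assume $m>\log n$. There is a prescient $((m\log m)^{2/3},\ (m\log m)^{2/3})$-scheme with perfect completeness for $m$-DISJ in the strict turnstile update model. In particular, the MA communication complexity of $m$-DISJ (Alice holding $S$, Bob holding $T$) is $O((m\log m)^{2/3})$. Any prescient $(c_a,c_v)$-scheme for $m$-DISJ requires $c_a c_v=\Omega(m)$.
   Context: $m$-DISJ: the data stream specifies two multisets $S,T$ over $[n]$, each with at most $m$ distinct items. An update $((0,i),\delta)$ inserts $\delta$ copies of $i$ into $S$ and an update $((1,i),\delta)$ inserts $\delta$ copies of $i$ into $T$; in the strict turnstile model $\delta$ may be negative but all multiplicities remain nonnegative. The goal is to decide whether $S$ and $T$ are disjoint (as communication problem: Alice holds $S$, Bob holds $T$, both subsets of $[n]$ of size at most $m$). Schemes: a scheme for $F$ is a pair $(\mathfrak h,V)$. A prover with private randomness $r_P$ supplies after the $i$th stream element an annotation string $\mathfrak h_i(\mathbf x,r_P)$, which may depend on the entire stream; the verifier $V$ is a streaming algorithm with $w$ bits of memory and private randomness $r_V$ reading the interleaved annotated stream and outputting a value or $\bot$ (reject). Completeness error $\delta_c$: for all $\mathbf x$, $\Pr_{r_P,r_V}[\text{output}\ne F(\mathbf x)]\le\delta_c$ (perfect completeness if $\delta_c=0$). Soundness error $\delta_s$: for all $\mathbf x$ and all annotation sequences, $\Pr_{r_V}[\text{output}\notin\{F(\mathbf x),\bot\}]\le\delta_s$. A prescient $(c_a,c_v)$-scheme has total annotation length $O(c_a)$, space $O(c_v)$ and error $\max\{\delta_s,\delta_c\}\le1/3$.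 MA communication for $F:X\times Y\to\{0,1\}$: Merlin, knowing $(x,y)$ and using private randomness, sends a help message seen by Alice and Bob; then Alice and Bob run a randomized protocol with public randomness unknown to Merlin and output a bit. Completeness: if $F=1$, the prescribed help leads to output $0$ with probability $\le\delta_c$; soundness: if $F=0$, for every help message output $1$ with probability $\le\delta_s$. hcost $=1+$ max help length; vcost $=$ max bits exchanged between Alice and Bob. The MA communication complexity is the minimum of hcost $+$ vcost over protocols with error at most $1/3$.
   Formalization: Formalized with m ≥ 2 and final multiplicities at most m^k (any fixed k; constants may depend on k); honest annotation lengths depend only on stream length and position; the lower bound assumes m ≤ n and c_a ≥ 1. Without these the claims fail. *)

theory Defs
  imports "HOL-Probability.Probability" "HOL-Library.Multiset"
begin

type_synonym bits = "bool list"

section \<open>Annotated streams and schemes\<close>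

text \<open>
  The verifier reads the annotation bit by bit, so that buffering a part of an annotation string
  costs memory; it can tell an annotation bit from a stream element.
\<close>

datatype 'x symbol = Elem 'x | Annot bool

text \<open>
  The string \<open>a i\<close> comes directly after the \<open>i\<close>-th stream element; \<open>a 0\<close> precedes the stream.
\<close>

definition annotated :: "(nat \<Rightarrow> bits) \<Rightarrow> 'x list \<Rightarrow> 'x symbol list" where
  "annotated a xs =
     map Annot (a 0) @ concat (map (\<lambda>i. Elem (xs ! i) # map Annot (a (Suc i))) [0..<length xs])"

text \<open>
  Both parties draw a private random string from a discrete distribution.  \<open>annotation i xs r\<close> is
  the string the paper calls \<open>h_i(x, r_P)\<close>.  The random string of the verifier is
  read-only and is not counted as memory; everything carried from one symbol to the next is
  in the memory state.  \<open>None\<close> is the output \<open>\<bottom>\<close>.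
\<close>

record 'x prover =
  prover_coins :: "bits pmf"
  annotation :: "nat \<Rightarrow> 'x list \<Rightarrow> bits \<Rightarrow> bits"

record ('x, 'o) verifier =
  verifier_coins :: "bits pmf"
  init_mem :: "bits \<Rightarrow> bits"
  step_mem :: "bits \<Rightarrow> bits \<Rightarrow> 'x symbol \<Rightarrow> bits"
  verdict :: "bits \<Rightarrow> bits \<Rightarrow> 'o option"

definition run :: "('x, 'o) verifier \<Rightarrow> bits \<Rightarrow> 'x symbol list \<Rightarrow> 'o option" where
  "run V r ys = verdict V r (foldl (step_mem V r) (init_mem V r) ys)"

definition memory_bits :: "('x, 'o) verifier \<Rightarrow> nat \<Rightarrow> bool" where
  "memory_bits V w \<longleftrightarrow>
     (\<forall>r. length (init_mem V r) = w \<and>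
          (\<forall>s y. length s = w \<longrightarrow> length (step_mem V r s y) = w))"

definition completeness_error ::
  "'x list set \<Rightarrow> ('x list \<Rightarrow> 'o) \<Rightarrow> 'x prover \<Rightarrow> ('x, 'o) verifier \<Rightarrow> real \<Rightarrow> bool" where
  "completeness_error X F P V \<delta> \<longleftrightarrow>
     (\<forall>xs\<in>X. measure_pmf.prob (pair_pmf (prover_coins P) (verifier_coins V))
        {(r\<^sub>P, r\<^sub>V). run V r\<^sub>V (annotated (\<lambda>i. annotation P i xs r\<^sub>P) xs) \<noteq> Some (F xs)} \<le> \<delta>)"

definition soundness_error ::
  "'x list set \<Rightarrow> ('x list \<Rightarrow> 'o) \<Rightarrow> ('x, 'o) verifier \<Rightarrow> real \<Rightarrow> bool" where
  "soundness_error X F V \<delta> \<longleftrightarrow>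
     (\<forall>xs\<in>X. \<forall>a. measure_pmf.prob (verifier_coins V)
        {r\<^sub>V. run V r\<^sub>V (annotated a xs) \<notin> {Some (F xs), None}} \<le> \<delta>)"

text \<open>
  The lengths of the honest annotation strings are part of the scheme: \<open>len N i\<close> bits follow the
  \<open>i\<close>-th element of a stream of length \<open>N\<close>.  If the lengths could depend on the stream, the prover
  could encode information in the positions of its bits, about \<open>log N\<close> bits for each bit paid for.
\<close>

definition annotation_bits :: "'x list set \<Rightarrow> 'x prover \<Rightarrow> nat \<Rightarrow> bool" where
  "annotation_bits X P c \<longleftrightarrow>
     (\<exists>len. \<forall>xs\<in>X.
        (\<forall>r\<in>set_pmf (prover_coins P). \<forall>i\<le>length xs.
           length (annotation P i xs r) = len (length xs) i) \<and>
        (\<Sum>i\<le>length xs. len (length xs) i) \<le> c)"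

text \<open>
  Prescient \<open>(c\<^sub>a, c\<^sub>v)\<close>-schemes for a problem family: \<open>Q\<close> is the set of parameters, \<open>X p\<close> and \<open>F p\<close> are the
  legal streams and the function for parameter \<open>p\<close>, and the constant \<open>K\<close> hidden in the \<open>O\<close>-notation
  is uniform over \<open>Q\<close>.  The scheme is prescient in that each annotation string is a function of the
  whole stream.
\<close>

definition prescient_scheme ::
  "real \<Rightarrow> 'p set \<Rightarrow> ('p \<Rightarrow> 'x list set) \<Rightarrow> ('p \<Rightarrow> 'x list \<Rightarrow> 'o) \<Rightarrow> ('p \<Rightarrow> real) \<Rightarrow> ('p \<Rightarrow> real) \<Rightarrow> bool"
  where
  "prescient_scheme \<delta>\<^sub>c Q X F c\<^sub>a c\<^sub>v \<longleftrightarrow>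
     (\<exists>K::real. \<forall>p\<in>Q. \<exists>(P :: 'x prover) (V :: ('x, 'o) verifier) c w.
        annotation_bits (X p) P c \<and> real c \<le> K * c\<^sub>a p \<and>
        memory_bits V w \<and> real w \<le> K * c\<^sub>v p \<and>
        completeness_error (X p) (F p) P V \<delta>\<^sub>c \<and>
        soundness_error (X p) (F p) V (1/3))"

section \<open>The problem m-DISJ\<close>

text \<open>An update \<open>((b, i), \<delta>)\<close> adds \<open>\<delta>\<close> copies of \<open>i\<close> to \<open>S\<close> if \<open>b = 0\<close> and to \<open>T\<close> if \<open>b = 1\<close>.\<close>

type_synonym update = "(nat \<times> nat) \<times> int"

definition frequency :: "update list \<Rightarrow> nat \<times> nat \<Rightarrow> int" where
  "frequency xs j = sum_list (map snd (filter (\<lambda>u. fst u = j) xs))"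

definition strict_turnstile :: "(nat \<times> nat) set \<Rightarrow> update list set" where
  "strict_turnstile U =
     {xs. fst ` set xs \<subseteq> U \<and> (\<forall>k\<le>length xs. \<forall>j. 0 \<le> frequency (take k xs) j)}"

definition stream_mset :: "nat \<Rightarrow> nat \<Rightarrow> update list \<Rightarrow> nat multiset" where
  "stream_mset n b xs = (\<Sum>i\<in>{1..n}. replicate_mset (nat (frequency xs (b, i))) i)"

text \<open>
  \<open>B\<close> bounds the multiplicities in the final multisets \<open>S\<close> and \<open>T\<close>.  Some bound is needed: already for
  \<open>n = m = 2\<close> a verifier and an annotation of bounded size cannot handle all multiplicities.
  With \<open>B\<close> polynomial in \<open>m\<close>, a multiplicity takes \<open>O(log m)\<close> bits.
\<close>

definition disj_streams :: "nat \<Rightarrow> nat \<Rightarrow> nat \<Rightarrow> update list set" where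
  "disj_streams n m B =
     {xs \<in> strict_turnstile ({0, 1} \<times> {1..n}).
        \<forall>b\<in>{0, 1}. card (set_mset (stream_mset n b xs)) \<le> m \<and>
                   (\<forall>i. count (stream_mset n b xs) i \<le> B)}"

definition m_disj :: "nat \<Rightarrow> update list \<Rightarrow> bool" where
  "m_disj n xs \<longleftrightarrow> set_mset (stream_mset n 0 xs) \<inter> set_mset (stream_mset n 1 xs) = {}"

text \<open>For \<open>m = 1\<close> the bound \<open>m log m\<close> vanishes.\<close>

definition disj_params :: "(nat \<times> nat) set" where
  "disj_params = {(n, m). 1 \<le> n \<and> 2 \<le> m \<and> log 2 (real n) < real m}"

section \<open>Merlin-Arthur communication\<close>

datatype ('x, 'y) protocol =
    Leaf bool
  | Alice "'x \<Rightarrow> bool" "('x, 'y) protocol" "('x, 'y) protocol"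
  | Bob "'y \<Rightarrow> bool" "('x, 'y) protocol" "('x, 'y) protocol"

primrec out :: "('x, 'y) protocol \<Rightarrow> 'x \<Rightarrow> 'y \<Rightarrow> bool" where
  "out (Leaf v) x y = v"
| "out (Alice f t u) x y = (if f x then out t x y else out u x y)"
| "out (Bob f t u) x y = (if f y then out t x y else out u x y)"

primrec bits_exchanged :: "('x, 'y) protocol \<Rightarrow> 'x \<Rightarrow> 'y \<Rightarrow> nat" where
  "bits_exchanged (Leaf v) x y = 0"
| "bits_exchanged (Alice f t u) x y =
     Suc (if f x then bits_exchanged t x y else bits_exchanged u x y)"
| "bits_exchanged (Bob f t u) x y =
     Suc (if f y then bits_exchanged t x y else bits_exchanged u x y)"

text \<open>
  \<open>conversation h r\<close> is the protocol of Alice and Bob after the help message \<open>h\<close> and with the public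
  random string \<open>r\<close>.  Merlin's message \<open>merlin_msg\<close> does not depend on \<open>r\<close>.
\<close>

record ('x, 'y) ma_protocol =
  merlin_coins :: "bits pmf"
  merlin_msg :: "'x \<Rightarrow> 'y \<Rightarrow> bits \<Rightarrow> bits"
  public_coins :: "bits pmf"
  conversation :: "bits \<Rightarrow> bits \<Rightarrow> ('x, 'y) protocol"

definition ma_computes ::
  "'x set \<Rightarrow> 'y set \<Rightarrow> ('x \<Rightarrow> 'y \<Rightarrow> bool) \<Rightarrow> ('x, 'y) ma_protocol \<Rightarrow> real \<Rightarrow> real \<Rightarrow> bool" where
  "ma_computes X Y F P \<delta>\<^sub>c \<delta>\<^sub>s \<longleftrightarrow>
     (\<forall>x\<in>X. \<forall>y\<in>Y.
       (F x y \<longrightarrow>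
          measure_pmf.prob (pair_pmf (merlin_coins P) (public_coins P))
            {(r\<^sub>M, r). \<not> out (conversation P (merlin_msg P x y r\<^sub>M) r) x y} \<le> \<delta>\<^sub>c) \<and>
       (\<not> F x y \<longrightarrow>
          (\<forall>h. measure_pmf.prob (public_coins P) {r. out (conversation P h r) x y} \<le> \<delta>\<^sub>s)))"

definition hcost :: "'x set \<Rightarrow> 'y set \<Rightarrow> ('x, 'y) ma_protocol \<Rightarrow> enat" where
  "hcost X Y P =
     1 + (SUP (x, y, r) \<in> X \<times> Y \<times> set_pmf (merlin_coins P). enat (length (merlin_msg P x y r)))"

definition vcost :: "'x set \<Rightarrow> 'y set \<Rightarrow> ('x, 'y) ma_protocol \<Rightarrow> enat" where
  "vcost X Y P =
     (SUP (x, y, h, r) \<in> X \<times> Y \<times> UNIV \<times> set_pmf (public_coins P).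
        enat (bits_exchanged (conversation P h r) x y))"

text \<open>An infimum of a nonempty set of extended naturals is attained, so this is a minimum.\<close>

definition ma_complexity :: "'x set \<Rightarrow> 'y set \<Rightarrow> ('x \<Rightarrow> 'y \<Rightarrow> bool) \<Rightarrow> enat" where
  "ma_complexity X Y F =
     (INF P \<in> {P. ma_computes X Y F P (1/3) (1/3)}. hcost X Y P + vcost X Y P)"

definition small_subsets :: "nat \<Rightarrow> nat \<Rightarrow> nat set set" where
  "small_subsets n m = {S. S \<subseteq> {1..n} \<and> card S \<le> m}"

end

theory Submission
  imports Defs
begin

text \<open>
  Upper bound.  Let \<open>C = (m log m)^(2/3)\<close>.  A random function from the items to a grid of size \<open>a\<close> by
  \<open>a\<close>, where \<open>a\<close> is of order \<open>C / log m\<close>, separates two disjoint sets of size \<open>O(m)\<close> with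
  probability at least \<open>exp (- O(m^2 / a^2)) = exp (- O(C))\<close>.  Hence there is a fixed family of hash functions with seeds
  of \<open>O(C)\<close> bits in which the prover always finds a function without a harmful collision; the
  assumption \<open>log n < m\<close> enters here.  The prover sends the seed.  To prove disjointness he also sends
  a polynomial over a field with \<open>m^O(1)\<close> elements which has the inner product of the hashed
  frequency vectors as its middle coefficient, and the verifier evaluates it at a random point from
  linear sketches with \<open>2 a\<close> entries.  To prove intersection he sends a grid point which is hit by
  a single item, and the verifier compares random fingerprints of what \<open>S\<close> and \<open>T\<close> put there.

  Lower bound.  The stream of \<open>S\<close> followed by that of \<open>T\<close> gives a one-way protocol with messages of
  \<open>w\<close> bits once the \<open>c\<close> annotation bits are fixed.  For random \<open>S \<subseteq> {1..m}\<close> and a random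
  sequence \<open>u\<close> of \<open>c + 1\<close> items, a dense set of \<open>S\<close> has few items which it nearly always avoids,
  so that \<open>u\<close> is unlikely to consist of such items only.  After \<open>O(c)\<close> repetitions the error
  is smaller than the fraction of disjoint pairs by a factor \<open>2^(-c)\<close>, and all annotations can be summed over.
\<close>


section \<open>Primes and roots of polynomials modulo primes\<close>

text \<open>The grid side \<open>a\<close> balances two costs: a seed needs about m^2 / a^2 bits,
  while the polynomial and the sketches consist of about \<open>a\<close> numbers of log m bits.
  Equality means a^3 = m^2 / log m, hence a log m = (m log m)^(2/3). The universe enters only
  through the number of pairs of sets, below 2^(4 m^2); the union bound over them costs a factor 4
  m^2 in the number of functions, that is O(log m) seed bits. A badly chosen seed cannot hide an
  intersection: in the strict turnstile model frequencies are nonnegative, so collisions only add to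
  the middle coefficient, and a prime above (m B)^2 keeps it nonzero. In the lower bound the honest
  annotation depends on the input, so only the sum over all 2^c annotations is known to accept every
  disjoint pair, and with t = c + 1 items in \<open>u\<close> disjoint pairs are only guaranteed to
  make up a fraction 2^(-t). The error after repetition and the chance 16^(-t) that \<open>u\<close>
  has only rarely hit items must both beat 2^(-c-t). This fixes \<open>t\<close>, the threshold 1/16
  and the number of repetitions.\<close>

lemma times_binomial_dvd:
  fixes L :: nat
  assumes "\<And>j. 1 \<le> j \<Longrightarrow> j \<le> n \<Longrightarrow> j dvd L" "k < n"
  shows "Suc k * (n choose Suc k) dvd L"
  using assms
proof (induction k arbitrary: n)
  case 0
  then show ?case by simp
next
  case (Suc k)
  then obtain n' where n: "n = Suc n'" by (cases n) auto
  define x where "x = n' choose Suc k"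
  define y where "y = n' choose k"
  have dvd1: "Suc k * x dvd L"
    unfolding x_def using Suc.prems n by (intro Suc.IH) auto
  have dvd2: "Suc k * (x + y) dvd L"
    using Suc.IH[of n] Suc.prems n by (simp add: x_def y_def add.commute)
  have absorb: "Suc k * (x + y) = n * y"
    using Suc_times_binomial[of k n'] n by (simp add: x_def y_def add.commute)
  have y: "y > 0" using Suc.prems n by (simp add: y_def)
  obtain A where A: "L = Suc k * x * A" using dvd1 by blast
  obtain B where B: "L = n * y * B" using dvd2 absorb by auto
  \<comment> \<open>Difference rule of the Leibniz harmonic triangle, 1/((k+1) x) - 1/(n y) = 1/(n
    x), multiplied by \<open>L\<close>: the first two terms become the integers \<open>A\<close> and
    \<open>B\<close>, so the third is an integer too.\<close>
  have "int (Suc k * y) * ((int A - int B) * int (n * x)) = int (Suc k * y) * int L"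
  proof -
    have "int (Suc k * y) * ((int A - int B) * int (n * x)) =
        int (n * y) * int (Suc k * x * A) - int (Suc k * x) * int (n * y * B)"
      by (simp add: algebra_simps)
    also have "\<dots> = (int (n * y) - int (Suc k * x)) * int L"
      unfolding A[symmetric] B[symmetric] by (simp add: algebra_simps)
    also have "int (n * y) - int (Suc k * x) = int (Suc k * y)"
      unfolding absorb[symmetric] by (simp add: algebra_simps)
    finally show ?thesis .
  qed
  then have "(int A - int B) * int (n * x) = int L"
    using y by (simp only: mult_cancel_left of_nat_eq_0_iff mult_eq_0_iff) simp
  then have "int (n * x) dvd int L" by (metis dvd_triv_right)
  then have "n * x dvd L" by (simp only: int_dvd_int_iff)
  moreover have "Suc (Suc k) * (n choose Suc (Suc k)) = n * x"
    unfolding n x_def by (rule Suc_times_binomial)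
  ultimately show ?case by simp
qed

text \<open>The witness is the least common multiple of 1, ..., \<open>N\<close>. Each prime
  contributes a power of at most \<open>N\<close>, so few primes would make it small.\<close>

lemma common_multiple_le_power:
  fixes N :: nat
  obtains L where "L > 0" "\<And>j. 1 \<le> j \<Longrightarrow> j \<le> N \<Longrightarrow> j dvd L"
    "L \<le> N ^ card {p. prime p \<and> p \<le> N}"
proof
  let ?P = "{p. prime p \<and> p \<le> N}"
  define e where "e p = Max {i. p ^ i \<le> N}" for p :: nat
  define L where "L = (\<Prod>p\<in>?P. p ^ e p)"
  have bounded: "i \<le> N" if "p \<ge> 2" "p ^ i \<le> N" for p i
    using that by (meson less_exp less_imp_le_nat order_trans power_mono zero_le)
  have fin: "finite {i. p ^ i \<le> N}" if "p \<ge> 2" for p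
    by (rule finite_subset[of _ "{..N}"]) (use bounded that in auto)
  have e: "p ^ e p \<le> N" if "p \<in> ?P" for p
  proof -
    have "{i. p ^ i \<le> N} \<noteq> {}" using that prime_ge_1_nat[of p] by (auto intro!: exI[of _ 0])
    then have "e p \<in> {i. p ^ i \<le> N}"
      unfolding e_def using fin[of p] that by (intro Max_in) (auto dest: prime_ge_2_nat)
    then show ?thesis by simp
  qed
  show "L > 0" unfolding L_def by (intro prod_pos) (auto dest: prime_gt_0_nat)
  show "L \<le> N ^ card ?P"
    unfolding L_def prod_constant[symmetric] using e by (intro prod_mono) auto
  show "j dvd L" if j: "1 \<le> j" "j \<le> N" for j
  proof -
    have "j = (\<Prod>p\<in>prime_factors j. p ^ multiplicity p j)"
      using j by (simp add: prime_factorization_nat)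
    also have "\<dots> dvd (\<Prod>p\<in>?P. p ^ e p)"
    proof (rule prod_dvd_prod_subset2)
      show "prime_factors j \<subseteq> ?P"
        using j by (auto dest!: dvd_imp_le)
      fix p assume "p \<in> prime_factors j"
      then have p: "prime p" "p \<ge> 2" using in_prime_factors_imp_prime prime_ge_2_nat by blast+
      have "p ^ multiplicity p j \<le> N"
        using dvd_imp_le[OF multiplicity_dvd[of p j]] j by linarith
      then have "multiplicity p j \<le> e p"
        unfolding e_def using fin[of p] p by (intro Max_ge) auto
      then show "p ^ multiplicity p j dvd p ^ e p" by (rule le_imp_power_dvd)
    qed simp
    finally show ?thesis by (simp add: L_def)
  qed
qed

text \<open>A weak Bertrand postulate by Chebyshev's argument. Only the bit length of the prime
  enters the costs, so the quadratic gap between the two bounds loses just a constant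
  factor.\<close>

lemma prime_between_power2:
  assumes "q \<ge> 4"
  obtains p :: nat where "prime p" "2 ^ q < p" "p \<le> 2 * 4 ^ q"
proof -
  define Q :: nat where "Q = 2 ^ q"
  define N where "N = Q ^ 2"
  have N4: "N = 4 ^ q" using power_mult_distrib[of "2::nat" 2 q] by (simp add: N_def Q_def power2_eq_square)
  \<comment> \<open>Here \<open>q\<close> has to be at least 4: the induction starts with 4 * 4 = 2
    ^ 4.\<close>
  have Q: "4 * q \<le> Q"
  proof -
    have "4 * q \<le> 2 ^ q" using assms
      by (induction q rule: dec_induct) auto
    then show ?thesis by (simp add: Q_def)
  qed
  have N: "N > 0" by (simp add: N_def Q_def)
  have "\<exists>p. prime p \<and> Q < p \<and> p \<le> 2 * N"
  proof (rule ccontr)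
    assume none: "\<not> ?thesis"
    obtain L where L: "L > 0" "\<And>j. 1 \<le> j \<Longrightarrow> j \<le> 2 * N \<Longrightarrow> j dvd L"
      "L \<le> (2 * N) ^ card {p. prime p \<and> p \<le> 2 * N}"
      using common_multiple_le_power[of "2 * N"] by blast
    have "{p. prime p \<and> p \<le> 2 * N} \<subseteq> {1..Q}"
      using none by (auto simp: not_less Suc_le_eq dest: prime_gt_0_nat)
    then have "card {p. prime p \<and> p \<le> 2 * N} \<le> Q"
      using card_mono[of "{1..Q}"] by fastforce
    then have "(2 * N) ^ card {p. prime p \<and> p \<le> 2 * N} \<le> (2 * N) ^ Q"
      using N by (intro power_increasing) auto
    then have LQ: "L \<le> (2 * N) ^ Q" using L(3) by (rule order_trans[rotated])
    \<comment> \<open>This divisor is at least 4^N / 2 and so has about 2 N bits, whereas without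
      primes between \<open>Q\<close> and 2 N the common multiple has at most (2 q + 1) Q
      bits.\<close>
    have "N * (2 * N choose N) dvd L"
      using times_binomial_dvd[of "2 * N" L "N - 1"] L(2) N by simp
    then have le: "N * (2 * N choose N) \<le> (2 * N) ^ Q"
      using L(1) LQ by (meson dvd_imp_le le_trans)
    have "4 ^ N / (2 * real N) \<le> real (2 * N choose N)"
      using central_binomial_lower_bound[OF N] .
    then have "4 ^ N \<le> 2 * (real N * real (2 * N choose N))"
      using N by (simp add: field_simps)
    also have "\<dots> = 2 * real (N * (2 * N choose N))" by simp
    also have "\<dots> \<le> 2 * real ((2 * N) ^ Q)" using le of_nat_mono by fastforce
    finally have "real (4 ^ N) \<le> real (2 * (2 * N) ^ Q)" by simp
    then have "4 ^ N \<le> 2 * (2 * N) ^ Q" using of_nat_le_iff by blast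
    also have "2 * N = 2 ^ (2 * q + 1)" by (simp only: N_def Q_def power_mult[symmetric] power_add power_one_right mult.commute)
    also have "2 * (2 ^ (2 * q + 1)) ^ Q = (2::nat) ^ ((2 * q + 1) * Q + 1)"
      by (simp only: power_mult[symmetric] power_Suc[symmetric] Suc_eq_plus1)
    also have "4 ^ N = (2::nat) ^ (2 * N)" using power_mult[of "2::nat" 2 N] by simp
    finally have "2 * N \<le> (2 * q + 1) * Q + 1"
      by (metis (no_types, lifting) one_less_numeral_iff power_increasing_iff semiring_norm(76))
    moreover have "(2 * q + 1) * Q + 1 < 2 * N"
    proof -
      have "2 * ((2 * q + 1) * Q + 1) \<le> (Q + 2) * Q + 2" using Q by (simp add: algebra_simps)
      also have "\<dots> < 4 * (Q * Q)"
      proof -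
        have "Q * 16 \<le> Q * Q" using Q assms by (intro mult_left_mono) auto
        moreover have "(Q + 2) * Q + 2 = Q * Q + 2 * Q + 2" by (simp add: algebra_simps)
        ultimately show ?thesis using Q assms by linarith
      qed
      finally show ?thesis by (simp add: N_def power2_eq_square)
    qed
    ultimately show False by simp
  qed
  then show ?thesis using that by (auto simp: N4 Q_def)
qed

text \<open>Split off x - a for a root \<open>a\<close>: the quotient has the Horner coefficients
  \<open>b\<close>, and as \<open>p\<close> is prime every other root is a root of the
  quotient.\<close>

lemma poly_sum_roots_mod_prime:
  fixes p :: int and c :: "nat \<Rightarrow> int"
  assumes "prime p" "\<exists>e<d. \<not> p dvd c e"
  shows "card {x\<in>{0..<p}. p dvd (\<Sum>e<d. c e * x ^ e)} < d"
  using assms(2)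
proof (induction d arbitrary: c)
  case 0
  then show ?case by simp
next
  case (Suc d)
  define R where "R c d = {x\<in>{0..<p}. p dvd (\<Sum>e<d. c e * x ^ e)}" for c :: "nat \<Rightarrow> int" and d
  have finR: "finite (R c d)" for c d
    unfolding R_def by (rule finite_subset[of _ "{0..<p}"]) auto
  show ?case
  proof (cases "R c (Suc d) = {}")
    case True
    then have "card (R c (Suc d)) = 0" by simp
    then show ?thesis unfolding R_def by linarith
  next
    case False
    then obtain a where a: "a \<in> R c (Suc d)" by blast
    define b where "b e = (\<Sum>i=e..<d. c (Suc i) * a ^ (i - e))" for e
    have split: "(\<Sum>e<Suc d. c e * x ^ e) - (\<Sum>e<Suc d. c e * a ^ e) =
        (x - a) * (\<Sum>e<d. b e * x ^ e)" for x
    proof -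
      have "(\<Sum>e<Suc d. c e * x ^ e) - (\<Sum>e<Suc d. c e * a ^ e) =
          (\<Sum>e<d. c (Suc e) * (x ^ Suc e - a ^ Suc e))"
        unfolding sum.lessThan_Suc_shift by (simp add: sum_subtractf[symmetric] algebra_simps)
      also have "\<dots> = (\<Sum>i<d. c (Suc i) * ((x - a) * (\<Sum>e<Suc i. x ^ e * a ^ (i - e))))"
        by (intro sum.cong refl) (simp only: diff_power_eq_sum)
      also have "\<dots> = (x - a) * (\<Sum>i<d. \<Sum>e<Suc i. c (Suc i) * a ^ (i - e) * x ^ e)"
        by (simp add: sum_distrib_left algebra_simps)
      also have "(\<Sum>i<d. \<Sum>e<Suc i. c (Suc i) * a ^ (i - e) * x ^ e) =
          (\<Sum>e<d. \<Sum>i=e..<d. c (Suc i) * a ^ (i - e) * x ^ e)"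
        by (simp only: sum.nested_swap' lessThan_Suc_atMost)
           (subst sum.Sigma, simp, simp, subst sum.Sigma, simp, simp,
            rule sum.reindex_bij_witness[of _ "\<lambda>(e, i). (i, e)" "\<lambda>(i, e). (e, i)"], auto)
      finally show ?thesis by (simp add: b_def sum_distrib_right)
    qed
    have "\<exists>e<d. \<not> p dvd b e"
    proof (rule ccontr)
      assume "\<not> ?thesis"
      then have b: "p dvd b e" if "e < d" for e using that by blast
      \<comment> \<open>The Horner recursion. Together with the root property it recovers all
        \<open>c e\<close> from the \<open>b e\<close>, so a quotient vanishing modulo
        \<open>p\<close> would make the polynomial vanish.\<close>
      have rec: "b e = c (Suc e) + a * b (Suc e)" if "e < d" for e
        unfolding b_def using that
        by (subst sum.atLeast_Suc_lessThan, simp)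
           (auto simp: sum_distrib_left Suc_diff_Suc mult.left_commute intro!: sum.cong
             simp flip: power_Suc)
      have b': "p dvd b e" for e
      proof (cases "e < d")
        case False
        then show ?thesis by (simp add: b_def)
      qed (rule b)
      have "p dvd c (Suc e)" if "e < d" for e
        using rec[OF that] b'[of e] b'[of "Suc e"] by (metis dvd_add_left_iff dvd_mult)
      moreover from this have "p dvd c 0"
      proof -
        assume *: "\<And>e. e < d \<Longrightarrow> p dvd c (Suc e)"
        have "p dvd (\<Sum>e<Suc d. c e * a ^ e)" using a by (simp add: R_def)
        then have "p dvd c 0 + (\<Sum>e<d. c (Suc e) * a ^ Suc e)"
          unfolding sum.lessThan_Suc_shift by simp
        moreover have "p dvd (\<Sum>e<d. c (Suc e) * a ^ Suc e)" using * by (intro dvd_sum) simp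
        ultimately show ?thesis by (simp add: dvd_add_left_iff)
      qed
      ultimately have "p dvd c e" if "e < Suc d" for e using that by (cases e) auto
      then show False using Suc.prems by blast
    qed
    then have IH: "card (R b d) < d" using Suc.IH unfolding R_def by blast
    have "R c (Suc d) \<subseteq> insert a (R b d)"
    proof
      fix x assume x: "x \<in> R c (Suc d)"
      then have "p dvd (x - a) * (\<Sum>e<d. b e * x ^ e)"
        unfolding split[symmetric] using a by (intro dvd_diff) (auto simp: R_def)
      then consider "p dvd x - a" | "p dvd (\<Sum>e<d. b e * x ^ e)"
        using assms(1) prime_dvd_mult_iff by blast
      then show "x \<in> insert a (R b d)"
      proof cases
        case 1
        then have "x mod p = a mod p" by (simp add: mod_eq_dvd_iff)
        then show ?thesis using x a by (simp add: R_def)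
      next
        case 2
        then show ?thesis using x by (simp add: R_def)
      qed
    qed
    then have "card (R c (Suc d)) \<le> card (insert a (R b d))" using finR by (intro card_mono) auto
    also have "\<dots> \<le> Suc (card (R b d))" by (rule card_insert_le_m1) auto
    finally show ?thesis using IH by (simp add: R_def)
  qed
qed

section \<open>Families of separating hash functions\<close>

text \<open>Probabilistic method in counting form: \<open>L\<close> independent functions all fail
  for a given \<open>i\<close> with probability at most (1 - \<beta>)^L, and the union bound over
  \<open>I\<close> leaves a list that works.\<close>

lemma covering_family:
  fixes \<beta> :: real
  assumes fin: "finite \<Omega>" "finite I" and ne: "\<Omega> \<noteq> {}" and \<beta>: "\<beta> \<le> 1"
    and good: "\<And>i. i \<in> I \<Longrightarrow> \<beta> * real (card \<Omega>) \<le> real (card {h\<in>\<Omega>. good i h})"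
    and small: "real (card I) * (1 - \<beta>) ^ L < 1"
  shows "\<exists>hs. set hs \<subseteq> \<Omega> \<and> length hs = L \<and> (\<forall>i\<in>I. \<exists>h\<in>set hs. good i h)"
proof (rule ccontr)
  assume none: "\<not> ?thesis"
  have cover: "{hs. set hs \<subseteq> \<Omega> \<and> length hs = L} \<subseteq>
      (\<Union>i\<in>I. {hs. set hs \<subseteq> {h\<in>\<Omega>. \<not> good i h} \<and> length hs = L})" (is "?A \<subseteq> (\<Union>i\<in>I. ?B i)")
  proof
    fix hs assume hs: "hs \<in> ?A"
    then obtain i where "i \<in> I" "\<And>h. h \<in> set hs \<Longrightarrow> \<not> good i h" using none by auto
    with hs show "hs \<in> (\<Union>i\<in>I. ?B i)" by auto
  qed
  have pos: "real (card \<Omega>) > 0" using fin ne by (simp add: card_gt_0_iff)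
  have bad: "real (card (?B i)) \<le> (1 - \<beta>) ^ L * real (card \<Omega>) ^ L" if "i \<in> I" for i
  proof -
    have "card {h\<in>\<Omega>. good i h} + card {h\<in>\<Omega>. \<not> good i h} = card \<Omega>"
      using fin by (subst card_Un_disjoint[symmetric]) (auto intro!: arg_cong[where f = card])
    then have "real (card {h\<in>\<Omega>. \<not> good i h}) \<le> (1 - \<beta>) * real (card \<Omega>)"
      using good[OF that] by (simp add: algebra_simps)
    then have "real (card {h\<in>\<Omega>. \<not> good i h}) ^ L \<le> ((1 - \<beta>) * real (card \<Omega>)) ^ L"
      by (intro power_mono) auto
    then show ?thesis using fin by (simp add: card_lists_length_eq power_mult_distrib)
  qed
  have "real (card \<Omega>) ^ L = real (card ?A)" using fin by (simp add: card_lists_length_eq)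
  also have "\<dots> \<le> real (card (\<Union>i\<in>I. ?B i))"
    using fin cover by (intro of_nat_mono card_mono) (auto intro!: finite_lists_length_eq)
  also have "\<dots> \<le> (\<Sum>i\<in>I. real (card (?B i)))"
    unfolding of_nat_sum[symmetric] by (intro of_nat_mono card_UN_le fin)
  also have "\<dots> \<le> real (card I) * ((1 - \<beta>) ^ L * real (card \<Omega>) ^ L)"
    using sum_mono[OF bad] by simp
  also have "\<dots> = (real (card I) * (1 - \<beta>) ^ L) * real (card \<Omega>) ^ L" by simp
  also have "\<dots> < 1 * real (card \<Omega>) ^ L"
    using small pos by (intro mult_strict_right_mono) auto
  finally show False by simp
qed

text \<open>Fix the values outside \<open>V\<close> first, including those on \<open>U\<close>; each
  point of \<open>V\<close> then has at least \<open>card R - M\<close> safe values. For x = M /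
  card R, at most 1/2, the factor (1 - x)^M is at least exp (-2 M x).\<close>

lemma card_separating_functions:
  assumes fin: "finite N" "finite R" and UV: "U \<subseteq> N" "V \<subseteq> N" "U \<inter> V = {}"
    and card: "card U \<le> M" "card V \<le> M" "2 * M \<le> card R" "M > 0" and v: "M\<^sup>2 \<le> v * card R"
  shows "exp (- 2 * real v) * real (card (N \<rightarrow>\<^sub>E R)) \<le> real (card {h \<in> N \<rightarrow>\<^sub>E R. h ` U \<inter> h ` V = {}})"
proof -
  define r where "r = card R"
  define x where "x = real M / real r"
  have r: "r > 0" "2 * M \<le> r" using card by (auto simp: r_def)
  have x: "0 \<le> x" "x \<le> 1/2" using r by (auto simp: x_def field_simps)
  let ?\<Sigma> = "SIGMA g : (N - V) \<rightarrow>\<^sub>E R. V \<rightarrow>\<^sub>E (R - g ` U)"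
  let ?merge = "\<lambda>(g, k). \<lambda>y. if y \<in> V then k y else g y"
  have finV: "finite V" "finite U" using UV fin finite_subset by blast+
  have "exp (- 2 * x) \<le> 1 - x"
  proof -
    have "x * x \<le> x * (1/2)" using x by (intro mult_left_mono) auto
    then have "- 2 * x \<le> ln (1 - x)"
      using ln_one_minus_pos_lower_bound[OF x] by (simp add: power2_eq_square)
    then show ?thesis using x by (simp add: ln_ge_iff)
  qed
  have "real M * x \<le> real v"
  proof -
    have "real (M\<^sup>2) \<le> real (v * r)" using v of_nat_mono by (fastforce simp: r_def)
    then show ?thesis using r by (simp add: x_def field_simps power2_eq_square)
  qed
  then have "exp (- 2 * real v) \<le> exp (real M * (- 2 * x))" by simp
  also have "\<dots> = exp (- 2 * x) ^ M" by (rule exp_of_nat_mult)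
  also have "\<dots> \<le> (1 - x) ^ M" using \<open>exp (- 2 * x) \<le> 1 - x\<close> by (intro power_mono) auto
  also have "\<dots> \<le> (1 - x) ^ card V" using x card by (intro power_decreasing) auto
  finally have "exp (- 2 * real v) * real (card (N \<rightarrow>\<^sub>E R)) \<le> (1 - x) ^ card V * real (card (N \<rightarrow>\<^sub>E R))"
    by (intro mult_right_mono) auto
  also have "(1 - x) ^ card V * real (card (N \<rightarrow>\<^sub>E R)) =
      real r ^ card (N - V) * real (r - M) ^ card V"
  proof -
    have "card N = card (N - V) + card V"
      using UV fin finV by (simp add: card_Diff_subset card_mono)
    then have "real (card (N \<rightarrow>\<^sub>E R)) = real r ^ card (N - V) * real r ^ card V"
      using fin by (simp add: card_PiE r_def power_add)
    moreover have "real (r - M) = (1 - x) * real r"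
      using r by (simp add: x_def field_simps)
    ultimately show ?thesis by (simp add: power_mult_distrib)
  qed
  also have "\<dots> = (\<Sum>g\<in>(N - V) \<rightarrow>\<^sub>E R. real (r - M) ^ card V)"
    using fin by (simp add: card_PiE r_def)
  also have "\<dots> \<le> (\<Sum>g\<in>(N - V) \<rightarrow>\<^sub>E R. real (card (V \<rightarrow>\<^sub>E (R - g ` U))))"
  proof (rule sum_mono)
    fix g assume "g \<in> (N - V) \<rightarrow>\<^sub>E R"
    have "card (g ` U) \<le> M" using card_image_le[OF finV(2), of g] card by linarith
    then have "r - M \<le> card (R - g ` U)"
      using diff_card_le_card_Diff[of "g ` U" R] finV by (simp add: r_def)
    then show "real (r - M) ^ card V \<le> real (card (V \<rightarrow>\<^sub>E (R - g ` U)))"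
      using finV by (simp add: card_PiE power_mono)
  qed
  also have "\<dots> = real (card ?\<Sigma>)"
    using fin finV by (subst card_SigmaI) (auto intro!: finite_PiE)
  also have "card ?\<Sigma> \<le> card {h \<in> N \<rightarrow>\<^sub>E R. h ` U \<inter> h ` V = {}}"
  proof (rule card_inj_on_le[where f = ?merge])
    show "inj_on ?merge ?\<Sigma>"
    proof (rule inj_onI, clarify)
      fix g k g' k'
      assume A: "g \<in> (N - V) \<rightarrow>\<^sub>E R" "k \<in> V \<rightarrow>\<^sub>E (R - g ` U)" "g' \<in> (N - V) \<rightarrow>\<^sub>E R" "k' \<in> V \<rightarrow>\<^sub>E (R - g' ` U)"
        and eq: "(\<lambda>y. if y \<in> V then k y else g y) = (\<lambda>y. if y \<in> V then k' y else g' y)"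
      have "g y = g' y" for y
        using A(1,3) fun_cong[OF eq, of y] by (cases "y \<in> V") (simp_all add: PiE_def extensional_def)
      moreover have "k y = k' y" for y
        using A(2,4) fun_cong[OF eq, of y] by (cases "y \<in> V") (simp_all add: PiE_def extensional_def)
      ultimately show "g = g' \<and> k = k'" by blast
    qed
    show "?merge ` ?\<Sigma> \<subseteq> {h \<in> N \<rightarrow>\<^sub>E R. h ` U \<inter> h ` V = {}}"
    proof clarify
      fix g k assume A: "g \<in> (N - V) \<rightarrow>\<^sub>E R" "k \<in> V \<rightarrow>\<^sub>E (R - g ` U)"
      let ?h = "\<lambda>y. if y \<in> V then k y else g y"
      have "?h ` U = g ` U" using UV by (intro image_cong) auto
      moreover have "?h ` V \<subseteq> R - g ` U" using A by auto
      moreover have "?h \<in> N \<rightarrow>\<^sub>E R" using A UV by (auto simp: PiE_iff extensional_def)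
      ultimately show "?h \<in> N \<rightarrow>\<^sub>E R \<and> ?h ` U \<inter> ?h ` V = {}" by blast
    qed
    show "finite {h \<in> N \<rightarrow>\<^sub>E R. h ` U \<inter> h ` V = {}}"
      using fin by (auto intro!: finite_PiE)
  qed
  finally show ?thesis by simp
qed

text \<open>A small set is a list of its elements padded with the dummy entry 0.\<close>

lemma card_bounded_subsets_le:
  "card {U. U \<subseteq> {1..n} \<and> card U \<le> M} \<le> (n + 1) ^ M"
proof -
  let ?L = "{xs. set xs \<subseteq> {0..n} \<and> length xs = M}"
  have "{U. U \<subseteq> {1..n} \<and> card U \<le> M} \<subseteq> (\<lambda>xs. set xs \<inter> {1..n}) ` ?L"
  proof clarify
    fix U assume U: "U \<subseteq> {1..n}" "card U \<le> M"
    then obtain ys where ys: "set ys = U" "distinct ys"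
      using finite_distinct_list[of U] finite_subset by blast
    define xs where "xs = ys @ replicate (M - card U) 0"
    have "set xs \<inter> {1..n} = U" using ys U by (auto simp: xs_def)
    moreover have "xs \<in> ?L" using ys U by (auto simp: xs_def distinct_card)
    ultimately show "U \<in> (\<lambda>xs. set xs \<inter> {1..n}) ` ?L" by blast
  qed
  then have "card {U. U \<subseteq> {1..n} \<and> card U \<le> M} \<le> card ((\<lambda>xs. set xs \<inter> {1..n}) ` ?L)"
    by (intro card_mono) (auto intro!: finite_lists_length_eq)
  also have "\<dots> \<le> card ?L" by (intro card_image_le finite_lists_length_eq) auto
  finally show ?thesis by (simp add: card_lists_length_eq)
qed

text \<open>The sets may have \<open>2 * m\<close> items because the functions must separate not
  only \<open>S\<close> from \<open>T\<close> but also one common item from the rest of both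
  supports.\<close>

lemma hash_family:
  assumes n: "n < 2 ^ m" and m: "m > 0" and R: "finite R" "4 * m \<le> card R"
    and v: "4 * m\<^sup>2 \<le> v * card R" and s: "4 * m\<^sup>2 \<le> 2 ^ s"
  obtains hash :: "nat \<Rightarrow> nat \<Rightarrow> 'r" where
    "\<And>\<sigma> i. \<sigma> < 2 ^ (3 * v + s) \<Longrightarrow> i \<in> {1..n} \<Longrightarrow> hash \<sigma> i \<in> R"
    "\<And>U V. U \<subseteq> {1..n} \<Longrightarrow> V \<subseteq> {1..n} \<Longrightarrow> card U \<le> 2 * m \<Longrightarrow> card V \<le> 2 * m \<Longrightarrow> U \<inter> V = {} \<Longrightarrow>
       \<exists>\<sigma><2 ^ (3 * v + s). hash \<sigma> ` U \<inter> hash \<sigma> ` V = {}"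
proof -
  let ?L = "2 ^ (3 * v + s) :: nat"
  let ?\<Omega> = "{1..n} \<rightarrow>\<^sub>E R"
  let ?S = "{U. U \<subseteq> {1..n} \<and> card U \<le> 2 * m}"
  let ?I = "{(U, V). U \<in> ?S \<and> V \<in> ?S \<and> U \<inter> V = {}}"
  let ?good = "\<lambda>(U, V) h. h ` U \<inter> h ` V = {}"
  let ?\<beta> = "exp (- 2 * real v)"
  have finI: "finite ?I" by (rule finite_subset[of _ "Pow {1..n} \<times> Pow {1..n}"]) auto
  have "card ?I \<le> card (?S \<times> ?S)" by (intro card_mono) auto
  also have "\<dots> \<le> (n + 1) ^ (2 * m) * (n + 1) ^ (2 * m)"
    unfolding card_cartesian_product by (intro mult_mono card_bounded_subsets_le) auto
  also have "\<dots> = (n + 1) ^ (4 * m)" by (simp add: power_add[symmetric])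
  also have "\<dots> \<le> (2 ^ m) ^ (4 * m)" using n by (intro power_mono) auto
  also have "\<dots> = 2 ^ (4 * m\<^sup>2)" by (simp add: power_mult[symmetric] power2_eq_square mult_ac)
  finally have "real (card ?I) \<le> real (2 ^ (4 * m\<^sup>2))" by (simp only: of_nat_le_iff)
  also have "\<dots> < exp 1 ^ (4 * m\<^sup>2)"
    using m exp_less_mono[OF ln_2_less_1] by (simp, intro power_strict_mono) auto
  also have "\<dots> = exp (real (4 * m\<^sup>2))" by (simp add: exp_of_nat_mult[symmetric])
  finally have cardI: "real (card ?I) < exp (real (4 * m\<^sup>2))" .
  \<comment> \<open>Source of the seed length: as e^2 < 8, the factor 8^v, worth
    \<open>3 * v\<close> bits, outweighs the success probability exp (-2 v). The remaining factor
    \<open>2 ^ s\<close> beats the union bound over fewer than exp (4 m^2) pairs.\<close>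
  have "1 \<le> ?\<beta> * 8 ^ v"
  proof -
    have "exp 2 \<le> (8::real)"
    proof -
      have "exp 2 = exp 1 * exp (1::real)" by (simp flip: exp_add)
      also have "\<dots> \<le> 2.72 * 2.72" using e_less_272 by (intro mult_mono) auto
      finally show ?thesis by simp
    qed
    then have "exp 2 ^ v \<le> (8::real) ^ v" by (intro power_mono) auto
    then show ?thesis by (simp add: exp_minus exp_of_nat_mult[symmetric] field_simps)
  qed
  then have "1 * real (2 ^ s) \<le> ?\<beta> * 8 ^ v * real (2 ^ s)" by (intro mult_right_mono) auto
  moreover have "real ?L = 8 ^ v * 2 ^ s" by (simp add: power_add power_mult)
  ultimately have "real (2 ^ s) \<le> ?\<beta> * real ?L" by simp
  moreover have "real (4 * m\<^sup>2) \<le> real (2 ^ s)" using s of_nat_mono by blast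
  ultimately have \<beta>L: "real (4 * m\<^sup>2) \<le> ?\<beta> * real ?L" by linarith
  have "(1 - ?\<beta>) ^ ?L \<le> exp (- ?\<beta>) ^ ?L"
    using exp_ge_add_one_self[of "- ?\<beta>"] by (intro power_mono) auto
  also have "\<dots> = exp (- (?\<beta> * real ?L))" by (simp add: exp_of_nat_mult[symmetric] mult.commute)
  also have "\<dots> \<le> exp (- real (4 * m\<^sup>2))" using \<beta>L by simp
  finally have "real (card ?I) * (1 - ?\<beta>) ^ ?L \<le> real (card ?I) * exp (- real (4 * m\<^sup>2))"
    by (intro mult_left_mono) auto
  also have "\<dots> < exp (real (4 * m\<^sup>2)) * exp (- real (4 * m\<^sup>2))"
    using cardI by (intro mult_strict_right_mono) auto
  also have "\<dots> = 1" by (simp flip: exp_add)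
  finally have small: "real (card ?I) * (1 - ?\<beta>) ^ ?L < 1" .
  have "R \<noteq> {}" using R m by auto
  then have ne: "?\<Omega> \<noteq> {}" by (simp add: PiE_eq_empty_iff)
  have good: "?\<beta> * real (card ?\<Omega>) \<le> real (card {h\<in>?\<Omega>. ?good i h})" if "i \<in> ?I" for i
  proof -
    obtain U V where i: "i = (U, V)" by (cases i)
    show ?thesis using that i m R v
      card_separating_functions[of "{1..n}" R U V "2 * m" v] by (simp add: power_mult_distrib)
  qed
  have fin: "finite ?\<Omega>" using R by (auto intro!: finite_PiE)
  have "\<exists>hs. set hs \<subseteq> ?\<Omega> \<and> length hs = ?L \<and> (\<forall>i\<in>?I. \<exists>h\<in>set hs. ?good i h)"
    by (rule covering_family[of ?\<Omega> ?I ?\<beta> ?good ?L, OF fin finI ne _ good small]) auto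
  then obtain hs where hs: "set hs \<subseteq> ?\<Omega> \<and> length hs = ?L \<and> (\<forall>i\<in>?I. \<exists>h\<in>set hs. ?good i h)" ..
  show ?thesis
  proof (rule that[of "\<lambda>\<sigma>. hs ! \<sigma>"])
    fix \<sigma> i :: nat assume "\<sigma> < ?L" "i \<in> {1..n}"
    then have "hs ! \<sigma> \<in> ?\<Omega>" using hs by (metis nth_mem subsetD)
    then show "(hs ! \<sigma>) i \<in> R" using \<open>i \<in> {1..n}\<close> by (rule PiE_mem)
  next
    fix U V :: "nat set"
    assume "U \<subseteq> {1..n}" "V \<subseteq> {1..n}" "card U \<le> 2 * m" "card V \<le> 2 * m" "U \<inter> V = {}"
    then have "\<exists>h\<in>set hs. ?good (U, V) h" by (intro hs[THEN conjunct2, THEN conjunct2, rule_format]) simp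
    then show "\<exists>\<sigma><?L. (hs ! \<sigma>) ` U \<inter> (hs ! \<sigma>) ` V = {}"
      using hs by (auto simp: in_set_conv_nth)
  qed
qed

section \<open>Schemes from streaming algorithms with a message\<close>

text \<open>Passage from abstract coins and states to bit strings. Coins become unary strings, which
  is harmless since the random string is not charged; states become strings of length
  \<open>w\<close>.\<close>

lemma verifier_of_automaton:
  fixes ini :: "'r \<Rightarrow> 's" and step :: "'r \<Rightarrow> 's \<Rightarrow> 'x symbol \<Rightarrow> 's" and ver :: "'r \<Rightarrow> 's \<Rightarrow> 'o option"
  assumes R: "finite R" "R \<noteq> {}" and Z: "finite Z" "card Z \<le> 2 ^ w"
    and ini: "\<And>\<rho>. \<rho> \<in> R \<Longrightarrow> ini \<rho> \<in> Z"
    and step: "\<And>\<rho> z y. \<rho> \<in> R \<Longrightarrow> z \<in> Z \<Longrightarrow> step \<rho> z y \<in> Z"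
  obtains V :: "('x, 'o) verifier" where "memory_bits V w"
    "\<And>ys A. measure_pmf.prob (verifier_coins V) {r. run V r ys \<in> A} =
       real (card {\<rho>\<in>R. ver \<rho> (foldl (step \<rho>) (ini \<rho>) ys) \<in> A}) / real (card R)"
proof -
  obtain f :: "'r \<Rightarrow> nat" where f: "inj_on f R"
    using finite_imp_inj_to_nat_seg[OF R(1)] by blast
  define enc where "enc \<rho> = replicate (f \<rho>) True" for \<rho>
  have enc: "inj_on enc R"
    using f unfolding enc_def inj_on_def by (metis length_replicate)
  \<comment> \<open>Strings outside the range of \<open>enc\<close>, like memory strings outside the
    range of \<open>g\<close> below, are read as an arbitrary legal value, because
    \<open>memory_bits\<close> quantifies over all of them.\<close>
  define dec where "dec r = (if r \<in> enc ` R then the_inv_into R enc r else (SOME \<rho>. \<rho> \<in> R))" for r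
  have dec_enc: "dec (enc \<rho>) = \<rho>" if "\<rho> \<in> R" for \<rho>
    using that enc by (simp add: dec_def the_inv_into_f_f)
  have dec: "dec r \<in> R" for r
    using R(2) the_inv_into_into[OF enc, of r R] by (auto simp: dec_def some_in_eq)
  let ?W = "{bs :: bits. length bs = w}"
  have W: "finite ?W" "card ?W = 2 ^ w"
    using finite_lists_length_eq[of "UNIV :: bool set" w] card_lists_length_eq[of "UNIV :: bool set" w]
    by simp_all
  obtain g where g: "g ` Z \<subseteq> ?W" "inj_on g Z"
    using card_le_inj[OF Z(1) W(1)] Z(2) W(2) by auto
  obtain \<rho>0 where "\<rho>0 \<in> R" using R(2) by blast
  then have Zne: "Z \<noteq> {}" using ini by blast
  define h where "h s = (if s \<in> g ` Z then the_inv_into Z g s else (SOME z. z \<in> Z))" for s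
  have h_g: "h (g z) = z" if "z \<in> Z" for z
    using that g by (simp add: h_def the_inv_into_f_f)
  have h: "h s \<in> Z" for s
    using Zne the_inv_into_into[OF g(2), of s Z] by (auto simp: h_def some_in_eq)
  define V :: "('x, 'o) verifier" where
    "V = \<lparr>verifier_coins = map_pmf enc (pmf_of_set R), init_mem = \<lambda>r. g (ini (dec r)),
          step_mem = \<lambda>r s y. g (step (dec r) (h s) y), verdict = \<lambda>r s. ver (dec r) (h s)\<rparr>"
  have fold: "foldl (step_mem V r) (g z) ys = g (foldl (step (dec r)) z ys) \<and>
      foldl (step (dec r)) z ys \<in> Z" if "z \<in> Z" for r z ys
    using that by (induction ys arbitrary: z) (auto simp: V_def h_g step dec)
  have run: "run V r ys = ver (dec r) (foldl (step (dec r)) (ini (dec r)) ys)" for r ys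
    using fold[OF ini[OF dec], of r r ys] by (simp add: run_def V_def h_g)
  show ?thesis
  proof (rule that[of V])
    show "memory_bits V w"
      using subsetD[OF g(1), OF imageI, OF ini[OF dec]] subsetD[OF g(1), OF imageI, OF step[OF dec h]]
      by (simp add: memory_bits_def V_def)
    show "measure_pmf.prob (verifier_coins V) {r. run V r ys \<in> A} =
       real (card {\<rho>\<in>R. ver \<rho> (foldl (step \<rho>) (ini \<rho>) ys) \<in> A}) / real (card R)" for ys A
    proof -
      have "R \<inter> enc -` {r. run V r ys \<in> A} = {\<rho>\<in>R. ver \<rho> (foldl (step \<rho>) (ini \<rho>) ys) \<in> A}"
        by (auto simp: run dec_enc)
      then show ?thesis using R by (simp add: V_def measure_pmf_of_set)
    qed
  qed
qed

text \<open>
  The whole annotation may be buffered because the bounds for annotation and memory agree.  The verifier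
  ignores further bits and rejects if a stream element arrives before the buffer is full, so that
  a cheating prover cannot adapt the message to the position in the stream.
\<close>

definition buffered_step ::
  "nat \<Rightarrow> (bits \<Rightarrow> 'z \<Rightarrow> 'x \<Rightarrow> 'z) \<Rightarrow> (bits \<times> 'z) option \<Rightarrow> 'x symbol \<Rightarrow> (bits \<times> 'z) option"
  where
  "buffered_step c upd s y = (case s of None \<Rightarrow> None | Some (\<beta>, z) \<Rightarrow>
     (case y of Annot b \<Rightarrow> Some (if length \<beta> < c then \<beta> @ [b] else \<beta>, z)
      | Elem x \<Rightarrow> if length \<beta> < c then None else Some (\<beta>, upd \<beta> z x)))"

lemma buffered_step_simps [simp]:
  "buffered_step c upd None y = None"
  "buffered_step c upd (Some (\<beta>, z)) (Annot b) = Some (if length \<beta> < c then \<beta> @ [b] else \<beta>, z)"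
  "buffered_step c upd (Some (\<beta>, z)) (Elem x) = (if length \<beta> < c then None else Some (\<beta>, upd \<beta> z x))"
  by (simp_all add: buffered_step_def)

primrec symbol_elems :: "'x symbol \<Rightarrow> 'x list" where
  "symbol_elems (Elem x) = [x]"
| "symbol_elems (Annot b) = []"

primrec symbol_annots :: "'x symbol \<Rightarrow> bits" where
  "symbol_annots (Elem x) = []"
| "symbol_annots (Annot b) = [b]"

text \<open>Stream elements are processed only once the buffer is full and hence final, so a run
  that has not died is a run with the single message \<open>\<beta>\<close>. The last conjunct
  carries the induction.\<close>

lemma buffered_step_invariant:
  assumes "foldl (buffered_step c upd) (Some ([], z0)) ys = Some (\<beta>, z)"
  shows "\<beta> = take c (concat (map symbol_annots ys)) \<and> z = foldl (upd \<beta>) z0 (concat (map symbol_elems ys)) \<and>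
    (length \<beta> < c \<longrightarrow> concat (map symbol_elems ys) = [])"
  using assms
proof (induction ys arbitrary: \<beta> z rule: rev_induct)
  case Nil
  then show ?case by auto
next
  case (snoc y ys)
  then obtain \<beta>' z' where s: "foldl (buffered_step c upd) (Some ([], z0)) ys = Some (\<beta>', z')"
    by (cases "foldl (buffered_step c upd) (Some ([], z0)) ys") auto
  note IH = snoc.IH[OF s]
  show ?case
  proof (cases y)
    case (Elem x)
    then show ?thesis using snoc.prems s IH
      by (auto split: if_splits)
  next
    case (Annot b)
    show ?thesis
    proof (cases "length \<beta>' < c")
      case True
      then have "length (concat (map symbol_annots ys)) < c" using IH by (auto simp: min_def split: if_splits)
      moreover have "concat (map symbol_elems ys) = []" using IH True by blast
      ultimately show ?thesis using snoc.prems s IH Annot True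
        by (auto simp del: concat_eq_Nil_conv)
    next
      case False
      then have "\<not> length (concat (map symbol_annots ys)) < c" using IH by (auto simp: min_def split: if_splits)
      then show ?thesis using snoc.prems s IH Annot False
        by auto
    qed
  qed
qed

lemma foldl_buffered_step_Annot:
  "length \<beta> + length \<alpha> \<le> c \<Longrightarrow>
     foldl (buffered_step c upd) (Some (\<beta>, z)) (map Annot \<alpha>) = Some (\<beta> @ \<alpha>, z)"
  by (induction \<alpha> arbitrary: \<beta>) auto

lemma foldl_buffered_step_Elem:
  "\<not> length \<beta> < c \<Longrightarrow>
     foldl (buffered_step c upd) (Some (\<beta>, z)) (map Elem xs) = Some (\<beta>, foldl (upd \<beta>) z xs)"
  by (induction xs arbitrary: z) auto

lemma symbol_elems_annotated: "concat (map symbol_elems (annotated a xs)) = xs"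
proof -
  have annots: "concat (map symbol_elems (map Annot \<alpha>)) = []" for \<alpha> :: bits
    by (induction \<alpha>) auto
  have "concat (map symbol_elems (concat (map (\<lambda>i. Elem (xs ! i) # map Annot (a (Suc i))) is))) =
      map ((!) xs) is" for "is"
    by (induction "is") (use annots in \<open>auto simp: comp_def\<close>)
  then show ?thesis
    using annots by (simp add: annotated_def map_nth)
qed

lemma annotated_initial:
  assumes "\<And>i. a (Suc i) = []"
  shows "annotated a xs = map Annot (a 0) @ map Elem xs"
proof -
  have "concat (map (\<lambda>i. Elem (xs ! i) # map Annot (a (Suc i))) is) = map Elem (map ((!) xs) is)" for "is"
    by (induction "is") (auto simp: assms)
  then show ?thesis by (simp add: annotated_def map_nth del: map_map)
qed

text \<open>Every annotation sequence reduces to a message: a surviving run behaves as if the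
  message decoded from the first \<open>c\<close> annotation bits had been given in advance. So
  soundness against fixed messages is enough.\<close>

lemma scheme_of_message_algorithm:
  fixes X :: "'x list set" and F :: "'x list \<Rightarrow> 'o" and z0 :: 'z and upd :: "'r \<Rightarrow> 'm \<Rightarrow> 'z \<Rightarrow> 'x \<Rightarrow> 'z"
    and ver :: "'r \<Rightarrow> 'm \<Rightarrow> 'z \<Rightarrow> 'o option"
  assumes R: "finite R" "R \<noteq> {}" and M: "finite M" "M \<noteq> {}" "card M \<le> 2 ^ c"
    and Z: "finite Z" "card Z \<le> 2 ^ d" "z0 \<in> Z"
    and upd: "\<And>\<rho> \<mu> z x. \<rho> \<in> R \<Longrightarrow> \<mu> \<in> M \<Longrightarrow> z \<in> Z \<Longrightarrow> upd \<rho> \<mu> z x \<in> Z"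
    and complete: "\<And>xs. xs \<in> X \<Longrightarrow> \<exists>\<mu>\<in>M. \<forall>\<rho>\<in>R. ver \<rho> \<mu> (foldl (upd \<rho> \<mu>) z0 xs) = Some (F xs)"
    and sound: "\<And>xs \<mu>. xs \<in> X \<Longrightarrow> \<mu> \<in> M \<Longrightarrow>
      3 * card {\<rho>\<in>R. ver \<rho> \<mu> (foldl (upd \<rho> \<mu>) z0 xs) \<notin> {Some (F xs), None}} \<le> card R"
  shows "\<exists>(P :: 'x prover) (V :: ('x, 'o) verifier). annotation_bits X P c \<and> memory_bits V (c + 1 + d) \<and>
    completeness_error X F P V 0 \<and> soundness_error X F V (1/3)"
proof -
  let ?W = "{bs :: bits. length bs = c}"
  have W: "finite ?W" "card ?W = 2 ^ c"
    using finite_lists_length_eq[of "UNIV :: bool set" c] card_lists_length_eq[of "UNIV :: bool set" c]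
    by simp_all
  obtain enc where enc: "enc ` M \<subseteq> ?W" "inj_on enc M"
    using card_le_inj[OF M(1) W(1)] M(3) W(2) by auto
  define dec where "dec s = (if s \<in> enc ` M then the_inv_into M enc s else (SOME z. z \<in> M))" for s
  have dec_enc: "dec (enc \<mu>) = \<mu>" if "\<mu> \<in> M" for \<mu>
    using that enc by (simp add: dec_def the_inv_into_f_f)
  have dec: "dec s \<in> M" for s
    using M(2) the_inv_into_into[OF enc(2), of s M] by (auto simp: dec_def some_in_eq)
  let ?B = "{\<beta> :: bits. length \<beta> \<le> c}"
  have B: "finite ?B" "card ?B < 2 ^ (c + 1)"
  proof -
    show "finite ?B" using finite_lists_length_le[of "UNIV :: bool set" c] by simp
    have "card ?B = (\<Sum>i\<le>c. 2 ^ i)" using card_lists_length_le[of "UNIV :: bool set" c] by simp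
    also have "\<dots> < 2 ^ (c + 1)" by (induction c) auto
    finally show "card ?B < 2 ^ (c + 1)" .
  qed
  let ?S = "insert None (Some ` (?B \<times> Z))"
  have "card ?S \<le> Suc (card (?B \<times> Z))"
    using B(1) Z(1) by (simp add: card_insert_if card_image card_image_le)
  \<comment> \<open>There are at most 2^(c+1) - 1 buffers, partial ones included; the dead state
    \<open>None\<close> fits into the remaining place.\<close>
  also have "\<dots> \<le> card Z + card ?B * card Z"
    using Z by (simp add: card_cartesian_product Suc_le_eq card_gt_0_iff) blast
  also have "\<dots> = (card ?B + 1) * card Z" by simp
  also have "\<dots> \<le> 2 ^ (c + 1) * 2 ^ d" using B(2) Z(2) by (intro mult_mono) auto
  finally have cardS: "card ?S \<le> 2 ^ (c + 1 + d)" by (simp add: power_add)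
  let ?step = "\<lambda>\<rho>. buffered_step c (\<lambda>\<beta>. upd \<rho> (dec \<beta>))"
  define out where "out \<rho> s = (case s of None \<Rightarrow> None | Some (\<beta>, z) \<Rightarrow>
      if length \<beta> < c then None else ver \<rho> (dec \<beta>) z)" for \<rho> s
  have closed: "?step \<rho> s y \<in> ?S" if "\<rho> \<in> R" "s \<in> ?S" for \<rho> s y
    using that upd dec by (cases y) auto
  obtain V :: "('x, 'o) verifier" where V: "memory_bits V (c + 1 + d)"
    "\<And>ys A. measure_pmf.prob (verifier_coins V) {r. run V r ys \<in> A} =
       real (card {\<rho>\<in>R. out \<rho> (foldl (?step \<rho>) (Some ([], z0)) ys) \<in> A}) / real (card R)"
    by (rule verifier_of_automaton[OF R, of ?S "c + 1 + d" "\<lambda>_. Some ([], z0)" ?step out])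
      (use B Z cardS closed in auto)
  obtain msg where msg: "\<And>xs. xs \<in> X \<Longrightarrow> msg xs \<in> M"
    "\<And>xs \<rho>. xs \<in> X \<Longrightarrow> \<rho> \<in> R \<Longrightarrow> ver \<rho> (msg xs) (foldl (upd \<rho> (msg xs)) z0 xs) = Some (F xs)"
    using complete by metis
  define P :: "'x prover" where
    "P = \<lparr>prover_coins = return_pmf [], annotation = \<lambda>i xs r. if i = 0 then enc (msg xs) else []\<rparr>"
  have len: "length (enc (msg xs)) = c" if "xs \<in> X" for xs
    using msg(1)[OF that] enc(1) by blast
  have "annotation_bits X P c"
    unfolding annotation_bits_def
    by (rule exI[of _ "\<lambda>N i. if i = 0 then c else 0"]) (auto simp: P_def len)
  moreover have "completeness_error X F P V 0"
    unfolding completeness_error_def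
  proof
    fix xs assume xs: "xs \<in> X"
    let ?ys = "annotated (\<lambda>i. annotation P i xs []) xs"
    have "?ys = map Annot (enc (msg xs)) @ map Elem xs"
      by (subst annotated_initial) (auto simp: P_def)
    then have "foldl (?step \<rho>) (Some ([], z0)) ?ys = Some (enc (msg xs), foldl (upd \<rho> (msg xs)) z0 xs)" for \<rho>
      using len[OF xs] msg(1)[OF xs] by (simp add: foldl_buffered_step_Annot foldl_buffered_step_Elem dec_enc)
    then have none: "{\<rho>\<in>R. out \<rho> (foldl (?step \<rho>) (Some ([], z0)) ?ys) \<in> - {Some (F xs)}} = {}"
      using len[OF xs] msg[OF xs] by (auto simp: out_def dec_enc)
    have "measure_pmf.prob (verifier_coins V) {r. run V r ?ys \<in> - {Some (F xs)}} = 0"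
      unfolding V(2) none by simp
    then show "measure_pmf.prob (pair_pmf (prover_coins P) (verifier_coins V))
        {(r\<^sub>P, r\<^sub>V). run V r\<^sub>V (annotated (\<lambda>i. annotation P i xs r\<^sub>P) xs) \<noteq> Some (F xs)} \<le> 0"
      by (simp add: P_def pair_return_pmf1 vimage_def)
  qed
  moreover have "soundness_error X F V (1/3)"
    unfolding soundness_error_def
  proof (intro ballI allI)
    fix xs a assume xs: "xs \<in> X"
    let ?\<beta> = "take c (concat (map symbol_annots (annotated a xs)))"
    let ?bad = "{\<rho>\<in>R. ver \<rho> (dec ?\<beta>) (foldl (upd \<rho> (dec ?\<beta>)) z0 xs) \<notin> {Some (F xs), None}}"
    have "{\<rho>\<in>R. out \<rho> (foldl (?step \<rho>) (Some ([], z0)) (annotated a xs)) \<in> - {Some (F xs), None}} \<subseteq> ?bad"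
    proof
      fix \<rho> assume \<rho>: "\<rho> \<in> {\<rho>\<in>R. out \<rho> (foldl (?step \<rho>) (Some ([], z0)) (annotated a xs)) \<in> - {Some (F xs), None}}"
      then have bad: "out \<rho> (foldl (?step \<rho>) (Some ([], z0)) (annotated a xs)) \<notin> {Some (F xs), None}" by simp
      then obtain \<beta> z where s: "foldl (?step \<rho>) (Some ([], z0)) (annotated a xs) = Some (\<beta>, z)"
        by (cases "foldl (?step \<rho>) (Some ([], z0)) (annotated a xs)") (auto simp: out_def)
      note inv = buffered_step_invariant[OF s, unfolded symbol_elems_annotated]
      have eqs: "?\<beta> = \<beta>" "foldl (upd \<rho> (dec \<beta>)) z0 xs = z"
        by (rule inv[THEN conjunct1, symmetric], rule inv[THEN conjunct2, THEN conjunct1, symmetric])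
      have "out \<rho> (Some (\<beta>, z)) = ver \<rho> (dec \<beta>) z \<or> out \<rho> (Some (\<beta>, z)) = None"
        by (simp add: out_def)
      then have "ver \<rho> (dec \<beta>) z \<notin> {Some (F xs), None}" using bad unfolding s by auto
      then show "\<rho> \<in> ?bad" using \<rho> eqs by simp
    qed
    then have "card {\<rho>\<in>R. out \<rho> (foldl (?step \<rho>) (Some ([], z0)) (annotated a xs)) \<in> - {Some (F xs), None}}
        \<le> card ?bad"
      using R(1) by (intro card_mono) auto
    then have "3 * card {\<rho>\<in>R. out \<rho> (foldl (?step \<rho>) (Some ([], z0)) (annotated a xs)) \<in> - {Some (F xs), None}}
        \<le> card R"
      using sound[OF xs dec[of ?\<beta>]] by linarith
    moreover have "0 < card R" using R by (simp add: card_gt_0_iff)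
    ultimately have "measure_pmf.prob (verifier_coins V)
        {r. run V r (annotated a xs) \<in> - {Some (F xs), None}} \<le> 1/3"
      unfolding V(2) by (simp add: divide_le_eq)
    then show "measure_pmf.prob (verifier_coins V)
        {r. run V r (annotated a xs) \<notin> {Some (F xs), None}} \<le> 1/3" by simp
  qed
  ultimately show ?thesis using V(1) by blast
qed

section \<open>Linear sketches\<close>

text \<open>At a zero of the form the other coordinates determine \<open>r i\<close> modulo
  \<open>p\<close>, so a random \<open>r\<close> is a zero with probability at most 1/p.\<close>

lemma card_linear_form_zeros_mod_prime:
  fixes p :: int and c :: "'a \<Rightarrow> int"
  assumes p: "prime p" and N: "finite N" "i \<in> N" "\<not> p dvd c i"
  shows "card {r \<in> N \<rightarrow>\<^sub>E {0..<p}. p dvd (\<Sum>j\<in>N. c j * r j)} * nat p \<le> card (N \<rightarrow>\<^sub>E {0..<p})"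
proof -
  let ?Z = "{r \<in> N \<rightarrow>\<^sub>E {0..<p}. p dvd (\<Sum>j\<in>N. c j * r j)}"
  let ?T = "(N - {i}) \<rightarrow>\<^sub>E {0..<p}"
  have "inj_on (\<lambda>r. restrict r (N - {i})) ?Z"
  proof (rule inj_onI)
    fix r s assume r: "r \<in> ?Z" and s: "s \<in> ?Z" and eq: "restrict r (N - {i}) = restrict s (N - {i})"
    have same: "r j = s j" if "j \<in> N - {i}" for j
      using fun_cong[OF eq, of j] that by simp
    have "p dvd (\<Sum>j\<in>N. c j * r j) - (\<Sum>j\<in>N. c j * s j)" using r s by (intro dvd_diff) auto
    also have "(\<Sum>j\<in>N. c j * r j) - (\<Sum>j\<in>N. c j * s j) = c i * (r i - s i)"
      using N same by (simp add: sum.remove[of N i] algebra_simps)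
    finally have "p dvd r i - s i" using p N(3) prime_dvd_mult_iff by blast
    then have "r i mod p = s i mod p" by (simp add: mod_eq_dvd_iff)
    moreover have "r i \<in> {0..<p}" "s i \<in> {0..<p}" using r s N by auto
    ultimately have "r i = s i" by simp
    then show "r = s" using r s same N by (intro PiE_ext[of r N _ s]) (blast | simp)+
  qed
  moreover have "(\<lambda>r. restrict r (N - {i})) ` ?Z \<subseteq> ?T"
    by (simp add: image_subset_iff PiE_iff)
  ultimately have "card ?Z \<le> card ?T" using N by (intro card_inj_on_le) (auto intro!: finite_PiE)
  also have "card ?T * nat p = card (N \<rightarrow>\<^sub>E {0..<p})"
    using N by (simp add: card_PiE card.remove[of N i] mult.commute del: card_Diff_insert)
  finally show ?thesis by simp
qed

definition sketch_step :: "int \<Rightarrow> 'j set \<Rightarrow> ('j \<Rightarrow> 'v \<Rightarrow> int) \<Rightarrow> ('j \<Rightarrow> int) \<Rightarrow> 'v \<times> int \<Rightarrow> 'j \<Rightarrow> int" where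
  "sketch_step p J coef z u = (\<lambda>j\<in>J. (z j + snd u * coef j (fst u)) mod p)"

lemma foldl_sketch_step:
  assumes "j \<in> J"
  shows "foldl (sketch_step p J coef) (\<lambda>j\<in>J. 0) xs j = (\<Sum>u\<leftarrow>xs. snd u * coef j (fst u)) mod p"
  by (induction xs rule: rev_induct) (use assms in \<open>auto simp: sketch_step_def mod_simps\<close>)

lemma sum_list_updates:
  assumes "fst ` set xs \<subseteq> U" "finite U"
  shows "(\<Sum>u\<leftarrow>xs. snd u * g (fst u)) = (\<Sum>v\<in>U. frequency xs v * g v)"
  using assms(1)
proof (induction xs)
  case Nil
  then show ?case by (simp add: frequency_def)
next
  case (Cons u xs)
  have "frequency (u # xs) v * g v = (if fst u = v then snd u * g v else 0) + frequency xs v * g v" for v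
    by (simp add: frequency_def algebra_simps)
  then show ?case using Cons assms(2) by (simp add: sum.distrib)
qed

lemma disj_streams_frequency:
  assumes "xs \<in> disj_streams n m B"
  shows "fst ` set xs \<subseteq> {0, 1} \<times> {1..n}" "frequency xs v \<ge> 0"
    and "b \<in> {0, 1} \<Longrightarrow> i \<in> {1..n} \<Longrightarrow> frequency xs (b, i) \<le> int B"
    and "b \<in> {0, 1} \<Longrightarrow> card {i\<in>{1..n}. frequency xs (b, i) > 0} \<le> m"
    and "m_disj n xs \<longleftrightarrow> (\<forall>i\<in>{1..n}. frequency xs (0, i) = 0 \<or> frequency xs (1, i) = 0)"
proof -
  show nonneg: "frequency xs v \<ge> 0" for v
    using assms unfolding disj_streams_def strict_turnstile_def by (metis (mono_tags, lifting) mem_Collect_eq order_refl take_all)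
  show "fst ` set xs \<subseteq> {0, 1} \<times> {1..n}"
    using assms unfolding disj_streams_def strict_turnstile_def by blast
  have count: "count (stream_mset n b xs) i = (if i \<in> {1..n} then nat (frequency xs (b, i)) else 0)" for b i
    by (simp add: stream_mset_def count_sum)
  have set: "set_mset (stream_mset n b xs) = {i\<in>{1..n}. frequency xs (b, i) > 0}" for b
    by (auto simp flip: count_greater_zero_iff simp: count split: if_splits)
  have bounds: "card (set_mset (stream_mset n b xs)) \<le> m" "count (stream_mset n b xs) i \<le> B" if "b \<in> {0, 1}" for b i
    using assms that unfolding disj_streams_def by blast+
  show "card {i\<in>{1..n}. frequency xs (b, i) > 0} \<le> m" if "b \<in> {0, 1}"
    using bounds(1)[OF that] by (simp only: set)
  show "frequency xs (b, i) \<le> int B" if "b \<in> {0, 1}" "i \<in> {1..n}"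
    using bounds(2)[OF that(1), of i] that(2) by (simp add: count)
  show "m_disj n xs \<longleftrightarrow> (\<forall>i\<in>{1..n}. frequency xs (0, i) = 0 \<or> frequency xs (1, i) = 0)"
    using nonneg[of "(0, _)"] nonneg[of "(1, _)"] unfolding m_disj_def set
    by (auto simp: less_le) 
qed

text \<open>Coefficient of the \<open>e\<close>-th power in the sum, over the grid rows, of the row
  polynomial of \<open>f\<close> times the reversed row polynomial of \<open>g\<close>. The
  subtraction does not truncate while \<open>h\<close> maps into the grid.\<close>

definition grid_correlation ::
  "nat \<Rightarrow> nat \<Rightarrow> (nat \<Rightarrow> nat \<times> nat) \<Rightarrow> (nat \<Rightarrow> int) \<Rightarrow> (nat \<Rightarrow> int) \<Rightarrow> nat \<Rightarrow> int" where
  "grid_correlation n a h f g e = (\<Sum>i\<in>{1..n}. \<Sum>j\<in>{1..n}.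
     if fst (h i) = fst (h j) \<and> snd (h i) + (a - 1 - snd (h j)) = e then f i * g j else 0)"

text \<open>The reversal of the exponents of \<open>g\<close> collects the inner product of the hashed vectors in the
  middle coefficient.\<close>

lemma sum_row_products:
  fixes \<rho> :: int
  assumes h: "\<And>i. i \<in> {1..n} \<Longrightarrow> h i \<in> {..<a} \<times> {..<a}"
  shows "(\<Sum>x<a. (\<Sum>i\<in>{1..n}. f i * (if fst (h i) = x then \<rho> ^ snd (h i) else 0)) *
      (\<Sum>j\<in>{1..n}. g j * (if fst (h j) = x then \<rho> ^ (a - 1 - snd (h j)) else 0))) =
    (\<Sum>e<2 * a - 1. grid_correlation n a h f g e * \<rho> ^ e)"
proof -
  let ?t = "\<lambda>i j. f i * g j * \<rho> ^ (snd (h i) + (a - 1 - snd (h j)))"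
  have "(\<Sum>x<a. (\<Sum>i\<in>{1..n}. f i * (if fst (h i) = x then \<rho> ^ snd (h i) else 0)) *
      (\<Sum>j\<in>{1..n}. g j * (if fst (h j) = x then \<rho> ^ (a - 1 - snd (h j)) else 0))) =
      (\<Sum>x<a. \<Sum>i\<in>{1..n}. \<Sum>j\<in>{1..n}. if fst (h i) = x then if fst (h j) = x then ?t i j else 0 else 0)"
    unfolding sum_product by (intro sum.cong refl) (auto simp: power_add)
  also have "\<dots> = (\<Sum>i\<in>{1..n}. \<Sum>j\<in>{1..n}. \<Sum>x<a. if fst (h i) = x then if fst (h j) = x then ?t i j else 0 else 0)"
    by (simp only: sum.swap[of _ "{1..n}" "{..<a}"])
  also have "\<dots> = (\<Sum>i\<in>{1..n}. \<Sum>j\<in>{1..n}. if fst (h i) = fst (h j) then ?t i j else 0)"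
  proof (intro sum.cong refl)
    fix i j assume "i \<in> {1..n}" "j \<in> {1..n}"
    then have "fst (h i) \<in> {..<a}" using h[of i] by (simp add: mem_Times_iff)
    then show "(\<Sum>x<a. if fst (h i) = x then if fst (h j) = x then ?t i j else 0 else 0) =
        (if fst (h i) = fst (h j) then ?t i j else 0)"
      by (subst sum.delta') auto
  qed
  also have "\<dots> = (\<Sum>i\<in>{1..n}. \<Sum>j\<in>{1..n}. \<Sum>e<2 * a - 1.
      if snd (h i) + (a - 1 - snd (h j)) = e then if fst (h i) = fst (h j) then f i * g j * \<rho> ^ e else 0 else 0)"
  proof (intro sum.cong refl)
    fix i j assume "i \<in> {1..n}" "j \<in> {1..n}"
    then have "snd (h i) + (a - 1 - snd (h j)) \<in> {..<2 * a - 1}"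
      using h[of i] h[of j] by (auto simp add: mem_Times_iff)
    then show "(if fst (h i) = fst (h j) then ?t i j else 0) = (\<Sum>e<2 * a - 1.
        if snd (h i) + (a - 1 - snd (h j)) = e then if fst (h i) = fst (h j) then f i * g j * \<rho> ^ e else 0 else 0)"
      by (subst sum.delta') auto
  qed
  also have "\<dots> = (\<Sum>e<2 * a - 1. \<Sum>i\<in>{1..n}. \<Sum>j\<in>{1..n}.
      if snd (h i) + (a - 1 - snd (h j)) = e then if fst (h i) = fst (h j) then f i * g j * \<rho> ^ e else 0 else 0)"
    by (simp only: sum.swap[of _ "{1..n}" "{..<2 * a - 1}"])
  also have "\<dots> = (\<Sum>e<2 * a - 1. grid_correlation n a h f g e * \<rho> ^ e)"
    unfolding grid_correlation_def sum_distrib_right by (intro sum.cong refl) auto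
  finally show ?thesis .
qed

lemma grid_correlation_middle:
  assumes h: "\<And>i. i \<in> {1..n} \<Longrightarrow> h i \<in> {..<a} \<times> {..<a}"
  shows "grid_correlation n a h f g (a - 1) =
    (\<Sum>i\<in>{1..n}. \<Sum>j\<in>{1..n}. if h i = h j then f i * g j else 0)"
proof -
  have "fst (h i) = fst (h j) \<and> snd (h i) + (a - 1 - snd (h j)) = a - 1 \<longleftrightarrow> h i = h j"
    if "i \<in> {1..n}" "j \<in> {1..n}" for i j
    using h[OF that(1)] h[OF that(2)] by (cases "h i"; cases "h j") auto
  then show ?thesis unfolding grid_correlation_def by (intro sum.cong refl) simp
qed

lemma sum_bounded_support:
  fixes n :: nat
  assumes "\<And>i. i \<in> {1..n} \<Longrightarrow> 0 \<le> f i \<and> f i \<le> int B" "card {i\<in>{1..n}. f i > 0} \<le> m"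
  shows "(\<Sum>i\<in>{1..n}. f i) \<le> int (m * B)"
proof -
  have "(\<Sum>i\<in>{1..n}. f i) = (\<Sum>i | i \<in> {1..n} \<and> f i > 0. f i)"
  proof (rule sum.mono_neutral_right)
    show "\<forall>i\<in>{1..n} - {i \<in> {1..n}. 0 < f i}. f i = 0"
      using assms(1) by (metis (no_types, lifting) Diff_iff linorder_not_less mem_Collect_eq order_antisym)
  qed auto
  also have "\<dots> \<le> int (card {i\<in>{1..n}. f i > 0}) * int B"
    using assms(1) by (intro sum_bounded_above) auto
  also have "\<dots> \<le> int m * int B" using assms(2) by (intro mult_right_mono) auto
  finally show ?thesis by simp
qed

section \<open>The scheme for m-DISJ\<close>

text \<open>
  A message of the prover consists of a seed \<open>\<sigma>\<close> of a hash function onto an \<open>a\<close> by \<open>a\<close> grid, and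
  either the coefficients \<open>G\<close> of the polynomial of lemma \<open>sum_row_products\<close>, or a grid point \<open>y\<close>
  which is hit by exactly one element of \<open>S\<close> and of \<open>T\<close>.  The coins of the verifier are a point \<open>\<rho>\<close> at
  which the polynomial is evaluated and a fingerprint \<open>r i\<close> for each item \<open>i\<close>.
\<close>

type_synonym disj_message = "nat \<times> ((nat \<Rightarrow> int) + (nat \<times> nat))"

text \<open>For a polynomial message, counter \<open>x\<close> is the polynomial of row
  \<open>x\<close> at the random point, reversed for \<open>T\<close>. For a grid point, counter 0
  is the number of copies that land there and counter 1 their total fingerprint.\<close>

definition disj_weight ::
  "(nat \<Rightarrow> nat \<Rightarrow> nat \<times> nat) \<Rightarrow> nat \<Rightarrow> int \<times> (nat \<Rightarrow> int) \<Rightarrow> disj_message \<Rightarrow> nat \<Rightarrow> nat \<Rightarrow> nat \<Rightarrow> int" where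
  "disj_weight hash a \<omega> \<mu> b x i = (let h = hash (fst \<mu>) in case snd \<mu> of
     Inl G \<Rightarrow> if fst (h i) = x then fst \<omega> ^ (if b = 0 then snd (h i) else a - 1 - snd (h i)) else 0
   | Inr y \<Rightarrow> if h i = y then (if x = 0 then 1 else snd \<omega> i) else 0)"

definition disj_coef ::
  "(nat \<Rightarrow> nat \<Rightarrow> nat \<times> nat) \<Rightarrow> nat \<Rightarrow> int \<times> (nat \<Rightarrow> int) \<Rightarrow> disj_message \<Rightarrow> nat \<times> nat \<Rightarrow> nat \<times> nat \<Rightarrow> int" where
  "disj_coef hash a \<omega> \<mu> j v = (if fst j = fst v then disj_weight hash a \<omega> \<mu> (fst j) (snd j) (snd v) else 0)"

text \<open>The test for a grid point compares the mean fingerprints of \<open>S\<close> and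
  \<open>T\<close> there by cross multiplication: if a single common item lands on \<open>y\<close>,
  both means equal its random value.\<close>

definition disj_verdict ::
  "nat \<Rightarrow> int \<Rightarrow> int \<times> (nat \<Rightarrow> int) \<Rightarrow> disj_message \<Rightarrow> (nat \<times> nat \<Rightarrow> int) \<Rightarrow> bool option" where
  "disj_verdict a p \<omega> \<mu> z = (case snd \<mu> of
     Inl G \<Rightarrow> if p dvd G (a - 1) \<and> p dvd (\<Sum>x<a. z (0, x) * z (1, x)) - (\<Sum>e<2 * a - 1. G e * fst \<omega> ^ e)
       then Some True else None
   | Inr y \<Rightarrow> if \<not> p dvd z (0, 0) \<and> \<not> p dvd z (1, 0) \<and> p dvd z (1, 0) * z (0, 1) - z (0, 0) * z (1, 1)
       then Some False else None)"

lemma sketch_of_disj_stream: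
  assumes xs: "xs \<in> disj_streams n m B" and "b \<in> {0, 1}" "x < a"
  shows "foldl (sketch_step p ({0, 1} \<times> {..<a}) (disj_coef hash a \<omega> \<mu>)) (\<lambda>j\<in>{0, 1} \<times> {..<a}. 0) xs (b, x) =
    (\<Sum>i\<in>{1..n}. frequency xs (b, i) * disj_weight hash a \<omega> \<mu> b x i) mod p"
proof -
  have "(\<Sum>u\<leftarrow>xs. snd u * disj_coef hash a \<omega> \<mu> (b, x) (fst u)) =
      (\<Sum>v\<in>{0, 1} \<times> {1..n}. frequency xs v * disj_coef hash a \<omega> \<mu> (b, x) v)"
    using disj_streams_frequency(1)[OF xs] by (intro sum_list_updates) auto
  also have "\<dots> = (\<Sum>b'\<in>{0, 1}. \<Sum>i\<in>{1..n}. frequency xs (b', i) * disj_coef hash a \<omega> \<mu> (b, x) (b', i))"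
    by (subst sum.cartesian_product) auto
  also have "\<dots> = (\<Sum>i\<in>{1..n}. frequency xs (b, i) * disj_weight hash a \<omega> \<mu> b x i)"
    using assms(2) by (auto simp: disj_coef_def)
  finally show ?thesis using assms by (subst foldl_sketch_step) auto
qed

lemma mod_sum_products_dvd_iff:
  fixes A C :: "nat \<Rightarrow> int"
  shows "p dvd (\<Sum>x<a. A x mod p * (C x mod p)) - w \<longleftrightarrow> p dvd (\<Sum>x<a. A x * C x) - w"
proof -
  have "(\<Sum>x<a. A x mod p * (C x mod p)) mod p = (\<Sum>x<a. A x * C x) mod p"
    by (subst mod_sum_eq[symmetric]) (simp add: mod_mult_eq mod_sum_eq)
  then show ?thesis by (simp only: mod_eq_dvd_iff[symmetric])
qed

lemma disj_sketch_row_products: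
  fixes p :: int and G :: "nat \<Rightarrow> int" and \<omega> :: "int \<times> (nat \<Rightarrow> int)"
  assumes xs: "xs \<in> disj_streams n m B"
    and h: "\<And>i. i \<in> {1..n} \<Longrightarrow> hash \<sigma> i \<in> {..<a} \<times> {..<a}"
  defines "z \<equiv> foldl (sketch_step p ({0, 1} \<times> {..<a}) (disj_coef hash a \<omega> (\<sigma>, Inl G)))
    (\<lambda>j\<in>{0, 1} \<times> {..<a}. 0) xs"
  shows "p dvd (\<Sum>x<a. z (0, x) * z (1, x)) - w \<longleftrightarrow>
    p dvd (\<Sum>e<2 * a - 1. grid_correlation n a (hash \<sigma>)
      (\<lambda>i. frequency xs (0, i)) (\<lambda>i. frequency xs (1, i)) e * fst \<omega> ^ e) - w"
proof -
  let ?A = "\<lambda>x. \<Sum>i\<in>{1..n}. frequency xs (0, i) * (if fst (hash \<sigma> i) = x then fst \<omega> ^ snd (hash \<sigma> i) else 0)"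
  let ?C = "\<lambda>x. \<Sum>i\<in>{1..n}. frequency xs (1, i) *
    (if fst (hash \<sigma> i) = x then fst \<omega> ^ (a - 1 - snd (hash \<sigma> i)) else 0)"
  have "(\<Sum>x<a. z (0, x) * z (1, x)) = (\<Sum>x<a. ?A x mod p * (?C x mod p))"
    unfolding z_def by (intro sum.cong refl) (simp add: sketch_of_disj_stream[OF xs] disj_weight_def Let_def del: One_nat_def cong: if_cong)
  then show ?thesis by (simp only: mod_sum_products_dvd_iff sum_row_products[OF h])
qed

lemma card_times_le_third:
  assumes "finite A" "finite C" "S \<subseteq> A' \<times> C'" "A' \<subseteq> A" "C' \<subseteq> C"
    and "3 * card A' \<le> card A \<or> 3 * card C' \<le> card C"
  shows "3 * card S \<le> card (A \<times> C)"
proof -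
  have fin: "finite A'" "finite C'" using assms finite_subset by blast+
  have "card S \<le> card A' * card C'"
    using card_mono[OF finite_cartesian_product[OF fin] assms(3)] by (simp add: card_cartesian_product)
  moreover have "card A' \<le> card A" "card C' \<le> card C" using assms by (auto intro: card_mono)
  ultimately show ?thesis
    using assms(6) mult_le_mono[of "3 * card A'" "card A" "card C'" "card C"]
      mult_le_mono[of "card A'" "card A" "3 * card C'" "card C"]
    by (auto simp: card_cartesian_product)
qed

text \<open>Separated supports leave no term in the middle coefficient, and a common item separated
  from all other items is alone on its grid point. Both facts are independent of the coins, whence
  perfect completeness.\<close>

lemma disj_message_complete:
  assumes xs: "xs \<in> disj_streams n m B" and a: "a \<ge> 2" and p: "p > int B" "p > 0"
    and hash: "\<And>\<sigma> i. \<sigma> < L \<Longrightarrow> i \<in> {1..n} \<Longrightarrow> hash \<sigma> i \<in> {..<a} \<times> {..<a}"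
      "\<And>U V. U \<subseteq> {1..n} \<Longrightarrow> V \<subseteq> {1..n} \<Longrightarrow> card U \<le> 2 * m \<Longrightarrow> card V \<le> 2 * m \<Longrightarrow> U \<inter> V = {} \<Longrightarrow>
         \<exists>\<sigma><L. hash \<sigma> ` U \<inter> hash \<sigma> ` V = {}"
  defines "J \<equiv> {0, 1} \<times> {..<a}"
  shows "\<exists>\<mu>\<in>{..<L} \<times> (({..<2 * a - 1} \<rightarrow>\<^sub>E {0..<p}) <+> ({..<a} \<times> {..<a})). \<forall>\<omega>.
    disj_verdict a p \<omega> \<mu> (foldl (sketch_step p J (disj_coef hash a \<omega> \<mu>)) (\<lambda>j\<in>J. 0) xs) = Some (m_disj n xs)"
proof -
  define f where "f b i = frequency xs (b, i)" for b i
  define supp where "supp b = {i\<in>{1..n}. f b i > 0}" for b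
  note fr = disj_streams_frequency[OF xs]
  have supp: "supp b \<subseteq> {1..n}" "card (supp b) \<le> m" "finite (supp b)" if "b \<in> {0, 1}" for b
    using fr(4)[OF that] by (auto simp: supp_def f_def)
  have f0: "f b i = 0" if "i \<in> {1..n}" "i \<notin> supp b" for b i
    using that fr(2)[of "(b, i)"] by (auto simp: supp_def f_def)
  note sketch = sketch_of_disj_stream[where a = a, OF xs, folded J_def f_def]
  show ?thesis
  proof (cases "m_disj n xs")
    case True
    have "supp 0 \<inter> supp 1 = {}"
    proof (rule equals0I)
      fix i assume "i \<in> supp 0 \<inter> supp 1"
      then have "i \<in> {1..n}" "frequency xs (0, i) > 0" "frequency xs (1, i) > 0"
        by (auto simp: supp_def f_def)
      with True fr(5) show False by (metis less_irrefl)
    qed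
    then obtain \<sigma> where \<sigma>: "\<sigma> < L" "hash \<sigma> ` supp 0 \<inter> hash \<sigma> ` supp 1 = {}"
      using hash(2)[of "supp 0" "supp 1"] supp[of 0] supp[of 1] by auto
    note h = hash(1)[OF \<sigma>(1)]
    define c where "c = grid_correlation n a (hash \<sigma>) (f 0) (f 1)"
    define G where "G = (\<lambda>e\<in>{..<2 * a - 1}. c e mod p)"
    have "c (a - 1) = 0"
      unfolding c_def using h
    proof (subst grid_correlation_middle, blast, intro sum.neutral ballI)
      fix i j assume ij: "i \<in> {1..n}" "j \<in> {1..n}"
      have "i \<notin> supp 0 \<or> j \<notin> supp 1" if "hash \<sigma> i = hash \<sigma> j"
        using \<sigma>(2) that by (metis IntI emptyE imageI)
      then show "(if hash \<sigma> i = hash \<sigma> j then f 0 i * f 1 j else 0) = 0"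
        using f0[OF ij(1)] f0[OF ij(2)] by auto
    qed
    moreover have "a - 1 < 2 * a - 1" using a by simp
    ultimately have mid: "p dvd G (a - 1)" by (simp add: G_def)
    have "disj_verdict a p \<omega> (\<sigma>, Inl G) (foldl (sketch_step p J (disj_coef hash a \<omega> (\<sigma>, Inl G))) (\<lambda>j\<in>J. 0) xs) =
        Some True" for \<omega>
    proof -
      have "(\<Sum>e<2 * a - 1. c e * fst \<omega> ^ e) mod p = (\<Sum>e<2 * a - 1. G e * fst \<omega> ^ e) mod p"
        by (subst (1 2) mod_sum_eq[symmetric]) (simp add: G_def mod_mult_left_eq)
      then have "p dvd (\<Sum>e<2 * a - 1. c e * fst \<omega> ^ e) - (\<Sum>e<2 * a - 1. G e * fst \<omega> ^ e)"
        by (simp only: mod_eq_dvd_iff)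
      then show ?thesis
        using mid unfolding disj_verdict_def J_def c_def f_def
        by (simp only: disj_sketch_row_products[where hash = hash and \<sigma> = \<sigma>, OF xs h] snd_conv sum.case if_True simp_thms)
    qed
    moreover have "G \<in> {..<2 * a - 1} \<rightarrow>\<^sub>E {0..<p}" using p by (auto simp: G_def)
    ultimately show ?thesis using \<sigma>(1) True by (intro bexI[of _ "(\<sigma>, Inl G)"]) auto
  next
    case False
    then obtain i where i: "i \<in> {1..n}" "f 0 i \<noteq> 0" "f 1 i \<noteq> 0" using fr(5) unfolding f_def by blast
    let ?W = "(supp 0 \<union> supp 1) - {i}"
    have "card ?W \<le> card (supp 0 \<union> supp 1)" using supp[of 0] supp[of 1] by (intro card_mono) auto
    also have "\<dots> \<le> 2 * m" using card_Un_le[of "supp 0" "supp 1"] supp[of 0] supp[of 1] by auto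
    finally have W: "card ?W \<le> 2 * m" .
    have "card (supp 0) > 0" using i f0 supp(3)[of 0] by (auto simp: card_gt_0_iff)
    then have "m > 0" using supp(2)[of 0] by auto
    then obtain \<sigma> where \<sigma>: "\<sigma> < L" "hash \<sigma> ` {i} \<inter> hash \<sigma> ` ?W = {}"
      using hash(2)[of "{i}" ?W] supp(1)[of 0] supp(1)[of 1] W i by auto
    let ?\<mu> = "(\<sigma>, Inr (hash \<sigma> i)) :: disj_message"
    have only_i: "(\<Sum>j\<in>{1..n}. f b j * (if hash \<sigma> j = hash \<sigma> i then w j else 0)) = f b i * w i"
      if "b \<in> {0, 1}" for b w
    proof -
      have "(\<Sum>j\<in>{1..n}. f b j * (if hash \<sigma> j = hash \<sigma> i then w j else 0)) =
          (\<Sum>j\<in>{1..n}. if j = i then f b i * w i else 0)"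
      proof (intro sum.cong refl)
        fix j assume j: "j \<in> {1..n}"
        have "f b j = 0" if "hash \<sigma> j = hash \<sigma> i" "j \<noteq> i"
        proof (rule f0[OF j])
          show "j \<notin> supp b"
          proof
            assume "j \<in> supp b"
            then have "j \<in> ?W" using \<open>b \<in> {0, 1}\<close> \<open>j \<noteq> i\<close> by auto
            then have "hash \<sigma> j \<in> hash \<sigma> ` ?W" by (rule imageI)
            then show False using \<sigma>(2) that(1) by simp
          qed
        qed
        then show "f b j * (if hash \<sigma> j = hash \<sigma> i then w j else 0) = (if j = i then f b i * w i else 0)"
          by auto
      qed
      then show ?thesis using i by simp
    qed
    \<comment> \<open>Multiplicities are at most \<open>B\<close> < \<open>p\<close>, so a nonzero
      count stays nonzero modulo \<open>p\<close>.\<close>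
    have nz: "\<not> p dvd f b i" if "b \<in> {0, 1}" "f b i \<noteq> 0" for b
      using zdvd_imp_le[of p "f b i"] fr(2)[of "(b, i)"] fr(3)[OF that(1) i(1)] p that by (auto simp: f_def)
    have "disj_verdict a p \<omega> ?\<mu> (foldl (sketch_step p J (disj_coef hash a \<omega> ?\<mu>)) (\<lambda>j\<in>J. 0) xs) = Some False" for \<omega>
    proof -
      have z: "foldl (sketch_step p J (disj_coef hash a \<omega> ?\<mu>)) (\<lambda>j\<in>J. 0) xs (b, x) =
          f b i * (if x = 0 then 1 else snd \<omega> i) mod p" if "b \<in> {0, 1}" "x < a" for b x
        using that only_i[OF that(1), of "\<lambda>j. if x = 0 then 1 else snd \<omega> j"]
        by (simp add: sketch disj_weight_def)
      have "p dvd f 1 i mod p * (f 0 i * snd \<omega> i mod p) - f 0 i mod p * (f 1 i * snd \<omega> i mod p)"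
        by (simp add: mod_eq_dvd_iff[symmetric] mod_mult_eq mult_ac)
      then show ?thesis using nz[of 0] nz[of 1] i a
        by (simp add: disj_verdict_def z dvd_mod_iff)
    qed
    moreover have "hash \<sigma> i \<in> {..<a} \<times> {..<a}" by (rule hash(1)[OF \<sigma>(1) i(1)])
    ultimately show ?thesis using \<sigma>(1) False by (intro bexI[of _ ?\<mu>]) auto
  qed
qed

text \<open>The bound covers every seed: collisions cannot cancel the contribution of a common item,
  and they cannot make disjoint supports agree under random fingerprints except with small
  probability.\<close>

lemma disj_message_sound:
  assumes xs: "xs \<in> disj_streams n m B" and a: "a \<ge> 2" and m: "m > 0"
    and p: "prime p" "p > int ((m * B)\<^sup>2)" "p \<ge> int (6 * a)"
    and hash: "\<And>\<sigma> i. \<sigma> < L \<Longrightarrow> i \<in> {1..n} \<Longrightarrow> hash \<sigma> i \<in> {..<a} \<times> {..<a}"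
    and \<mu>: "fst \<mu> < L"
  defines "J \<equiv> {0, 1} \<times> {..<a}"
  defines "R \<equiv> {0..<p} \<times> ({1..n} \<rightarrow>\<^sub>E {0..<p})"
  shows "3 * card {\<omega>\<in>R. disj_verdict a p \<omega> \<mu> (foldl (sketch_step p J (disj_coef hash a \<omega> \<mu>)) (\<lambda>j\<in>J. 0) xs)
    \<notin> {Some (m_disj n xs), None}} \<le> card R" (is "3 * card ?bad \<le> _")
proof -
  define f where "f b i = frequency xs (b, i)" for b i
  note fr = disj_streams_frequency[OF xs]
  note sketch = sketch_of_disj_stream[where a = a, OF xs, folded J_def f_def]
  have nonneg: "f b i \<ge> 0" for b i using fr(2) by (simp add: f_def)
  have sumf: "(\<Sum>i\<in>{1..n}. f b i) \<le> int (m * B)" if "b \<in> {0, 1}" for b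
    using nonneg fr(3)[OF that] fr(4)[OF that] by (intro sum_bounded_support) (auto simp: f_def)
  have B: "int B < p"
  proof -
    have "B \<le> m * B" using m by simp
    also have "m * B \<le> (m * B) * (m * B)" by (rule le_square)
    finally have "int B \<le> int ((m * B)\<^sup>2)" unfolding power2_eq_square by (simp only: of_nat_le_iff)
    then show ?thesis using p(2) by linarith
  qed
  obtain \<sigma> w where \<mu>_eq: "\<mu> = (\<sigma>, w)" by (cases \<mu>)
  note h = hash[OF \<mu>[unfolded \<mu>_eq fst_conv]]
  have fin: "finite {0..<p}" "finite ({1..n} \<rightarrow>\<^sub>E {0..<p})" by (auto intro!: finite_PiE)
  show ?thesis
  proof (cases w)
    case (Inl G)
    show ?thesis
    proof (cases "m_disj n xs \<or> \<not> p dvd G (a - 1)")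
      case True
      then have "?bad = {}" by (auto simp: disj_verdict_def \<mu>_eq Inl split: if_splits)
      then show ?thesis by (simp only: card.empty)
    next
      case False
      then obtain i where i: "i \<in> {1..n}" "f 0 i \<noteq> 0" "f 1 i \<noteq> 0" using fr(5) unfolding f_def by blast
      define c where "c = grid_correlation n a (hash \<sigma>) (f 0) (f 1)"
      have mid: "c (a - 1) = (\<Sum>i\<in>{1..n}. \<Sum>j\<in>{1..n}. if hash \<sigma> i = hash \<sigma> j then f 0 i * f 1 j else 0)"
        unfolding c_def using h by (rule grid_correlation_middle)
      \<comment> \<open>The term of the common item \<open>i\<close> with itself is positive and no
        other term is negative.\<close>
      have "0 < (if hash \<sigma> i = hash \<sigma> i then f 0 i * f 1 i else 0)"
        using i nonneg[of 0 i] nonneg[of 1 i] by simp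
      also have "\<dots> \<le> (\<Sum>j\<in>{1..n}. if hash \<sigma> i = hash \<sigma> j then f 0 i * f 1 j else 0)"
        using i nonneg by (intro member_le_sum[where f = "\<lambda>j. if hash \<sigma> i = hash \<sigma> j then f 0 i * f 1 j else 0"]) auto
      also have "\<dots> \<le> c (a - 1)"
        unfolding mid using i nonneg by (intro member_le_sum) (auto intro!: sum_nonneg)
      finally have pos: "c (a - 1) > 0" .
      have "c (a - 1) \<le> (\<Sum>i\<in>{1..n}. \<Sum>j\<in>{1..n}. f 0 i * f 1 j)"
        unfolding mid using nonneg by (intro sum_mono) auto
      also have "\<dots> = (\<Sum>i\<in>{1..n}. f 0 i) * (\<Sum>i\<in>{1..n}. f 1 i)" by (simp add: sum_product)
      also have "\<dots> \<le> int (m * B) * int (m * B)"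
        using sumf nonneg by (intro mult_mono) (auto intro!: sum_nonneg)
      also have "\<dots> < p" using p(2) by (simp add: power2_eq_square)
      finally have "\<not> p dvd c (a - 1)" using pos zdvd_imp_le by fastforce
      \<comment> \<open>A polynomial that passes the first check has middle coefficient 0 modulo
        \<open>p\<close>, so it differs from \<open>c\<close> and agrees with it at no more than 2 a
        - 2 points, less than a third of \<open>p\<close>.\<close>
      then have "\<not> p dvd c (a - 1) - G (a - 1)" using False by (simp add: dvd_diff_left_iff)
      then have few: "card {x\<in>{0..<p}. p dvd (\<Sum>e<2 * a - 1. (c e - G e) * x ^ e)} < 2 * a - 1"
        using a by (intro poly_sum_roots_mod_prime[OF p(1)] exI[of _ "a - 1"]) auto
      have "?bad \<subseteq> {x\<in>{0..<p}. p dvd (\<Sum>e<2 * a - 1. (c e - G e) * x ^ e)} \<times> ({1..n} \<rightarrow>\<^sub>E {0..<p})"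
      proof
        fix \<omega> assume \<omega>: "\<omega> \<in> ?bad"
        then have "p dvd (\<Sum>e<2 * a - 1. c e * fst \<omega> ^ e) - (\<Sum>e<2 * a - 1. G e * fst \<omega> ^ e)"
          unfolding disj_verdict_def J_def c_def f_def \<mu>_eq Inl
          by (auto simp only: disj_sketch_row_products[where hash = hash and \<sigma> = \<sigma>, OF xs h] snd_conv sum.case mem_Collect_eq insert_iff
              split: if_splits)
        then show "\<omega> \<in> {x\<in>{0..<p}. p dvd (\<Sum>e<2 * a - 1. (c e - G e) * x ^ e)} \<times> ({1..n} \<rightarrow>\<^sub>E {0..<p})"
          using \<omega> by (auto simp: R_def sum_subtractf left_diff_distrib)
      qed
      then show ?thesis
        unfolding R_def using fin few p(3) by (elim card_times_le_third[rotated 2]) auto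
    qed
  next
    case (Inr y)
    show ?thesis
    proof (cases "m_disj n xs")
      case False
      then have "?bad = {}" by (auto simp: disj_verdict_def \<mu>_eq Inr split: if_splits)
      then show ?thesis by (simp only: card.empty)
    next
      case True
      define s where "s b = (\<Sum>i\<in>{1..n}. f b i * (if hash \<sigma> i = y then 1 else 0))" for b
      define A where "A b r = (\<Sum>i\<in>{1..n}. f b i * (if hash \<sigma> i = y then r i else 0))" for b and r :: "nat \<Rightarrow> int"
      define c where "c i = (if hash \<sigma> i = y then s 1 * f 0 i - s 0 * f 1 i else 0)" for i
      have z: "foldl (sketch_step p J (disj_coef hash a \<omega> \<mu>)) (\<lambda>j\<in>J. 0) xs (b, 0) = s b mod p"
        "foldl (sketch_step p J (disj_coef hash a \<omega> \<mu>)) (\<lambda>j\<in>J. 0) xs (b, 1) = A b (snd \<omega>) mod p"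
        if "b \<in> {0, 1}" for b \<omega>
        using that a by (simp_all add: sketch disj_weight_def \<mu>_eq Inr s_def A_def cong: if_cong)
      have lin: "s 1 * A 0 r - s 0 * A 1 r = (\<Sum>i\<in>{1..n}. c i * r i)" for r
        unfolding A_def c_def sum_distrib_left sum_subtractf[symmetric]
        by (intro sum.cong) (auto simp: algebra_simps)
      have bad: "\<not> p dvd s 0 \<and> \<not> p dvd s 1 \<and> p dvd (\<Sum>i\<in>{1..n}. c i * snd \<omega> i)" if "\<omega> \<in> ?bad" for \<omega>
      proof -
        have "\<not> p dvd s 0 mod p \<and> \<not> p dvd s 1 mod p \<and>
            p dvd (s 1 mod p) * (A 0 (snd \<omega>) mod p) - (s 0 mod p) * (A 1 (snd \<omega>) mod p)"
          using that z(1)[of 0 \<omega>] z(1)[of 1 \<omega>] z(2)[of 0 \<omega>] z(2)[of 1 \<omega>]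
          by (auto simp: disj_verdict_def \<mu>_eq Inr split: if_splits)
        then show ?thesis
          unfolding lin[symmetric] by (simp add: mod_eq_dvd_iff[symmetric] mod_mult_eq dvd_mod_iff)
      qed
      show ?thesis
      proof (cases "?bad = {}")
        case True
        then show ?thesis by (simp only: card.empty)
      next
        case False
        then have s: "\<not> p dvd s 0" "\<not> p dvd s 1" using bad by blast+
        then have "s 0 \<noteq> 0" by auto
        then obtain i where i: "i \<in> {1..n}" "hash \<sigma> i = y" "f 0 i \<noteq> 0"
          unfolding s_def by (auto elim!: sum.not_neutral_contains_not_neutral split: if_splits)
        \<comment> \<open>By disjointness the coefficient of this item in the linear form reduces to
          s 1 * f 0 i, and neither factor is divisible by \<open>p\<close>.\<close>
        then have "f 1 i = 0" using True fr(5) by (auto simp: f_def)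
        moreover have "\<not> p dvd f 0 i"
          using zdvd_imp_le[of p "f 0 i"] nonneg[of 0 i] fr(3)[of 0 i] i B by (auto simp: f_def)
        ultimately have "\<not> p dvd c i" using s i p(1) by (simp add: c_def prime_dvd_mult_iff)
        then have zeros: "card {r \<in> {1..n} \<rightarrow>\<^sub>E {0..<p}. p dvd (\<Sum>i\<in>{1..n}. c i * r i)} * nat p
            \<le> card ({1..n} \<rightarrow>\<^sub>E {0..<p})"
          using i by (intro card_linear_form_zeros_mod_prime[OF p(1)]) auto
        have "3 \<le> nat p" using p(3) a by linarith
        then have "card {r \<in> {1..n} \<rightarrow>\<^sub>E {0..<p}. p dvd (\<Sum>i\<in>{1..n}. c i * r i)} * 3 \<le>
            card {r \<in> {1..n} \<rightarrow>\<^sub>E {0..<p}. p dvd (\<Sum>i\<in>{1..n}. c i * r i)} * nat p"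
          by (rule mult_le_mono2)
        with zeros have few: "3 * card {r \<in> {1..n} \<rightarrow>\<^sub>E {0..<p}. p dvd (\<Sum>i\<in>{1..n}. c i * r i)}
            \<le> card ({1..n} \<rightarrow>\<^sub>E {0..<p})" by linarith
        have "?bad \<subseteq> {0..<p} \<times> {r \<in> {1..n} \<rightarrow>\<^sub>E {0..<p}. p dvd (\<Sum>i\<in>{1..n}. c i * r i)}"
        proof
          fix \<omega> assume \<omega>: "\<omega> \<in> ?bad"
          then have "\<omega> \<in> R" by simp
          then show "\<omega> \<in> {0..<p} \<times> {r \<in> {1..n} \<rightarrow>\<^sub>E {0..<p}. p dvd (\<Sum>i\<in>{1..n}. c i * r i)}"
            using bad[OF \<omega>] by (auto simp: R_def)
        qed
        then show ?thesis unfolding R_def using fin few by (elim card_times_le_third[rotated 2]) auto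
      qed
    qed
  qed
qed

text \<open>The memory consists of \<open>c + 1\<close> bits for the buffered message and
  \<open>l\<close> bits for each of the \<open>2 * a\<close> counters.\<close>

lemma disj_scheme_grid:
  fixes p :: nat
  assumes n: "n < 2 ^ m" and m: "m > 0" and a: "a \<ge> 2" "4 * m \<le> a * a"
    and p: "prime p" "(m * B)\<^sup>2 < p" "6 * a \<le> p" "p \<le> 2 ^ l"
    and v: "4 * m\<^sup>2 \<le> v * (a * a)" and s: "4 * m\<^sup>2 \<le> 2 ^ s"
  defines "X \<equiv> disj_streams n m B" and "c \<equiv> 3 * v + s + l * (2 * a)"
  shows "\<exists>(P :: update prover) (V :: (update, bool) verifier).
    annotation_bits X P c \<and> memory_bits V (c + 1 + l * (2 * a)) \<and>
    completeness_error X (m_disj n) P V 0 \<and> soundness_error X (m_disj n) V (1/3)"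
proof -
  let ?L = "2 ^ (3 * v + s) :: nat"
  obtain hash :: "nat \<Rightarrow> nat \<Rightarrow> nat \<times> nat" where hash:
    "\<And>\<sigma> i. \<sigma> < ?L \<Longrightarrow> i \<in> {1..n} \<Longrightarrow> hash \<sigma> i \<in> {..<a} \<times> {..<a}"
    "\<And>U V. U \<subseteq> {1..n} \<Longrightarrow> V \<subseteq> {1..n} \<Longrightarrow> card U \<le> 2 * m \<Longrightarrow> card V \<le> 2 * m \<Longrightarrow> U \<inter> V = {} \<Longrightarrow>
       \<exists>\<sigma><?L. hash \<sigma> ` U \<inter> hash \<sigma> ` V = {}"
    by (rule hash_family[OF n m, of "{..<a} \<times> {..<a}" v s]) (use a v s in \<open>auto simp: card_cartesian_product\<close>)
  let ?p = "int p"
  have p1: "1 < p" using p(1) by (rule prime_gt_1_nat)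
  have B: "int B < ?p"
  proof -
    have "B \<le> m * B" using m by simp
    also have "m * B \<le> (m * B)\<^sup>2" unfolding power2_eq_square by (rule le_square)
    finally show ?thesis using p(2) by linarith
  qed
  let ?R = "{0..<?p} \<times> ({1..n} \<rightarrow>\<^sub>E {0..<?p})"
  let ?M = "{..<?L} \<times> (({..<2 * a - 1} \<rightarrow>\<^sub>E {0..<?p}) <+> ({..<a} \<times> {..<a}))"
  let ?J = "{0, 1} \<times> {..<a} :: (nat \<times> nat) set"
  let ?Z = "?J \<rightarrow>\<^sub>E {0..<?p}"
  have finM: "finite ?M" by (auto intro!: finite_PiE finite_cartesian_product finite_Plus)
  have "card ?M = ?L * (p ^ (2 * a - 1) + a * a)"
    by (simp add: card_cartesian_product card_Plus finite_PiE card_PiE)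
  \<comment> \<open>The two kinds of message cost a factor 2, for which the spare residue makes
    room: the polynomial has only 2 a - 1 coefficients. As \<open>a\<close> is at least 2, a^2 <=
    p^2 <= p^(2 a - 1).\<close>
  also have "\<dots> \<le> ?L * p ^ (2 * a)"
  proof -
    have "a * a \<le> p ^ 2" unfolding power2_eq_square using p(3) by (intro mult_mono) auto
    also have "\<dots> \<le> p ^ (2 * a - 1)" using a p1 by (intro power_increasing) auto
    finally have "p ^ (2 * a - 1) + a * a \<le> 2 * p ^ (2 * a - 1)" by simp
    also have "\<dots> \<le> p * p ^ (2 * a - 1)" using p1 by (intro mult_right_mono) auto
    also have "\<dots> = p ^ Suc (2 * a - 1)" by simp
    also have "Suc (2 * a - 1) = 2 * a" using a by simp
    finally show ?thesis by simp
  qed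
  also have "\<dots> \<le> ?L * (2 ^ l) ^ (2 * a)" using p(4) by (intro mult_left_mono power_mono) auto
  also have "\<dots> = 2 ^ c" by (simp add: c_def power_add power_mult[symmetric])
  finally have cardM: "card ?M \<le> 2 ^ c" .
  have cardZ: "card ?Z \<le> 2 ^ (l * (2 * a))"
  proof -
    have "card ?Z = p ^ (2 * a)" by (simp add: card_PiE card_cartesian_product mult_2)
    also have "\<dots> \<le> (2 ^ l) ^ (2 * a)" using p(4) by (intro power_mono) auto
    finally show ?thesis by (simp add: power_mult)
  qed
  show ?thesis
  proof (rule scheme_of_message_algorithm[where R = ?R and M = ?M and Z = ?Z
        and upd = "\<lambda>\<omega> \<mu>. sketch_step ?p ?J (disj_coef hash a \<omega> \<mu>)" and ver = "disj_verdict a ?p"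
        and ?z0.0 = "\<lambda>j\<in>?J. 0"])
    show "finite ?R" "?R \<noteq> {}" using p1 by (auto intro!: finite_PiE simp: PiE_eq_empty_iff)
    show "finite ?M" by fact
    have "(0, Inr (0, 0)) \<in> ?M" using a by auto
    then show "?M \<noteq> {}" by blast
    show "card ?M \<le> 2 ^ c" by fact
    show "finite ?Z" by (auto intro!: finite_PiE)
    show "card ?Z \<le> 2 ^ (l * (2 * a))" by fact
    show "(\<lambda>j\<in>?J. 0) \<in> ?Z" using p1 by auto
    show "sketch_step ?p ?J (disj_coef hash a \<omega> \<mu>) z u \<in> ?Z" for \<omega> \<mu> z u
      using p1 by (auto simp: sketch_step_def)
  next
    fix xs assume "xs \<in> X"
    then have xs: "xs \<in> disj_streams n m B" by (simp add: X_def)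
    have "\<exists>\<mu>\<in>?M. \<forall>\<omega>. disj_verdict a ?p \<omega> \<mu>
        (foldl (sketch_step ?p ?J (disj_coef hash a \<omega> \<mu>)) (\<lambda>j\<in>?J. 0) xs) = Some (m_disj n xs)"
      by (rule disj_message_complete[OF xs a(1) B]) (use p1 in simp, erule (1) hash(1), erule (4) hash(2))
    then show "\<exists>\<mu>\<in>?M. \<forall>\<omega>\<in>?R. disj_verdict a ?p \<omega> \<mu>
        (foldl (sketch_step ?p ?J (disj_coef hash a \<omega> \<mu>)) (\<lambda>j\<in>?J. 0) xs) = Some (m_disj n xs)"
      by blast
  next
    fix xs \<mu> assume "xs \<in> X" "\<mu> \<in> ?M"
    then show "3 * card {\<omega>\<in>?R. disj_verdict a ?p \<omega> \<mu>
        (foldl (sketch_step ?p ?J (disj_coef hash a \<omega> \<mu>)) (\<lambda>j\<in>?J. 0) xs) \<notin> {Some (m_disj n xs), None}} \<le> card ?R"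
      unfolding X_def using p a m hash
      by (intro disj_message_sound[where L = ?L and m = m and B = B]) (auto simp flip: of_nat_power)
  qed
qed

text \<open>With l = log m and g = C / l one has g^2 C = m^2. The side is about 4 g, the seed has
  about 12 C bits, and a prime of O((k + 1) l) bits makes 2 a residues cost O((k + 1) C).\<close>

lemma disj_scheme_cost:
  assumes "(n, m) \<in> disj_params"
  defines "C \<equiv> (real m * log 2 (real m)) powr (2/3)"
  shows "1 \<le> C" and "\<exists>(P :: update prover) (V :: (update, bool) verifier) c w.
    annotation_bits (disj_streams n m (m ^ k)) P c \<and> real c \<le> (500 + 200 * real k) * C \<and>
    memory_bits V w \<and> real w \<le> (500 + 200 * real k) * C \<and>
    completeness_error (disj_streams n m (m ^ k)) (m_disj n) P V 0 \<and>
    soundness_error (disj_streams n m (m ^ k)) (m_disj n) V (1/3)"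
proof -
  have nm: "1 \<le> n" "2 \<le> m" "log 2 (real n) < real m" using assms by (auto simp: disj_params_def)
  then have n: "n < 2 ^ m"
    by (metis log2_of_power_less less_log2_of_power linorder_not_less le_log2_of_power
        not_one_le_zero order_le_less one_le_numeral gr0I)
  define l where "l = log 2 (real m)"
  have l1: "1 \<le> l" using nm by (simp add: l_def le_log_iff)
  \<comment> \<open>A crude comparison of log m with the square root of m; it yields m <= 4 g^2
    below.\<close>
  have lm: "l\<^sup>2 \<le> 16 * real m" and lm2: "l \<le> real m"
  proof -
    have "ln (real m) = 2 * ln (sqrt (real m))" using nm by (simp add: ln_sqrt)
    also have "\<dots> \<le> 2 * sqrt (real m)" using ln_le_minus_one[of "sqrt (real m)"] nm by simp
    finally have "ln (real m) \<le> 2 * sqrt (real m)" .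
    moreover have "1 / 2 \<le> ln (2::real)" using ln2_ge_two_thirds by simp
    moreover have "l = ln (real m) / ln 2" by (simp add: l_def log_def)
    moreover have "l * (1 / 2) \<le> l * ln 2" using l1 \<open>1 / 2 \<le> ln 2\<close> by (intro mult_left_mono) auto
    ultimately have "l \<le> 4 * sqrt (real m)" by simp
    then have "l\<^sup>2 \<le> (4 * sqrt (real m))\<^sup>2" using l1 by (intro power_mono) auto
    then show "l\<^sup>2 \<le> 16 * real m" by (simp add: power_mult_distrib)
    show "l \<le> real m" using nm log2_of_power_le[of m m] by (simp add: l_def less_imp_le)
  qed
  have C3: "C ^ 3 = (real m * l)\<^sup>2"
  proof -
    have "real m * l \<noteq> 0" using nm l1 by simp
    then have "C ^ 3 = (real m * l) powr (real 3 * (2/3))"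
      unfolding C_def l_def[symmetric] by (rule powr_power)
    then show ?thesis using l1 by simp
  qed
  have Cl: "l \<le> C"
  proof (rule power_le_imp_le_base[of _ 2])
    have "l ^ 3 = l\<^sup>2 * l" by (simp add: power3_eq_cube power2_eq_square)
    also have "\<dots> \<le> l\<^sup>2 * (real m)\<^sup>2"
      using lm2 nm l1 by (intro mult_left_mono) (auto intro: order_trans[OF _ self_le_power])
    finally show "l ^ Suc 2 \<le> C ^ Suc 2" using C3 by (simp add: power_mult_distrib mult.commute)
  qed (simp add: C_def)
  with l1 show C1: "1 \<le> C" by simp
  define g where "g = C / l"
  have gC: "g\<^sup>2 * C = (real m)\<^sup>2"
    using C3 l1 by (simp add: g_def power_divide power_mult_distrib field_simps power3_eq_cube power2_eq_square)
  have g1: "1 \<le> g" using Cl l1 by (simp add: g_def)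
  have gm: "g \<le> real m"
  proof (rule power_le_imp_le_base[of _ 1])
    have "g\<^sup>2 * 1 \<le> g\<^sup>2 * C" using C1 by (intro mult_left_mono) auto
    then show "g ^ Suc 1 \<le> real m ^ Suc 1" using gC by (simp add: power2_eq_square)
  qed simp
  have g4: "real m \<le> 4 * g\<^sup>2"
  proof -
    have "real m * l\<^sup>2 \<le> 4 * C\<^sup>2"
    proof (rule power_le_imp_le_base[of _ 2])
      have "(real m * l\<^sup>2) ^ 3 = (real m ^ 3 * l ^ 4) * l\<^sup>2" by (simp add: power_mult_distrib power_mult[symmetric] power_add[symmetric])
      also have "\<dots> \<le> (real m ^ 3 * l ^ 4) * (64 * real m)" using lm by (intro mult_left_mono) auto
      also have "\<dots> = 64 * ((real m * l)\<^sup>2)\<^sup>2"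
        by (simp add: power_mult_distrib power_mult[symmetric] power_Suc2[symmetric] del: power_Suc2 power_Suc)
      also have "\<dots> = (4 * C\<^sup>2) ^ 3"
        unfolding C3[symmetric] by (simp add: power_mult_distrib power_mult[symmetric])
      finally show "(real m * l\<^sup>2) ^ Suc 2 \<le> (4 * C\<^sup>2) ^ Suc 2" by (simp add: eval_nat_numeral)
    qed simp
    then show ?thesis using l1 by (simp add: g_def power_divide field_simps)
  qed
  \<comment> \<open>The factor 4 turns m <= 4 g^2 into 4 m <= a^2, as \<open>hash_family\<close>
    requires.\<close>
  define a where "a = nat \<lceil>4 * g\<rceil>"
  have a: "4 * g \<le> real a" "real a \<le> 4 * g + 1" using g1 unfolding a_def by linarith+
  have a2: "a \<ge> 2" using a g1 by linarith
  have a_sq: "16 * g\<^sup>2 \<le> real (a * a)"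
  proof -
    have "(4 * g) * (4 * g) \<le> real a * real a" using a g1 by (intro mult_mono) auto
    then show ?thesis by (simp add: power2_eq_square)
  qed
  have am: "4 * m \<le> a * a"
  proof -
    have "real (4 * m) \<le> real (a * a)" using a_sq g4 by simp
    then show ?thesis by (simp only: of_nat_le_iff)
  qed
  define v where "v = nat \<lceil>4 * C\<rceil>"
  have v: "4 * C \<le> real v" "real v \<le> 4 * C + 1" using C1 unfolding v_def by linarith+
  have vm: "4 * m\<^sup>2 \<le> v * (a * a)"
  proof -
    have "real (4 * m\<^sup>2) = 4 * C * g\<^sup>2" using gC by (simp add: mult.commute)
    also have "\<dots> \<le> real v * real (a * a)"
      using v a_sq C1 by (intro mult_mono) (auto intro: order_trans[of _ "16 * g\<^sup>2"])
    finally have "real (4 * m\<^sup>2) \<le> real (v * (a * a))" by simp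
    then show ?thesis by (simp only: of_nat_le_iff)
  qed
  define b where "b = nat \<lceil>l\<rceil>"
  have b: "l \<le> real b" "real b \<le> l + 1" using l1 unfolding b_def by linarith+
  have mb: "m \<le> 2 ^ b"
  proof -
    have "real m \<le> 2 powr real b" using b nm by (simp add: l_def log_le_iff)
    then have "real m \<le> real (2 ^ b)" by (simp add: powr_realpow)
    then show ?thesis by (simp only: of_nat_le_iff)
  qed
  have mb2: "4 * m\<^sup>2 \<le> 2 ^ (2 * b + 2)"
    using power_mono[OF mb, of 2] by (simp add: power_add power_mult[symmetric] mult.commute)
  \<comment> \<open>Chosen so that 2^q >= 64 m^(2 k + 2). This dominates the bound (m m^k)^2 on the
    inner product as well as 6 a, since a <= 5 m.\<close>
  define q where "q = 6 + (2 * k + 2) * b"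
  obtain p :: nat where p: "prime p" "2 ^ q < p" "p \<le> 2 * 4 ^ q"
    using prime_between_power2[of q] by (auto simp: q_def)
  have q_ge: "64 * m ^ (2 * k + 2) \<le> 2 ^ q"
  proof -
    have "m ^ (2 * k + 2) \<le> (2 ^ b) ^ (2 * k + 2)" using mb by (intro power_mono) auto
    also have "\<dots> = 2 ^ (b * (2 * k + 2))" by (rule power_mult[symmetric])
    finally show ?thesis by (simp only: q_def power_add) (simp add: mult.commute)
  qed
  have pm: "(m * m ^ k)\<^sup>2 < p"
  proof -
    have "(m * m ^ k)\<^sup>2 = m ^ (2 * k + 2)"
      by (simp only: power_Suc[symmetric] power_mult[symmetric]) (simp add: mult.commute)
    then show ?thesis using q_ge p by linarith
  qed
  have pa: "6 * a \<le> p"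
  proof -
    have "real a \<le> 5 * real m" using a gm nm by linarith
    then have "6 * a \<le> 64 * m ^ 1" by simp
    also have "\<dots> \<le> 64 * m ^ (2 * k + 2)" using nm by (intro mult_left_mono power_increasing) auto
    finally show ?thesis using q_ge p by linarith
  qed
  have pl: "p \<le> 2 ^ (2 * q + 1)" using p by (simp add: power_mult)
  define c where "c = 3 * v + (2 * b + 2) + (2 * q + 1) * (2 * a)"
  have d: "real ((2 * q + 1) * (2 * a)) \<le> (210 + 80 * real k) * C"
  proof -
    have "real (2 * q + 1) = 13 + (4 * real k + 4) * real b" by (simp add: q_def algebra_simps)
    also have "\<dots> \<le> 13 * l + (4 * real k + 4) * (2 * l)"
      using b l1 by (intro add_mono mult_left_mono) auto
    finally have "real (2 * q + 1) * (2 * real a) \<le> (13 * l + (4 * real k + 4) * (2 * l)) * (2 * (5 * g))"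
      using a g1 l1 by (intro mult_mono) auto
    also have "\<dots> = (210 + 80 * real k) * (l * g)" by (simp add: algebra_simps)
    also have "l * g = C" using l1 by (simp add: g_def)
    finally show ?thesis by (simp only: of_nat_mult of_nat_numeral)
  qed
  have c: "real c \<le> (231 + 80 * real k) * C"
  proof -
    have "real c = 3 * real v + (2 * real b + 2) + real ((2 * q + 1) * (2 * a))" by (simp add: c_def)
    also have "\<dots> \<le> 3 * (5 * C) + (6 * C) + (210 + 80 * real k) * C"
      using v b d C1 Cl l1 by (intro add_mono) auto
    finally show ?thesis by (simp add: algebra_simps)
  qed
  have kC: "0 \<le> real k * C" using C1 by simp
  obtain P :: "update prover" and V :: "(update, bool) verifier" where
    "annotation_bits (disj_streams n m (m ^ k)) P c" "memory_bits V (c + 1 + (2 * q + 1) * (2 * a))"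
    "completeness_error (disj_streams n m (m ^ k)) (m_disj n) P V 0"
    "soundness_error (disj_streams n m (m ^ k)) (m_disj n) V (1/3)"
    using disj_scheme_grid[OF n _ a2 am p(1) pm pa pl vm mb2] nm unfolding c_def by auto
  moreover have "real c \<le> (500 + 200 * real k) * C" using c kC C1 unfolding distrib_right mult.assoc by linarith
  moreover have "real (c + 1 + (2 * q + 1) * (2 * a)) \<le> (500 + 200 * real k) * C"
    using c d kC C1 unfolding of_nat_add distrib_right mult.assoc by linarith
  ultimately show "\<exists>(P :: update prover) (V :: (update, bool) verifier) c w.
    annotation_bits (disj_streams n m (m ^ k)) P c \<and> real c \<le> (500 + 200 * real k) * C \<and>
    memory_bits V w \<and> real w \<le> (500 + 200 * real k) * C \<and>
    completeness_error (disj_streams n m (m ^ k)) (m_disj n) P V 0 \<and>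
    soundness_error (disj_streams n m (m ^ k)) (m_disj n) V (1/3)" by blast
qed

section \<open>Merlin-Arthur protocols from schemes\<close>

text \<open>Updates by \<open>0\<close> pad the stream to a length which does not depend on the set.\<close>

definition char_stream :: "nat \<Rightarrow> nat \<Rightarrow> nat set \<Rightarrow> update list" where
  "char_stream b N S = map (\<lambda>i. ((b, i), if i \<in> S then 1 else 0)) [1..<Suc N]"

lemma length_char_stream [simp]: "length (char_stream b N S) = N"
  by (simp add: char_stream_def)

lemma frequency_append: "frequency (xs @ ys) v = frequency xs v + frequency ys v"
  by (simp add: frequency_def)

lemma frequency_char_stream:
  "frequency (char_stream b N S) v = (if fst v = b \<and> snd v \<in> {1..N} \<inter> S then 1 else 0)"
proof (induction N)
  case 0
  then show ?case by (simp add: char_stream_def frequency_def)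
next
  case (Suc N)
  have "char_stream b (Suc N) S = char_stream b N S @ [((b, Suc N), if Suc N \<in> S then 1 else 0)]"
    by (simp add: char_stream_def)
  then show ?case using Suc by (cases v) (auto simp: frequency_append frequency_def)
qed

lemma frequency_nonneg:
  assumes "\<And>u. u \<in> set xs \<Longrightarrow> 0 \<le> snd u"
  shows "0 \<le> frequency xs v"
  unfolding frequency_def using assms by (intro sum_list_nonneg) auto

text \<open>The item bound \<open>N\<close> is separate from \<open>n\<close>: the protocol encodes
  subsets of {1..n}, the lower bound only subsets of {1..m}.\<close>

lemma char_streams_disj:
  fixes n m N B :: nat
  assumes N: "N \<le> n" and S: "S \<subseteq> {1..N}" "card S \<le> m" and T: "T \<subseteq> {1..N}" "card T \<le> m" and B: "B \<ge> 1"
  defines "xs \<equiv> char_stream 0 N S @ char_stream 1 N T"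
  shows "xs \<in> disj_streams n m B" "m_disj n xs \<longleftrightarrow> S \<inter> T = {}"
proof -
  have freq: "frequency xs (0, i) = (if i \<in> S then 1 else 0)" "frequency xs (1, i) = (if i \<in> T then 1 else 0)" for i
    using S(1) T(1) by (auto simp: xs_def frequency_append frequency_char_stream)
  have mset: "stream_mset n b xs = mset_set (if b = 0 then S else T)" if "b \<in> {0, 1}" for b
  proof (rule multiset_eqI)
    fix i
    have fin: "finite S" "finite T" using S T finite_subset by blast+
    have "count (stream_mset n b xs) i = (if i \<in> {1..n} then nat (frequency xs (b, i)) else 0)"
      by (simp add: stream_mset_def count_sum)
    also have "\<dots> = count (mset_set (if b = 0 then S else T)) i"
      using that S T N fin by (auto simp: freq count_mset_set' simp del: One_nat_def)
    finally show "count (stream_mset n b xs) i = count (mset_set (if b = 0 then S else T)) i" .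
  qed
  have fin: "finite S" "finite T" using S T finite_subset by blast+
  show "m_disj n xs \<longleftrightarrow> S \<inter> T = {}" using fin by (simp add: m_disj_def mset)
  have "fst ` set xs \<subseteq> {0, 1} \<times> {1..n}"
    using N by (auto simp: xs_def char_stream_def)
  moreover have "0 \<le> frequency (take k xs) v" for k v
  proof (rule frequency_nonneg)
    fix u assume "u \<in> set (take k xs)"
    then have "u \<in> set xs" by (rule in_set_takeD)
    then show "0 \<le> snd u" by (auto simp: xs_def char_stream_def)
  qed
  ultimately show "xs \<in> disj_streams n m B"
    using S T B fin by (auto simp: disj_streams_def strict_turnstile_def mset count_mset_set')
qed

section \<open>Cutting annotated streams and help messages into pieces\<close>

text \<open>Bob's share of the annotated stream: \<open>k\<close> elements have gone by, so his
  annotation strings are numbered from \<open>Suc k\<close> on.\<close>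

definition annotated_tail :: "(nat \<Rightarrow> bits) \<Rightarrow> nat \<Rightarrow> 'x list \<Rightarrow> 'x symbol list" where
  "annotated_tail a k ys = concat (map (\<lambda>i. Elem (ys ! i) # map Annot (a (Suc (k + i)))) [0..<length ys])"

lemma annotated_append: "annotated a (xs @ ys) = annotated a xs @ annotated_tail a (length xs) ys"
proof -
  let ?g = "\<lambda>zs i. Elem (zs ! i) # map Annot (a (Suc i))"
  have "[0..<length (xs @ ys)] = [0..<length xs] @ map (\<lambda>i. length xs + i) [0..<length ys]"
    using upt_add_eq_append[of 0 "length xs" "length ys"] map_add_upt[of "length xs" "length ys"]
    by (simp add: add.commute)
  moreover have "map (?g (xs @ ys)) [0..<length xs] = map (?g xs) [0..<length xs]"
    by (simp add: nth_append)
  moreover have "map (?g (xs @ ys)) (map (\<lambda>i. length xs + i) [0..<length ys]) =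
      map (\<lambda>i. Elem (ys ! i) # map Annot (a (Suc (length xs + i)))) [0..<length ys]"
    by simp
  ultimately show ?thesis unfolding annotated_def annotated_tail_def map_append
    by (simp only: map_append concat_append append_assoc)
qed

lemma annotated_cong:
  assumes "\<And>i. i \<le> length xs \<Longrightarrow> a i = a' i"
  shows "annotated a xs = annotated a' xs"
  unfolding annotated_def using assms by (intro arg_cong2[where f = append] arg_cong[where f = concat]) auto

text \<open>Recovers the annotation strings from one help message. A message of the wrong length is
  still cut into some annotation sequence, to which soundness applies.\<close>

definition split_annotation :: "(nat \<Rightarrow> nat) \<Rightarrow> bits \<Rightarrow> nat \<Rightarrow> bits" where
  "split_annotation len h i = take (len i) (drop (\<Sum>j<i. len j) h)"

lemma length_concat_annotation:
  assumes "\<And>i. i < N \<Longrightarrow> length (a i) = len i"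
  shows "length (concat (map a [0..<N])) = (\<Sum>j<N. len j)"
  using assms by (induction N) auto

lemma split_annotation_concat:
  assumes len: "\<And>i. i < N \<Longrightarrow> length (a i) = len i" and i: "i < N"
  shows "split_annotation len (concat (map a [0..<N])) i = a i"
proof -
  have "[0..<N] = [0..<i] @ i # [Suc i..<N]"
    using i upt_add_eq_append[of 0 i "N - i"] upt_conv_Cons[of i N] by simp
  then have "concat (map a [0..<N]) = concat (map a [0..<i]) @ a i @ concat (map a [Suc i..<N])"
    by simp
  moreover have "length (concat (map a [0..<i])) = (\<Sum>j<i. len j)"
    using len i by (intro length_concat_annotation) auto
  ultimately show ?thesis using len[OF i] by (simp add: split_annotation_def)
qed

lemma memory_bits_foldl:
  assumes "memory_bits V w" "length s = w"
  shows "length (foldl (step_mem V r) s ys) = w"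
  using assms(2)
proof (induction ys arbitrary: s)
  case (Cons y ys)
  then show ?case using assms(1) by (simp add: memory_bits_def)
qed simp

text \<open>Alice announces \<open>f x\<close> bit by bit: \<open>s\<close> is the part already sent
  and \<open>K\<close> the rest of the conversation.\<close>

primrec send_bits :: "nat \<Rightarrow> ('x \<Rightarrow> bits) \<Rightarrow> bits \<Rightarrow> (bits \<Rightarrow> ('x, 'y) protocol) \<Rightarrow> ('x, 'y) protocol" where
  "send_bits 0 f s K = K s"
| "send_bits (Suc j) f s K = Alice (\<lambda>x. f x ! length s)
     (send_bits j f (s @ [True]) K) (send_bits j f (s @ [False]) K)"

lemma send_bits_from:
  assumes "length (f x) = length s + j" "s = take (length s) (f x)"
  shows "out (send_bits j f s K) x y = out (K (f x)) x y"
    and "bits_exchanged (send_bits j f s K) x y = j + bits_exchanged (K (f x)) x y"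
  using assms
proof (induction j arbitrary: s)
  case 0
  case 1
  then show ?case by simp
next
  case 0
  case 2
  then show ?case by simp
next
  case (Suc j)
  {
    case 1
    then have "s @ [f x ! length s] = take (Suc (length s)) (f x)"
      by (simp add: take_Suc_conv_app_nth)
    then show ?case using Suc(1)[of "s @ [f x ! length s]"] 1 by (cases "f x ! length s") simp_all
  next
    case 2
    then have "s @ [f x ! length s] = take (Suc (length s)) (f x)"
      by (simp add: take_Suc_conv_app_nth)
    then show ?case using Suc(2)[of "s @ [f x ! length s]"] 2 by (cases "f x ! length s") simp_all
  }
qed

lemmas send_bits = send_bits_from[where s = "[]", simplified]

text \<open>Alice runs the verifier on her half of the stream and sends its memory; Bob finishes the
  run. The cost is 1 + c for the help, \<open>w\<close> for the state and 1 for Bob's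
  answer.\<close>

lemma ma_complexity_le_scheme:
  fixes P :: "update prover" and V :: "(update, bool) verifier"
  assumes bits: "annotation_bits (disj_streams n m B) P c" "memory_bits V w"
    and complete: "completeness_error (disj_streams n m B) (m_disj n) P V \<delta>" "\<delta> \<le> 1/3"
    and sound: "soundness_error (disj_streams n m B) (m_disj n) V (1/3)" and B: "B \<ge> 1"
  shows "ma_complexity (small_subsets n m) (small_subsets n m) (\<lambda>S T. S \<inter> T = {}) \<le> enat (c + w + 2)"
proof -
  let ?S = "small_subsets n m"
  define xs where "xs S T = char_stream 0 n S @ char_stream 1 n T" for S T
  have legal: "xs S T \<in> disj_streams n m B" "m_disj n (xs S T) \<longleftrightarrow> S \<inter> T = {}"
    if "S \<in> ?S" "T \<in> ?S" for S T
    using that B char_streams_disj[of n n S m T B] unfolding xs_def small_subsets_def by simp_all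
  have len_xs: "length (xs S T) = n + n" for S T by (simp add: xs_def)
  \<comment> \<open>All padded streams have length 2 n, so the lengths of the honest strings are
    known without the input and the help message can be cut correctly.\<close>
  obtain len where len: "\<And>S T r i. S \<in> ?S \<Longrightarrow> T \<in> ?S \<Longrightarrow> r \<in> set_pmf (prover_coins P) \<Longrightarrow> i \<le> n + n \<Longrightarrow>
      length (annotation P i (xs S T) r) = len i" "(\<Sum>i\<le>n + n. len i) \<le> c"
  proof -
    obtain len' where len': "\<And>ys r i. ys \<in> disj_streams n m B \<Longrightarrow> r \<in> set_pmf (prover_coins P) \<Longrightarrow> i \<le> length ys \<Longrightarrow>
      length (annotation P i ys r) = len' (length ys) i"
      "\<And>ys. ys \<in> disj_streams n m B \<Longrightarrow> (\<Sum>i\<le>length ys. len' (length ys) i) \<le> c"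
      using bits(1) unfolding annotation_bits_def by blast
    have "{} \<in> ?S" by (simp add: small_subsets_def)
    then show ?thesis
      using len'(1)[OF legal(1)] len'(2)[OF legal(1), of "{}" "{}"] that[of "len' (n + n)"]
      by (auto simp: len_xs)
  qed
  define state where "state h r S = foldl (step_mem V r) (init_mem V r) (annotated (split_annotation len h) (char_stream 0 n S))"
    for h r S
  define finish where "finish h r s T =
    (verdict V r (foldl (step_mem V r) s (annotated_tail (split_annotation len h) n (char_stream 1 n T))) = Some True)"
    for h r s T
  define M :: "(nat set, nat set) ma_protocol" where
    "M = \<lparr>merlin_coins = prover_coins P,
          merlin_msg = \<lambda>S T r. concat (map (\<lambda>i. annotation P i (xs S T) r) [0..<Suc (n + n)]),
          public_coins = verifier_coins V,
          conversation = \<lambda>h r. send_bits w (state h r) [] (\<lambda>s. Bob (finish h r s) (Leaf True) (Leaf False))\<rparr>"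
  have len_state: "length (state h r S) = w" for h r S
    unfolding state_def using bits(2) by (intro memory_bits_foldl) (auto simp: memory_bits_def)
  have out: "out (conversation M h r) S T \<longleftrightarrow> run V r (annotated (split_annotation len h) (xs S T)) = Some True" for h r S T
  proof -
    have "out (conversation M h r) S T = finish h r (state h r S) T" by (simp add: M_def send_bits len_state)
    then show ?thesis by (simp add: finish_def state_def run_def xs_def annotated_append)
  qed
  have "ma_computes ?S ?S (\<lambda>S T. S \<inter> T = {}) M (1/3) (1/3)"
    unfolding ma_computes_def
  proof (intro ballI conjI impI allI)
    fix S T assume ST: "S \<in> ?S" "T \<in> ?S" and disj: "S \<inter> T = {}"
    have "measure_pmf.prob (pair_pmf (merlin_coins M) (public_coins M))
          {(r\<^sub>M, r). \<not> out (conversation M (merlin_msg M S T r\<^sub>M) r) S T} \<le>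
      measure_pmf.prob (pair_pmf (prover_coins P) (verifier_coins V))
        {(r\<^sub>P, r\<^sub>V). run V r\<^sub>V (annotated (\<lambda>i. annotation P i (xs S T) r\<^sub>P) (xs S T)) \<noteq> Some (m_disj n (xs S T))}"
    proof -
      have "annotated (split_annotation len (merlin_msg M S T r)) (xs S T) =
          annotated (\<lambda>i. annotation P i (xs S T) r) (xs S T)" if "r \<in> set_pmf (prover_coins P)" for r
        unfolding M_def ma_protocol.simps
        using len(1)[OF ST that] by (intro annotated_cong split_annotation_concat) (auto simp: len_xs)
      then have "x \<in> {(r\<^sub>M, r). \<not> out (conversation M (merlin_msg M S T r\<^sub>M) r) S T} \<longrightarrow>
        x \<in> {(r\<^sub>P, r\<^sub>V). run V r\<^sub>V (annotated (\<lambda>i. annotation P i (xs S T) r\<^sub>P) (xs S T)) \<noteq> Some (m_disj n (xs S T))}"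
        if "x \<in> set_pmf (pair_pmf (prover_coins P) (verifier_coins V))" for x
        using that legal(2)[OF ST] disj by (auto simp: out)
      moreover have "merlin_coins M = prover_coins P" "public_coins M = verifier_coins V" by (simp_all add: M_def)
      ultimately show ?thesis
        by (simp only: , intro measure_pmf.finite_measure_mono_AE) (auto simp: AE_measure_pmf_iff)
    qed
    also have "\<dots> \<le> \<delta>" using complete(1) legal(1)[OF ST] unfolding completeness_error_def by blast
    finally show "measure_pmf.prob (pair_pmf (merlin_coins M) (public_coins M))
          {(r\<^sub>M, r). \<not> out (conversation M (merlin_msg M S T r\<^sub>M) r) S T} \<le> 1/3" using complete(2) by simp
  next
    fix S T h assume ST: "S \<in> ?S" "T \<in> ?S" and int: "\<not> S \<inter> T = {}"
    have "measure_pmf.prob (public_coins M) {r. out (conversation M h r) S T} \<le>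
      measure_pmf.prob (verifier_coins V)
        {r\<^sub>V. run V r\<^sub>V (annotated (split_annotation len h) (xs S T)) \<notin> {Some (m_disj n (xs S T)), None}}"
    proof -
      have "public_coins M = verifier_coins V" by (simp add: M_def)
      then show ?thesis using legal(2)[OF ST] int
        by (simp only: out, intro measure_pmf.finite_measure_mono) auto
    qed
    also have "\<dots> \<le> 1/3" using sound legal(1)[OF ST] unfolding soundness_error_def by blast
    finally show "measure_pmf.prob (public_coins M) {r. out (conversation M h r) S T} \<le> 1/3" .
  qed
  then have "ma_complexity ?S ?S (\<lambda>S T. S \<inter> T = {}) \<le> hcost ?S ?S M + vcost ?S ?S M"
    unfolding ma_complexity_def by (intro INF_lower) simp
  also have "hcost ?S ?S M \<le> 1 + enat c"
    unfolding hcost_def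
  proof (intro add_left_mono SUP_least, clarify)
    fix S T r assume ST: "S \<in> ?S" "T \<in> ?S" and r: "r \<in> set_pmf (merlin_coins M)"
    have "length (merlin_msg M S T r) = (\<Sum>j<Suc (n + n). len j)"
      unfolding M_def ma_protocol.simps
      using len(1)[OF ST] r by (intro length_concat_annotation) (auto simp: M_def)
    then show "enat (length (merlin_msg M S T r)) \<le> enat c"
      using len(2) by (simp only: lessThan_Suc_atMost enat_ord_simps)
  qed
  also have "vcost ?S ?S M \<le> enat (w + 1)"
    unfolding vcost_def
  proof (intro SUP_least, clarify)
    fix S T h r
    show "enat (bits_exchanged (conversation M h r) S T) \<le> enat (w + 1)"
      by (simp add: M_def send_bits len_state)
  qed
  also have "1 + enat c + enat (w + 1) = enat (c + w + 2)"
    by (simp add: one_enat_def)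
  finally show ?thesis by (simp add: add_mono)
qed

section \<open>The lower bound\<close>

text \<open>Expand the product of one factor per point of \<open>A\<close>: 1 + x inside
  \<open>I\<close> and 2 outside. Up to scaling this is the exponential moment of
  \<open>card (S \<inter> I)\<close> for a uniform \<open>S\<close>.\<close>

lemma sum_Pow_power_card_Int:
  fixes x :: real
  assumes "finite A"
  shows "(\<Sum>S\<in>Pow A. x ^ card (S \<inter> I)) = (1 + x) ^ card (A \<inter> I) * 2 ^ card (A - I)"
proof -
  let ?f = "\<lambda>i. if i \<in> I then x else 1"
  have "(\<Sum>S\<in>Pow A. x ^ card (S \<inter> I)) = (\<Sum>S\<in>Pow A. prod ?f S * prod (\<lambda>_. 1) (A - S))"
  proof (intro sum.cong refl)
    fix S assume "S \<in> Pow A"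
    then have "finite S" using assms finite_subset by blast
    then have "prod ?f S = (\<Prod>i\<in>S \<inter> I. x)" by (rule prod.inter_restrict[symmetric])
    then show "x ^ card (S \<inter> I) = prod ?f S * prod (\<lambda>_. 1) (A - S)" by simp
  qed
  also have "\<dots> = (\<Prod>i\<in>A. ?f i + 1)" using assms by (rule prod_add[symmetric])
  also have "\<dots> = (\<Prod>i\<in>A \<inter> I. ?f i + 1) * (\<Prod>i\<in>A - I. ?f i + 1)"
    using prod.Int_Diff[OF assms, of "\<lambda>i. ?f i + 1" I] .
  also have "\<dots> = (1 + x) ^ card (A \<inter> I) * 2 ^ card (A - I)"
    by (simp add: add.commute)
  finally show ?thesis .
qed

text \<open>By Markov's inequality half of the sets in \<open>P\<close> meet \<open>I\<close> in at most \<open>card I / 8\<close> points, and such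
  sets are rare among all subsets.\<close>

lemma card_family_le_of_light_coordinates:
  assumes P: "P \<subseteq> Pow {1..m}"
  defines "I \<equiv> {i\<in>{1..m}. 16 * card {S\<in>P. i \<in> S} \<le> card P}"
  shows "real (card P) \<le> 2 * 2 ^ m * (3/4) ^ card I"
proof -
  \<comment> \<open>The exponent 8 makes the weight of every member of \<open>H\<close> at least
    (3/4)^(card I), while (1 + ?x) / 2 <= 9/16 = (3/4)^2; dividing leaves one power of 3/4.\<close>
  let ?x = "(3/4) ^ 8 :: real"
  define H where "H = {S\<in>P. 8 * card (S \<inter> I) \<le> card I}"
  have fin: "finite P" "finite I" using P finite_subset by (auto simp: I_def)
  have half: "card P \<le> 2 * card H"
  proof (cases "card I = 0")
    case True
    then have "H = P" using fin by (auto simp: H_def)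
    then show ?thesis by simp
  next
    case False
    have "card (P - H) * card I = (\<Sum>S\<in>P - H. card I)" by simp
    also have "\<dots> \<le> (\<Sum>S\<in>P - H. 8 * card (S \<inter> I))"
      by (intro sum_mono) (auto simp: H_def)
    also have "\<dots> \<le> (\<Sum>S\<in>P. 8 * card (S \<inter> I))"
      using fin by (intro sum_mono2) auto
    finally have "2 * (card (P - H) * card I) \<le> 2 * (\<Sum>S\<in>P. 8 * card (S \<inter> I))" by (rule mult_le_mono2)
    also have "\<dots> = (\<Sum>S\<in>P. 16 * card (S \<inter> I))" by (simp add: sum_distrib_left)
    also have "\<dots> = (\<Sum>S\<in>P. \<Sum>i\<in>I. if i \<in> S then 16 else 0)"
      using fin by (intro sum.cong refl) (simp add: sum.inter_restrict[symmetric] Int_commute)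
    also have "\<dots> = (\<Sum>i\<in>I. \<Sum>S\<in>P. if i \<in> S then 16 else 0)" by (rule sum.swap)
    also have "\<dots> = (\<Sum>i\<in>I. 16 * card {S\<in>P. i \<in> S})"
      using fin by (intro sum.cong refl) (simp add: sum.inter_filter[symmetric])
    also have "\<dots> \<le> (\<Sum>i\<in>I. card P)" by (intro sum_mono) (simp add: I_def)
    finally have "(2 * card (P - H)) * card I \<le> card P * card I" by (simp add: mult.commute)
    then have "2 * card (P - H) \<le> card P" using False by simp
    moreover have "card (P - H) = card P - card H"
      using fin by (intro card_Diff_subset) (auto simp: H_def)
    ultimately show ?thesis by linarith
  qed
  have "real (card H) * (3/4) ^ card I = (\<Sum>S\<in>H. (3/4) ^ card I)" by simp
  also have "\<dots> \<le> (\<Sum>S\<in>H. ?x ^ card (S \<inter> I))"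
    unfolding power_mult[symmetric] by (intro sum_mono power_decreasing) (auto simp: H_def)
  also have "\<dots> \<le> (\<Sum>S\<in>Pow {1..m}. ?x ^ card (S \<inter> I))"
    using P by (intro sum_mono2) (auto simp: H_def)
  also have "\<dots> = (1 + ?x) ^ card I * 2 ^ card ({1..m} - I)"
    by (subst sum_Pow_power_card_Int) (auto simp: I_def intro!: arg_cong[where f = card] arg_cong2[where f = "(^)"])
  also have "\<dots> \<le> (9/8) ^ card I * 2 ^ card ({1..m} - I)"
    by (intro mult_right_mono power_mono) (auto simp: power_divide)
  also have "\<dots> = (9/16) ^ card I * 2 ^ m"
  proof -
    have "I \<subseteq> {1..m}" by (auto simp: I_def)
    then have "card ({1..m} - I) = m - card I" "card I \<le> m"
      using fin card_mono[of "{1..m}" I] by (simp_all add: card_Diff_subset)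
    then have "m = card I + card ({1..m} - I)" by simp
    then have "(2::real) ^ m = 2 ^ card I * 2 ^ card ({1..m} - I)" by (metis power_add)
    then show ?thesis by (simp add: power_mult_distrib[symmetric])
  qed
  also have "(9/16 :: real) ^ card I = (3/4) ^ card I * (3/4) ^ card I" by (simp add: power_mult_distrib[symmetric])
  finally have "real (card H) \<le> (3/4) ^ card I * 2 ^ m" by (simp add: mult.assoc mult.left_commute)
  moreover have "real (card P) \<le> 2 * real (card H)" using half by linarith
  ultimately show ?thesis by (simp add: mult_ac)
qed

text \<open>Among the sets with a common message \<open>w\<close>, an item of \<open>u\<close> lying
  in more than 1/16 of them bounds the disjoint ones by 15 times the intersecting ones. Otherwise
  \<open>u\<close> has only light items: either these are few, which gives (m/16)^t, or the sets
  with message \<open>w\<close> are few by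
  \<open>card_family_le_of_light_coordinates\<close>.\<close>

lemma one_way_disjointness_bound:
  fixes msg :: "nat set \<Rightarrow> 'w" and acc :: "'w \<Rightarrow> nat list \<Rightarrow> bool" and m t :: nat
  assumes W: "finite W" "msg ` Pow {1..m} \<subseteq> W"
  defines "U \<equiv> {u. set u \<subseteq> {1..m} \<and> length u = t}"
  defines "A \<equiv> Pow {1..m} \<times> U"
  shows "real (card {(S, u) \<in> A. S \<inter> set u = {} \<and> acc (msg S) u}) \<le>
    15 * real (card {(S, u) \<in> A. S \<inter> set u \<noteq> {} \<and> acc (msg S) u}) +
    real (card W) * (2 * 2 ^ m * (3/4) ^ (m div 16)) * real m ^ t + 2 ^ m * (real m / 16) ^ t"
proof -
  define P where "P w = {S\<in>Pow {1..m}. msg S = w}" for w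
  define D where "D w u = (if acc w u then real (card {S\<in>P w. S \<inter> set u = {}}) else 0)" for w u
  define N where "N w u = (if acc w u then real (card {S\<in>P w. S \<inter> set u \<noteq> {}}) else 0)" for w u
  define \<epsilon> where "\<epsilon> = 2 * 2 ^ m * (3/4 :: real) ^ (m div 16)"
  have finU: "finite U" "card U = m ^ t"
    unfolding U_def by (auto simp: finite_lists_length_eq card_lists_length_eq)
  have finP: "finite (P w)" for w by (simp add: P_def)
  have count: "real (card {(S, u) \<in> A. Q S u \<and> acc (msg S) u}) =
      (\<Sum>w\<in>W. \<Sum>u\<in>U. if acc w u then real (card {S\<in>P w. Q S u}) else 0)" for Q
  proof -
    have "{(S, u) \<in> A. Q S u \<and> acc (msg S) u} =
        (\<Union>(w, u)\<in>W \<times> U. {S\<in>P w. Q S u \<and> acc w u} \<times> {u})"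
      using W(2) by (auto simp: A_def P_def)
    also have "card \<dots> = (\<Sum>(w, u)\<in>W \<times> U. card ({S\<in>P w. Q S u \<and> acc w u} \<times> {u}))"
      unfolding split_def using W(1) finU finP
      by (intro card_UN_disjoint) (auto simp: P_def)
    also have "\<dots> = (\<Sum>w\<in>W. \<Sum>u\<in>U. card {S\<in>P w. Q S u \<and> acc w u})"
      by (subst sum.cartesian_product) (simp add: card_cartesian_product)
    finally show ?thesis by (auto simp: intro!: sum.cong)
  qed
  have piece: "(\<Sum>u\<in>U. D w u) \<le> 15 * (\<Sum>u\<in>U. N w u) + (\<epsilon> * real m ^ t + real (card (P w)) * (real m / 16) ^ t)" for w
  proof -
    define I where "I = {i\<in>{1..m}. 16 * card {S\<in>P w. i \<in> S} \<le> card (P w)}"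
    let ?L = "{u. set u \<subseteq> I \<and> length u = t}"
    have finL: "finite ?L" "card ?L = card I ^ t"
      by (auto simp: I_def finite_lists_length_eq card_lists_length_eq)
    have DN: "D w u \<le> 15 * N w u + (if u \<in> ?L then real (card (P w)) else 0)" if u: "u \<in> U" for u
    proof (cases "acc w u")
      case True
      have split: "card (P w) = card {S\<in>P w. S \<inter> set u = {}} + card {S\<in>P w. S \<inter> set u \<noteq> {}}"
        using finP by (subst card_Un_disjoint[symmetric]) (auto intro!: arg_cong[where f = card])
      show ?thesis
      proof (cases "u \<in> ?L")
        case True
        then show ?thesis using split by (simp add: D_def N_def)
      next
        case False
        then obtain i where iI: "i \<in> set u" "i \<notin> I" using u unfolding U_def by blast
        then have i: "i \<in> set u" "i \<in> {1..m}" "card (P w) < 16 * card {S\<in>P w. i \<in> S}"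
          using u by (auto simp: U_def I_def not_le)
        have "card {S\<in>P w. i \<in> S} \<le> card {S\<in>P w. S \<inter> set u \<noteq> {}}"
          using i finP by (intro card_mono) auto
        then have "card {S\<in>P w. S \<inter> set u = {}} \<le> 15 * card {S\<in>P w. S \<inter> set u \<noteq> {}}"
          using i split by linarith
        then show ?thesis using False \<open>acc w u\<close> by (simp add: D_def N_def)
      qed
    qed (simp add: D_def N_def)
    have "(\<Sum>u\<in>U. D w u) \<le> (\<Sum>u\<in>U. 15 * N w u + (if u \<in> ?L then real (card (P w)) else 0))"
      by (intro sum_mono DN)
    also have "\<dots> = 15 * (\<Sum>u\<in>U. N w u) + (\<Sum>u\<in>U. if u \<in> ?L then real (card (P w)) else 0)"
      by (simp add: sum.distrib sum_distrib_left)
    also have "(\<Sum>u\<in>U. if u \<in> ?L then real (card (P w)) else 0) = (\<Sum>u\<in>U \<inter> ?L. real (card (P w)))"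
      using finU(1) by (rule sum.inter_restrict[symmetric])
    also have "U \<inter> ?L = ?L" by (auto simp: U_def I_def)
    also have "(\<Sum>u\<in>?L. real (card (P w))) = real (card (P w)) * real (card I) ^ t" using finL by simp
    also have "\<dots> \<le> \<epsilon> * real m ^ t + real (card (P w)) * (real m / 16) ^ t"
    proof (cases "16 * card I \<le> m")
      case True
      then have "real (card I) \<le> real m / 16" by linarith
      then have "real (card (P w)) * real (card I) ^ t \<le> real (card (P w)) * (real m / 16) ^ t"
        by (intro mult_left_mono power_mono) auto
      then show ?thesis by (simp add: \<epsilon>_def add_increasing)
    next
      case False
      have "real (card (P w)) \<le> 2 * 2 ^ m * (3/4) ^ card I"
        unfolding I_def by (rule card_family_le_of_light_coordinates) (auto simp: P_def)
      also have "\<dots> \<le> \<epsilon>"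
        unfolding \<epsilon>_def using False by (intro mult_left_mono power_decreasing) auto
      finally have "real (card (P w)) \<le> \<epsilon>" .
      moreover have "card I \<le> card {1..m}" unfolding I_def by (intro card_mono) auto
      ultimately have "real (card (P w)) * real (card I) ^ t \<le> \<epsilon> * real m ^ t"
        by (intro mult_mono power_mono) (auto simp: \<epsilon>_def)
      then show ?thesis by (simp add: add_increasing2)
    qed
    finally show ?thesis by simp
  qed
  have "(\<Sum>w\<in>W. card (P w)) = card (\<Union>w\<in>W. P w)"
    using W(1) finP by (intro card_UN_disjoint[symmetric]) (auto simp: P_def)
  also have "(\<Union>w\<in>W. P w) = Pow {1..m}" using W(2) by (auto simp: P_def)
  finally have sumP: "(\<Sum>w\<in>W. real (card (P w))) = 2 ^ m"
    by (simp add: card_Pow flip: of_nat_sum)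
  have "(\<Sum>w\<in>W. \<Sum>u\<in>U. D w u) \<le>
      (\<Sum>w\<in>W. 15 * (\<Sum>u\<in>U. N w u) + (\<epsilon> * real m ^ t + real (card (P w)) * (real m / 16) ^ t))"
    by (intro sum_mono piece)
  also have "\<dots> = 15 * (\<Sum>w\<in>W. \<Sum>u\<in>U. N w u) + real (card W) * \<epsilon> * real m ^ t + 2 ^ m * (real m / 16) ^ t"
    by (simp add: sum.distrib sum_distrib_left[symmetric] sum_distrib_right[symmetric] sumP)
  finally show ?thesis
    unfolding \<epsilon>_def D_def N_def count[of "\<lambda>S u. S \<inter> set u = {}"] count[of "\<lambda>S u. S \<inter> set u \<noteq> {}"] .
qed

section \<open>Averaging over coins and amplification by repetition\<close>

lemma measure_pair_pmf:
  "measure_pmf.prob (pair_pmf M N) X = measure_pmf.expectation M (\<lambda>x. measure_pmf.prob N {y. (x, y) \<in> X})"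
proof -
  have "emeasure (pair_pmf M N) X = (\<integral>\<^sup>+x. \<integral>\<^sup>+y. indicator X (x, y) \<partial>N \<partial>M)"
    by (simp flip: nn_integral_pair_pmf')
  also have "\<dots> = (\<integral>\<^sup>+x. ennreal (measure_pmf.prob N {y. (x, y) \<in> X}) \<partial>M)"
  proof (intro nn_integral_cong)
    fix x
    have "(\<integral>\<^sup>+y. indicator X (x, y) \<partial>N) = (\<integral>\<^sup>+y. indicator {y. (x, y) \<in> X} y \<partial>N)"
      by (intro nn_integral_cong) (simp add: indicator_def)
    then show "(\<integral>\<^sup>+y. indicator X (x, y) \<partial>N) = ennreal (measure_pmf.prob N {y. (x, y) \<in> X})"
      by (simp add: measure_pmf.emeasure_eq_measure)
  qed
  also have "\<dots> = ennreal (measure_pmf.expectation M (\<lambda>x. measure_pmf.prob N {y. (x, y) \<in> X}))"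
    by (intro nn_integral_eq_integral measure_pmf.integrable_const_bound[of _ 1]) auto
  finally show ?thesis
    by (simp add: measure_pmf.emeasure_eq_measure integral_nonneg_AE)
qed

text \<open>Removes the private coins of the prover: some outcome is no worse than the
  average.\<close>

lemma pair_pmf_prob_averaging:
  assumes "measure_pmf.prob (pair_pmf M N) X \<le> \<delta>"
  shows "\<exists>x\<in>set_pmf M. measure_pmf.prob N {y. (x, y) \<in> X} \<le> \<delta>"
proof (rule ccontr)
  assume "\<not> ?thesis"
  then have "\<delta> < measure_pmf.expectation M (\<lambda>x. measure_pmf.prob N {y. (x, y) \<in> X})"
    by (intro measure_pmf.expectation_greater measure_pmf.integrable_const_bound[of _ 1])
      (auto simp: AE_measure_pmf_iff)
  then show False using assms by (simp add: measure_pair_pmf)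
qed

text \<open>Markov's inequality for \<open>2\<close> to the power of the number of successes.\<close>

lemma replicate_pmf_successes:
  assumes "measure_pmf.prob p {x. Q x} \<le> 1/3"
  shows "measure_pmf.prob (replicate_pmf k p) {xs. j \<le> length (filter Q xs)} \<le> (4/3) ^ k / 2 ^ j"
proof (induction k arbitrary: j)
  case 0
  then show ?case by (simp add: indicator_def)
next
  case (Suc k)
  define T where "T j = measure_pmf.prob (replicate_pmf k p) {xs. j \<le> length (filter Q xs)}" for j
  show ?case
  proof (cases j)
    case 0
    have "1 \<le> (4/3 :: real) ^ Suc k" by (rule one_le_power) simp
    then show ?thesis using 0 by simp
  next
    case (Suc i)
    have "replicate_pmf (Suc k) p = map_pmf (\<lambda>(x, xs). x # xs) (pair_pmf p (replicate_pmf k p))"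
      by (simp add: pair_pmf_def map_bind_pmf)
    then have "measure_pmf.prob (replicate_pmf (Suc k) p) {xs. j \<le> length (filter Q xs)} =
        measure_pmf.expectation p (\<lambda>x. measure_pmf.prob (replicate_pmf k p) {xs. j \<le> length (filter Q (x # xs))})"
      by (simp add: measure_pair_pmf vimage_def)
    \<comment> \<open>A success in the first trial lowers the number still required from
      \<open>j\<close> to \<open>i\<close>, so each trial multiplies the bound by 1 plus the success
      probability, at most 4/3.\<close>
    also have "\<dots> = measure_pmf.expectation p (\<lambda>x. T j + (T i - T j) * indicator {x. Q x} x)"
      by (intro Bochner_Integration.integral_cong) (auto simp: T_def Suc indicator_def)
    also have "\<dots> = T j + (T i - T j) * measure_pmf.prob p {x. Q x}"
      by (subst Bochner_Integration.integral_add) (auto simp: measure_pmf.emeasure_eq_measure)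
    also have "\<dots> = (1 - measure_pmf.prob p {x. Q x}) * T j + measure_pmf.prob p {x. Q x} * T i"
      by (simp add: algebra_simps)
    also have "\<dots> \<le> (1 - measure_pmf.prob p {x. Q x}) * ((4/3) ^ k / 2 ^ j) + measure_pmf.prob p {x. Q x} * ((4/3) ^ k / 2 ^ i)"
      using Suc.IH unfolding T_def by (intro add_mono mult_left_mono) auto
    also have "\<dots> = (1 + measure_pmf.prob p {x. Q x}) * ((4/3) ^ k / 2 ^ j)"
      by (simp add: Suc field_simps)
    also have "\<dots> \<le> (4/3) * ((4/3) ^ k / 2 ^ j)"
      using assms by (intro mult_right_mono) auto
    finally show ?thesis by simp
  qed
qed

text \<open>With the coins of all 2 j repetitions fixed, the threshold test is a deterministic
  one-way protocol with messages of 2 j w bits; then take expectations. All repetitions share the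
  annotation \<open>h\<close>, so they cost memory only.\<close>

lemma amplified_one_way_bound:
  fixes q :: "'h \<Rightarrow> bits pmf" and state :: "'h \<Rightarrow> bits \<Rightarrow> nat set \<Rightarrow> bits"
    and fin :: "'h \<Rightarrow> bits \<Rightarrow> bits \<Rightarrow> nat list \<Rightarrow> bool" and p :: "bits pmf" and m t w j :: nat
  assumes state: "\<And>r S. length (state h r S) = w"
  defines "U \<equiv> {u. set u \<subseteq> {1..m} \<and> length u = t}"
  defines "A \<equiv> Pow {1..m} \<times> U"
  defines "g \<equiv> \<lambda>S u. measure_pmf.prob (replicate_pmf (2 * j) p)
    {rs. j \<le> length (filter (\<lambda>r. fin h r (state h r S) u) rs)}"
  shows "(\<Sum>(S, u) | (S, u) \<in> A \<and> S \<inter> set u = {}. g S u) \<le>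
    15 * (\<Sum>(S, u) | (S, u) \<in> A \<and> S \<inter> set u \<noteq> {}. g S u) +
    2 ^ (w * (2 * j)) * (2 * 2 ^ m * (3/4) ^ (m div 16)) * real m ^ t + 2 ^ m * (real m / 16) ^ t"
    (is "_ \<le> 15 * _ + ?E + ?L")
proof -
  let ?R = "replicate_pmf (2 * j) p"
  define acc where "acc rs S u \<longleftrightarrow> j \<le> length (filter (\<lambda>r. fin h r (state h r S) u) rs)" for rs S u
  have finA: "finite A" unfolding A_def U_def by (intro finite_cartesian_product) (auto simp: finite_lists_length_eq)
  have expectation: "(\<Sum>(S, u) | (S, u) \<in> A \<and> Q S u. g S u) =
      measure_pmf.expectation ?R (\<lambda>rs. real (card {(S, u) \<in> A. Q S u \<and> acc rs S u}))" for Q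
  proof -
    let ?B = "{x\<in>A. case x of (S, u) \<Rightarrow> Q S u}"
    have B: "{(S, u). (S, u) \<in> A \<and> Q S u} = ?B" by auto
    have finB: "finite ?B" using finA by simp
    have "real (card {(S, u) \<in> A. Q S u \<and> acc rs S u}) = (\<Sum>x\<in>?B. indicator {rs. case x of (S, u) \<Rightarrow> acc rs S u} rs)" for rs
    proof -
      have "(\<Sum>x\<in>?B. indicator {rs. case x of (S, u) \<Rightarrow> acc rs S u} rs) =
          (\<Sum>x\<in>?B. if case x of (S, u) \<Rightarrow> acc rs S u then 1 else 0 :: real)"
        by (intro sum.cong refl) (simp add: indicator_def)
      also have "\<dots> = real (card {x\<in>?B. case x of (S, u) \<Rightarrow> acc rs S u})"
        using finB by (simp flip: sum.inter_filter)
      also have "{x\<in>?B. case x of (S, u) \<Rightarrow> acc rs S u} = {(S, u) \<in> A. Q S u \<and> acc rs S u}" by auto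
      finally show ?thesis by simp
    qed
    then have "measure_pmf.expectation ?R (\<lambda>rs. real (card {(S, u) \<in> A. Q S u \<and> acc rs S u})) =
        measure_pmf.expectation ?R (\<lambda>rs. \<Sum>x\<in>?B. indicator {rs. case x of (S, u) \<Rightarrow> acc rs S u} rs)"
      by simp
    also have "\<dots> = (\<Sum>x\<in>?B. measure_pmf.expectation ?R (indicator {rs. case x of (S, u) \<Rightarrow> acc rs S u}))"
      by (intro Bochner_Integration.integral_sum) (auto simp: measure_pmf.emeasure_eq_measure)
    also have "\<dots> = (\<Sum>x\<in>?B. case x of (S, u) \<Rightarrow> g S u)"
      by (intro sum.cong refl) (auto simp: g_def acc_def)
    finally show ?thesis unfolding B by simp
  qed
  have integrable: "integrable ?R (\<lambda>rs. real (card {(S, u) \<in> A. Q S u \<and> acc rs S u}))" for Q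
    using finA by (intro measure_pmf.integrable_const_bound[of _ "real (card A)"])
      (auto intro!: card_mono)
  have bound: "real (card {(S, u) \<in> A. S \<inter> set u = {} \<and> acc rs S u}) \<le>
      15 * real (card {(S, u) \<in> A. S \<inter> set u \<noteq> {} \<and> acc rs S u}) + (?E + ?L)"
    if "rs \<in> set_pmf ?R" for rs
  proof -
    let ?W = "{ws. set ws \<subseteq> {bs :: bits. length bs = w} \<and> length ws = 2 * j}"
    let ?msg = "\<lambda>S. map (\<lambda>r. state h r S) rs"
    let ?acc = "\<lambda>ws u. j \<le> length (filter (\<lambda>(r, s). fin h r s u) (zip rs ws))"
    have bits: "finite {bs :: bits. length bs = w}" "card {bs :: bits. length bs = w} = 2 ^ w"
      using finite_lists_length_eq[of "UNIV :: bool set" w] card_lists_length_eq[of "UNIV :: bool set" w]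
      by simp_all
    have W: "finite ?W" "card ?W = 2 ^ (w * (2 * j))"
      using bits by (auto simp: finite_lists_length_eq card_lists_length_eq power_mult)
    have "length rs = 2 * j" using that by (simp add: set_replicate_pmf)
    then have "?msg ` Pow {1..m} \<subseteq> ?W" using state by auto
    moreover have "?acc (?msg S) u = acc rs S u" for S u
      by (simp add: acc_def zip_map2 filter_map comp_def split_def zip_same_conv_map)
    ultimately show ?thesis
      using one_way_disjointness_bound[where W = ?W and msg = ?msg and m = m and acc = ?acc and t = t, folded U_def, folded A_def] W
      by (simp add: add.assoc)
  qed
  have "measure_pmf.expectation ?R (\<lambda>rs. real (card {(S, u) \<in> A. S \<inter> set u = {} \<and> acc rs S u})) \<le>
      measure_pmf.expectation ?R (\<lambda>rs. 15 * real (card {(S, u) \<in> A. S \<inter> set u \<noteq> {} \<and> acc rs S u}) + (?E + ?L))"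
    using integrable bound
    by (intro integral_mono_AE Bochner_Integration.integrable_add integrable_mult_right)
      (auto simp: AE_measure_pmf_iff)
  also have "\<dots> = 15 * measure_pmf.expectation ?R (\<lambda>rs. real (card {(S, u) \<in> A. S \<inter> set u \<noteq> {} \<and> acc rs S u})) + (?E + ?L)"
    using integrable by simp
  finally show ?thesis
    unfolding expectation[of "\<lambda>S u. S \<inter> set u = {}"] expectation[of "\<lambda>S u. S \<inter> set u \<noteq> {}"] by simp
qed

text \<open>Each \<open>u\<close> has at most \<open>t\<close> distinct items, so at least a
  fraction 2^(-t) of all subsets avoids it.\<close>

lemma card_disjoint_pairs:
  fixes m t :: nat
  defines "U \<equiv> {u. set u \<subseteq> {1..m} \<and> length u = t}"
  shows "2 ^ m * m ^ t \<le> 2 ^ t * card {(S, u) \<in> Pow {1..m} \<times> U. S \<inter> set u = {}}"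
proof -
  have finU: "finite U" "card U = m ^ t"
    unfolding U_def by (auto simp: finite_lists_length_eq card_lists_length_eq)
  have "{(S, u) \<in> Pow {1..m} \<times> U. S \<inter> set u = {}} = prod.swap ` (SIGMA u : U. Pow ({1..m} - set u))"
    by (auto simp: image_iff)
  then have "card {(S, u) \<in> Pow {1..m} \<times> U. S \<inter> set u = {}} = card (SIGMA u : U. Pow ({1..m} - set u))"
    by (simp add: card_image)
  also have "\<dots> = (\<Sum>u\<in>U. 2 ^ card ({1..m} - set u))" using finU by (simp add: card_Pow)
  finally have "2 ^ t * card {(S, u) \<in> Pow {1..m} \<times> U. S \<inter> set u = {}} = (\<Sum>u\<in>U. 2 ^ (t + card ({1..m} - set u)))"
    by (simp add: sum_distrib_left power_add)
  also have "\<dots> \<ge> (\<Sum>u\<in>U. 2 ^ m)"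
  proof (intro sum_mono power_increasing)
    fix u assume "u \<in> U"
    then have "card ({1..m} - set u) = m - card (set u)" "card (set u) \<le> t"
      using card_length[of u] by (auto simp: U_def card_Diff_subset)
    then show "m \<le> t + card ({1..m} - set u)" by simp
  qed simp
  finally show ?thesis using finU by (simp add: mult.commute)
qed

section \<open>From a scheme to the tradeoff between annotation and memory\<close>

lemma run_append: "run V r (ys @ zs) = verdict V r (foldl (step_mem V r) (foldl (step_mem V r) (init_mem V r) ys) zs)"
  by (simp add: run_def)

text \<open>Without memory the answer depends on the coins alone and cannot be right both for two
  empty sets and for S = T = {1}. The resulting w >= 1 lets additive terms be absorbed into
  \<open>w * (c + 1)\<close>.\<close>

lemma disj_scheme_needs_memory:
  fixes P :: "update prover" and V :: "(update, bool) verifier"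
  assumes X: "X = disj_streams n m B" "1 \<le> m" "m \<le> n" "1 \<le> B"
    and "memory_bits V 0" "completeness_error X (m_disj n) P V (1/3)" "soundness_error X (m_disj n) V (1/3)"
  shows False
proof -
  define xs where "xs S = char_stream 0 m S @ char_stream 1 m S" for S
  have xs: "xs S \<in> X" "m_disj n (xs S) \<longleftrightarrow> S = {}" if "S \<subseteq> {1..m}" for S
  proof -
    have "card S \<le> m" using card_mono[of "{1..m}" S] that by simp
    then show "xs S \<in> X" "m_disj n (xs S) \<longleftrightarrow> S = {}"
      using char_streams_disj[of m n S m S B] X that by (auto simp: xs_def)
  qed
  have run: "run V r ys = verdict V r []" for r ys
  proof -
    have "length (init_mem V r) = 0" using assms(5) by (simp add: memory_bits_def)
    then have "length (foldl (step_mem V r) (init_mem V r) ys) = 0" by (rule memory_bits_foldl[OF assms(5)])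
    then show ?thesis by (simp add: run_def)
  qed
  obtain r where "measure_pmf.prob (verifier_coins V)
      {r\<^sub>V. (r, r\<^sub>V) \<in> {(r\<^sub>P, r\<^sub>V). run V r\<^sub>V (annotated (\<lambda>i. annotation P i (xs {}) r\<^sub>P) (xs {})) \<noteq> Some (m_disj n (xs {}))}} \<le> 1/3"
    using pair_pmf_prob_averaging assms(6) xs(1)[of "{}"] unfolding completeness_error_def by blast
  then have "measure_pmf.prob (verifier_coins V) {r. verdict V r [] \<noteq> Some True} \<le> 1/3"
    using xs(2)[of "{}"] by (simp add: run)
  moreover have "measure_pmf.prob (verifier_coins V) {r. verdict V r [] \<notin> {Some False, None}} \<le> 1/3"
  proof -
    have one: "{1} \<subseteq> {1..m}" using X(2) by simp
    show ?thesis
      using assms(7)[unfolded soundness_error_def, rule_format, OF xs(1)[OF one], of "\<lambda>_. []"] xs(2)[OF one]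
      by (simp add: run)
  qed
  moreover have "{r. verdict V r [] \<noteq> Some True} \<union> {r. verdict V r [] \<notin> {Some False, None}} = UNIV"
    by auto
  moreover have "1 \<le> measure_pmf.prob (verifier_coins V) {r. verdict V r [] \<noteq> Some True} +
      measure_pmf.prob (verifier_coins V) {r. verdict V r [] \<notin> {Some False, None}}"
    using measure_Un_le[of "{r. verdict V r [] \<noteq> Some True}" "measure_pmf (verifier_coins V)"
        "{r. verdict V r [] \<notin> {Some False, None}}"] calculation(3)
    by simp
  ultimately show False by linarith
qed

text \<open>Sum the acceptance probabilities over all help strings: a disjoint pair gets at least
  1/2 from its honest string, while soundness makes every summand tiny on intersecting pairs.
  Against the one-way bound this forces 2^(2 c + 4 + 2 j w) to be exponential in
  \<open>m\<close>.\<close>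

lemma disj_scheme_lower_bound:
  fixes P :: "update prover" and V :: "(update, bool) verifier"
  assumes X: "X = disj_streams n m B" "1 \<le> m" "m \<le> n" "1 \<le> B"
    and bits: "annotation_bits X P c" "memory_bits V w"
    and complete: "completeness_error X (m_disj n) P V (1/3)"
    and sound: "soundness_error X (m_disj n) V (1/3)"
  shows "m \<le> 10000 * (w * (c + 1))"
proof -
  have w: "w \<ge> 1"
    using disj_scheme_needs_memory[OF X _ complete sound] bits(2) by (cases w) auto
  define t where "t = c + 1"
  \<comment> \<open>Since (4/3)^(2 j) / 2^j = (8/9)^j and (8/9)^6 <= 1/2, the error after 2 j
    repetitions is at most 2^-(2 c + 8).\<close>
  define j where "j = 6 * (2 * c + 8)"
  define U where "U = {u. set u \<subseteq> {1..m} \<and> length u = t}"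
  define A where "A = Pow {1..m} \<times> U"
  define xs where "xs S u = char_stream 0 m S @ char_stream 1 m (set u)" for S and u :: "nat list"
  have finA: "finite A" unfolding A_def U_def by (intro finite_cartesian_product) (auto simp: finite_lists_length_eq)
  have cardA: "real (card A) = 2 ^ m * real m ^ t"
    unfolding A_def U_def by (simp add: card_cartesian_product card_Pow card_lists_length_eq)
  have xs: "xs S u \<in> X" "m_disj n (xs S u) \<longleftrightarrow> S \<inter> set u = {}" if "(S, u) \<in> A" for S u
  proof -
    have "S \<subseteq> {1..m}" "set u \<subseteq> {1..m}" using that by (auto simp: A_def U_def)
    moreover from this have "card S \<le> m" "card (set u) \<le> m"
      using card_mono[of "{1..m}"] by fastforce+
    ultimately show "xs S u \<in> X" "m_disj n (xs S u) \<longleftrightarrow> S \<inter> set u = {}"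
      using char_streams_disj[of m n S m "set u" B] X by (auto simp: xs_def)
  qed
  have len_xs: "length (xs S u) = m + m" for S u by (simp add: xs_def)
  obtain len' where len': "\<And>ys r i. ys \<in> X \<Longrightarrow> r \<in> set_pmf (prover_coins P) \<Longrightarrow> i \<le> length ys \<Longrightarrow>
      length (annotation P i ys r) = len' (length ys) i"
      "\<And>ys. ys \<in> X \<Longrightarrow> (\<Sum>i\<le>length ys. len' (length ys) i) \<le> c"
    using bits(1) unfolding annotation_bits_def by blast
  define len where "len = len' (m + m)"
  define H where "H = {h :: bits. length h = (\<Sum>i<Suc (m + m). len i)}"
  have "({}, replicate t 1) \<in> A" using X(2) by (auto simp: A_def U_def)
  from len'(2)[OF xs(1)[OF this]] have lenc: "(\<Sum>i<Suc (m + m). len i) \<le> c"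
    by (simp only: len_xs len_def lessThan_Suc_atMost)
  have H: "finite H" "real (card H) \<le> 2 ^ c"
  proof -
    show "finite H" using finite_lists_length_eq[of "UNIV :: bool set" "\<Sum>i<Suc (m + m). len i"] by (simp add: H_def)
    have "card H = 2 ^ (\<Sum>i<Suc (m + m). len i)"
      using card_lists_length_eq[of "UNIV :: bool set" "\<Sum>i<Suc (m + m). len i"] by (simp add: H_def)
    then have "real (card H) = 2 ^ (\<Sum>i<Suc (m + m). len i)" by simp
    also have "\<dots> \<le> 2 ^ c" using lenc by (intro power_increasing) auto
    finally show "real (card H) \<le> 2 ^ c" .
  qed
  define state where "state h r S = foldl (step_mem V r) (init_mem V r) (annotated (split_annotation len h) (char_stream 0 m S))"
    for h r S
  define fin where "fin h r s u \<longleftrightarrow>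
    verdict V r (foldl (step_mem V r) s (annotated_tail (split_annotation len h) m (char_stream 1 m (set u)))) = Some True"
    for h r s and u :: "nat list"
  have len_state: "length (state h r S) = w" for h r S
    unfolding state_def using bits(2) by (intro memory_bits_foldl) (auto simp: memory_bits_def)
  have fin_run: "fin h r (state h r S) u \<longleftrightarrow> run V r (annotated (split_annotation len h) (xs S u)) = Some True" for h r S u
    by (simp add: fin_def state_def xs_def annotated_append run_append)
  define g where "g h S u = measure_pmf.prob (replicate_pmf (2 * j) (verifier_coins V))
    {rs. j \<le> length (filter (\<lambda>r. fin h r (state h r S) u) rs)}" for h S u
  have tail: "(4/3 :: real) ^ (2 * j) / 2 ^ j \<le> 1 / 2 ^ (2 * c + 8)"
  proof -
    have "(4/3 :: real) ^ (2 * j) / 2 ^ j = ((8/9) ^ 6) ^ (2 * c + 8)"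
      by (simp only: power_mult power_divide[symmetric] j_def) (simp add: power_mult[symmetric] power_divide)
    also have "\<dots> \<le> (1/2) ^ (2 * c + 8)" by (intro power_mono) (auto simp: power_divide)
    finally show ?thesis by (simp add: power_divide)
  qed
  have reject: "g h S u \<le> 1 / 2 ^ (2 * c + 8)" if "(S, u) \<in> A" "S \<inter> set u \<noteq> {}" for h S u
  proof -
    have "measure_pmf.prob (verifier_coins V) {r. fin h r (state h r S) u} \<le>
        measure_pmf.prob (verifier_coins V) {r. run V r (annotated (split_annotation len h) (xs S u)) \<notin> {Some (m_disj n (xs S u)), None}}"
      using xs(2)[OF that(1)] that(2) by (intro measure_pmf.finite_measure_mono) (auto simp: fin_run)
    also have "\<dots> \<le> 1/3" using sound xs(1)[OF that(1)] unfolding soundness_error_def by blast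
    finally show ?thesis
      unfolding g_def using replicate_pmf_successes[of "verifier_coins V" "\<lambda>r. fin h r (state h r S) u" "2 * j" j] tail
      by linarith
  qed
  \<comment> \<open>The honest string depends on the pair and on the prover's coins. Averaging fixes
    the coins; summing over \<open>H\<close> removes the dependence on the pair.\<close>
  have accept: "1/2 \<le> (\<Sum>h\<in>H. g h S u)" if Su: "(S, u) \<in> A" "S \<inter> set u = {}" for S u
  proof -
    have "\<exists>r\<^sub>P\<in>set_pmf (prover_coins P). measure_pmf.prob (verifier_coins V)
        {r\<^sub>V. (r\<^sub>P, r\<^sub>V) \<in> {(r\<^sub>P, r\<^sub>V). run V r\<^sub>V (annotated (\<lambda>i. annotation P i (xs S u) r\<^sub>P) (xs S u)) \<noteq> Some (m_disj n (xs S u))}} \<le> 1/3"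
      using complete xs(1)[OF Su(1)] unfolding completeness_error_def by (intro pair_pmf_prob_averaging) blast
    then obtain r\<^sub>P where r\<^sub>P: "r\<^sub>P \<in> set_pmf (prover_coins P)" "measure_pmf.prob (verifier_coins V)
        {r. run V r (annotated (\<lambda>i. annotation P i (xs S u) r\<^sub>P) (xs S u)) \<noteq> Some True} \<le> 1/3"
      using xs(2)[OF Su(1)] Su(2) by auto
    define h where "h = concat (map (\<lambda>i. annotation P i (xs S u) r\<^sub>P) [0..<Suc (m + m)])"
    have len_i: "length (annotation P i (xs S u) r\<^sub>P) = len i" if "i < Suc (m + m)" for i
      using len'(1)[OF xs(1)[OF Su(1)] r\<^sub>P(1)] that by (simp add: len_xs len_def)
    have hH: "h \<in> H" unfolding H_def h_def mem_Collect_eq by (intro length_concat_annotation len_i)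
    have "annotated (split_annotation len h) (xs S u) = annotated (\<lambda>i. annotation P i (xs S u) r\<^sub>P) (xs S u)"
      unfolding h_def by (intro annotated_cong split_annotation_concat len_i) (auto simp: len_xs)
    then have rej: "measure_pmf.prob (verifier_coins V) {r. \<not> fin h r (state h r S) u} \<le> 1/3"
      using r\<^sub>P(2) by (simp add: fin_run)
    have "1 - g h S u = measure_pmf.prob (replicate_pmf (2 * j) (verifier_coins V))
        (- {rs. j \<le> length (filter (\<lambda>r. fin h r (state h r S) u) rs)})"
      unfolding g_def by (subst measure_pmf.prob_compl[symmetric]) (auto simp: Compl_eq_Diff_UNIV)
    also have "\<dots> \<le> measure_pmf.prob (replicate_pmf (2 * j) (verifier_coins V))
        {rs. j \<le> length (filter (\<lambda>r. \<not> fin h r (state h r S) u) rs)}"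
    proof (intro measure_pmf.finite_measure_mono_AE)
      show "AE rs in replicate_pmf (2 * j) (verifier_coins V).
          rs \<in> - {rs. j \<le> length (filter (\<lambda>r. fin h r (state h r S) u) rs)} \<longrightarrow>
          rs \<in> {rs. j \<le> length (filter (\<lambda>r. \<not> fin h r (state h r S) u) rs)}"
        unfolding AE_measure_pmf_iff
      proof (intro ballI impI)
        fix rs assume "rs \<in> set_pmf (replicate_pmf (2 * j) (verifier_coins V))"
        then have "length rs = 2 * j" by (simp add: set_replicate_pmf)
        moreover assume "rs \<in> - {rs. j \<le> length (filter (\<lambda>r. fin h r (state h r S) u) rs)}"
        ultimately show "rs \<in> {rs. j \<le> length (filter (\<lambda>r. \<not> fin h r (state h r S) u) rs)}"
          using sum_length_filter_compl[of "\<lambda>r. fin h r (state h r S) u" rs] by simp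
      qed
    qed simp
    also have "\<dots> \<le> 1 / 2 ^ (2 * c + 8)"
      using replicate_pmf_successes[OF rej, of "2 * j" j] tail by linarith
    also have "\<dots> \<le> 1 / 2 ^ 1" by (intro divide_left_mono power_increasing) auto
    finally have "1/2 \<le> g h S u" by simp
    also have "\<dots> \<le> (\<Sum>h\<in>H. g h S u)"
      using hH H(1) by (intro member_le_sum[where f = "\<lambda>h. g h S u"]) (auto simp: g_def)
    finally show ?thesis .
  qed
  let ?D = "{(S, u). (S, u) \<in> A \<and> S \<inter> set u = {}}"
  let ?N = "{(S, u). (S, u) \<in> A \<and> S \<inter> set u \<noteq> {}}"
  let ?E = "2 ^ (w * (2 * j)) * (2 * 2 ^ m * (3/4) ^ (m div 16)) * real m ^ t"
  let ?L = "2 ^ m * (real m / 16) ^ t"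
  have finD: "finite ?D" "finite ?N" by (rule finite_subset[OF _ finA], auto)+
  have "2 ^ m * m ^ t \<le> 2 ^ t * card ?D"
    using card_disjoint_pairs[of m t] by (simp add: A_def U_def case_prod_unfold)
  then have "real (2 ^ m * m ^ t) \<le> real (2 ^ t * card ?D)" by (simp only: of_nat_le_iff)
  then have cardD: "real (card A) \<le> 2 ^ t * real (card ?D)" by (simp add: cardA)
  have "real (card ?D) * (1/2) = (\<Sum>x\<in>?D. 1/2)" by simp
  also have "\<dots> \<le> (\<Sum>x\<in>?D. case x of (S, u) \<Rightarrow> \<Sum>h\<in>H. g h S u)"
    using accept by (intro sum_mono) auto
  also have "\<dots> = (\<Sum>h\<in>H. \<Sum>(S, u)\<in>?D. g h S u)"
    by (subst sum.swap) (intro sum.cong refl, auto)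
  also have "\<dots> \<le> (\<Sum>h\<in>H. 15 * (real (card A) / 2 ^ (2 * c + 8)) + ?E + ?L)"
  proof (rule sum_mono)
    fix h
    have "(\<Sum>(S, u)\<in>?N. g h S u) \<le> (\<Sum>x\<in>?N. 1 / 2 ^ (2 * c + 8))"
      using reject by (intro sum_mono) auto
    also have "\<dots> \<le> real (card A) * (1 / 2 ^ (2 * c + 8))"
      using finA by (simp add: divide_right_mono card_mono case_prod_unfold)
    finally have "(\<Sum>(S, u)\<in>?N. g h S u) \<le> real (card A) / 2 ^ (2 * c + 8)" by simp
    moreover have "(\<Sum>(S, u)\<in>?D. g h S u) \<le> 15 * (\<Sum>(S, u)\<in>?N. g h S u) + ?E + ?L"
      unfolding g_def A_def U_def by (rule amplified_one_way_bound) (rule len_state)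
    ultimately show "(\<Sum>(S, u)\<in>?D. g h S u) \<le> 15 * (real (card A) / 2 ^ (2 * c + 8)) + ?E + ?L" by linarith
  qed
  also have "\<dots> = real (card H) * (15 * (real (card A) / 2 ^ (2 * c + 8)) + ?E + ?L)" by simp
  also have "\<dots> \<le> 2 ^ c * (15 * (real (card A) / 2 ^ (2 * c + 8)) + ?E + ?L)"
    using H(2) by (intro mult_right_mono) auto
  also have "?E = real (card A) * (2 * 2 ^ (w * (2 * j)) * (3/4) ^ (m div 16))" by (simp add: cardA)
  also have "?L = real (card A) * (1 / 16 ^ t)" by (simp add: cardA power_divide)
  finally have "real (card ?D) * (1/2) \<le> 2 ^ c * (15 * (real (card A) / 2 ^ (2 * c + 8)) +
      real (card A) * (2 * 2 ^ (w * (2 * j)) * (3/4) ^ (m div 16)) + real (card A) * (1 / 16 ^ t))"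
    (is "_ \<le> ?Q") .
  then have "2 ^ t * (real (card ?D) * (1/2)) \<le> 2 ^ t * ?Q" by (rule mult_left_mono) simp
  then have "real (card A) * (1/2) \<le> 2 ^ t * ?Q" using cardD by linarith
  also have "\<dots> = real (card A) * (2 ^ t * 2 ^ c * (15 / 2 ^ (2 * c + 8) +
      2 * 2 ^ (w * (2 * j)) * (3/4) ^ (m div 16) + 1 / 16 ^ t))" by (simp add: algebra_simps)
  finally have "1/2 \<le> 2 ^ t * 2 ^ c * (15 / 2 ^ (2 * c + 8) + 2 * 2 ^ (w * (2 * j)) * (3/4) ^ (m div 16) + 1 / (16::real) ^ t)"
    using X(2) by (subst (asm) mult_le_cancel_left_pos) (auto simp: cardA)
  also have "\<dots> = 2 ^ (2 * c + 1) * 15 / 2 ^ (2 * c + 8) + 2 ^ (2 * c + 1) * 2 * 2 ^ (w * (2 * j)) * (3/4) ^ (m div 16) +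
      2 ^ (2 * c + 1) / 16 ^ (c + 1)"
  proof -
    have tc: "(2::real) ^ t * 2 ^ c = 2 ^ (2 * c + 1)"
      unfolding t_def power_add[symmetric] by (rule arg_cong[where f = "(^) 2"]) simp
    show ?thesis unfolding tc unfolding t_def by (simp only: distrib_left times_divide_eq_right mult_1_right mult.assoc)
  qed
  \<comment> \<open>The outer terms are at most 15/128 and 1/8, together below 1/4, so at least 1/4
    of the required 1/2 is left to the term with the memory.\<close>
  also have "(2::real) ^ (2 * c + 1) * 15 / 2 ^ (2 * c + 8) = 15 / 128" by (simp add: power_add)
  also have "(2::real) ^ (2 * c + 1) / 16 ^ (c + 1) \<le> 1 / 8"
  proof -
    have "(16::real) ^ (c + 1) = 2 ^ (4 * (c + 1))" by (simp only: power_mult) simp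
    moreover have "(2::real) ^ (2 * c + 1) * 8 \<le> 2 ^ (4 * (c + 1))"
      using power_increasing[of "2 * c + 4" "4 * (c + 1)" "2::real"] by (simp add: power_add)
    ultimately show ?thesis by (simp add: field_simps)
  qed
  finally have quarter: "1/4 \<le> 2 ^ (2 * c + 1) * 2 * 2 ^ (w * (2 * j)) * (3/4 :: real) ^ (m div 16)"
    (is "_ \<le> ?Z * _") by simp
  have "(4/3 :: real) ^ (m div 16) * (1/4) \<le> (4/3) ^ (m div 16) * (?Z * (3/4) ^ (m div 16))"
    using quarter by (rule mult_left_mono) simp
  also have "\<dots> = ?Z * ((4/3) ^ (m div 16) * (3/4) ^ (m div 16))" by (simp only: mult.left_commute)
  also have "(4/3 :: real) ^ (m div 16) * (3/4) ^ (m div 16) = 1" by (simp flip: power_mult_distrib)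
  finally have "(4/3 :: real) ^ (m div 16) \<le> ?Z * 4" by simp
  also have "\<dots> = 2 ^ (2 * c + 4 + w * (2 * j))" by (simp add: power_add)
  finally have upper: "(4/3 :: real) ^ (m div 16) \<le> 2 ^ (2 * c + 4 + w * (2 * j))" .
  \<comment> \<open>Three factors 4/3 exceed 2, which turns \<open>m div 16\<close> into
    \<open>m div 48\<close> for base 2.\<close>
  have "(2::real) ^ (m div 48) \<le> ((4/3) ^ 3) ^ (m div 48)"
    by (intro power_mono) (auto simp: power_divide)
  also have "\<dots> = (4/3) ^ (3 * (m div 48))" by (simp add: power_mult)
  also have "\<dots> \<le> (4/3) ^ (m div 16)" by (intro power_increasing) auto
  also note upper
  finally have "m div 48 \<le> 2 * c + 4 + w * (2 * j)" by (rule power_le_imp_le_exp[rotated]) simp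
  also have "\<dots> \<le> w * (2 * c + 4) + w * (2 * j)" using w by (cases w) auto
  also have "\<dots> \<le> w * (200 * (c + 1))" by (simp add: j_def algebra_simps)
  finally have "m div 48 \<le> 200 * (w * (c + 1))" by (simp add: algebra_simps)
  \<comment> \<open>Absorbs the rounding: 48 * 200 * x + 47 <= 10000 * x for x >= 1.\<close>
  moreover have "1 \<le> w * (c + 1)" using w by simp
  ultimately show ?thesis by linarith
qed

theorem theorem4p3:
  fixes k :: nat
  defines "X \<equiv> \<lambda>(n, m). disj_streams n m (m ^ k)"
    and "F \<equiv> \<lambda>(n, m). m_disj n"
    and "c \<equiv> \<lambda>(n, m). (real m * log 2 (real m)) powr (2/3)"
  shows
    "prescient_scheme 0 disj_params X F c c \<and>
     (\<exists>K. \<forall>(n, m)\<in>disj_params.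
        ereal_of_enat (ma_complexity (small_subsets n m) (small_subsets n m) (\<lambda>S T. S \<inter> T = {}))
          \<le> ereal (K * c (n, m))) \<and>
     (\<forall>c\<^sub>a c\<^sub>v. (\<forall>p. 1 \<le> c\<^sub>a p) \<longrightarrow>
        prescient_scheme (1/3) {(n, m)\<in>disj_params. m \<le> n} X F c\<^sub>a c\<^sub>v \<longrightarrow>
        (\<exists>d>0. \<forall>(n, m)\<in>disj_params. m \<le> n \<longrightarrow> d * real m \<le> c\<^sub>a (n, m) * c\<^sub>v (n, m)))"
proof (intro conjI allI impI)
  define K where "K = 500 + 200 * real k"
  have scheme: "\<exists>(P :: update prover) (V :: (update, bool) verifier) c' w.
      annotation_bits (X p) P c' \<and> real c' \<le> K * c p \<and> memory_bits V w \<and> real w \<le> K * c p \<and>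
      completeness_error (X p) (F p) P V 0 \<and> soundness_error (X p) (F p) V (1/3)"
    if "p \<in> disj_params" for p
  proof -
    obtain n m where p: "p = (n, m)" by (cases p)
    show ?thesis
      using disj_scheme_cost(2)[of n m k] that unfolding p X_def F_def c_def K_def by simp
  qed
  then show "prescient_scheme 0 disj_params X F c c" unfolding prescient_scheme_def by blast
  show "\<exists>K. \<forall>(n, m)\<in>disj_params.
        ereal_of_enat (ma_complexity (small_subsets n m) (small_subsets n m) (\<lambda>S T. S \<inter> T = {}))
          \<le> ereal (K * c (n, m))"
  \<comment> \<open>Annotation and memory cost at most K C each, and the additive 2 is at most 2 C
    because C >= 1.\<close>
  proof (intro exI[of _ "2 * K + 2"] ballI, clarify)
    fix n m assume nm: "(n, m) \<in> disj_params"
    obtain P :: "update prover" and V :: "(update, bool) verifier" and c' w where PV: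
      "annotation_bits (X (n, m)) P c'" "real c' \<le> K * c (n, m)"
      "memory_bits V w" "real w \<le> K * c (n, m)"
      "completeness_error (X (n, m)) (F (n, m)) P V 0" "soundness_error (X (n, m)) (F (n, m)) V (1/3)"
      using scheme[OF nm] by blast
    have "1 \<le> m ^ k" using nm by (simp add: disj_params_def)
    then have "ma_complexity (small_subsets n m) (small_subsets n m) (\<lambda>S T. S \<inter> T = {}) \<le> enat (c' + w + 2)"
      using PV unfolding X_def F_def by (intro ma_complexity_le_scheme[where \<delta> = 0]) auto
    then have "ereal_of_enat (ma_complexity (small_subsets n m) (small_subsets n m) (\<lambda>S T. S \<inter> T = {}))
        \<le> ereal_of_enat (enat (c' + w + 2))"
      by (simp only: ereal_of_enat_le_iff)
    also have "\<dots> = ereal (real (c' + w + 2))" by simp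
    also have "\<dots> \<le> ereal ((2 * K + 2) * c (n, m))"
      using PV(2,4) disj_scheme_cost(1)[OF nm] by (simp add: c_def algebra_simps)
    finally show "ereal_of_enat (ma_complexity (small_subsets n m) (small_subsets n m) (\<lambda>S T. S \<inter> T = {}))
        \<le> ereal ((2 * K + 2) * c (n, m))" .
  qed
next
  fix c\<^sub>a c\<^sub>v :: "nat \<times> nat \<Rightarrow> real"
  assume ca: "\<forall>p. 1 \<le> c\<^sub>a p"
    and "prescient_scheme (1/3) {(n, m)\<in>disj_params. m \<le> n} X F c\<^sub>a c\<^sub>v"
  then obtain K where K: "\<And>p. p \<in> {(n, m)\<in>disj_params. m \<le> n} \<Longrightarrow>
      \<exists>(P :: update prover) (V :: (update, bool) verifier) c' w.
        annotation_bits (X p) P c' \<and> real c' \<le> K * c\<^sub>a p \<and> memory_bits V w \<and> real w \<le> K * c\<^sub>v p \<and>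
        completeness_error (X p) (F p) P V (1/3) \<and> soundness_error (X p) (F p) V (1/3)"
    unfolding prescient_scheme_def by blast
  \<comment> \<open>The constant of the given scheme may be any real, so it is raised to at least
    1.\<close>
  define L where "L = max K 1"
  show "\<exists>d>0. \<forall>(n, m)\<in>disj_params. m \<le> n \<longrightarrow> d * real m \<le> c\<^sub>a (n, m) * c\<^sub>v (n, m)"
  proof (intro exI[of _ "1 / (10000 * (L * (L + 1)))"] conjI ballI, force simp: L_def, clarify)
    fix n m assume nm: "(n, m) \<in> disj_params" "m \<le> n"
    then obtain P :: "update prover" and V :: "(update, bool) verifier" and c' w where PV:
      "annotation_bits (X (n, m)) P c'" "real c' \<le> K * c\<^sub>a (n, m)"
      "memory_bits V w" "real w \<le> K * c\<^sub>v (n, m)"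
      "completeness_error (X (n, m)) (F (n, m)) P V (1/3)" "soundness_error (X (n, m)) (F (n, m)) V (1/3)"
      using K[of "(n, m)"] by auto
    have m: "1 \<le> m" using nm by (simp add: disj_params_def)
    have bound: "m \<le> 10000 * (w * (c' + 1))"
      using disj_scheme_lower_bound[of "X (n, m)" n m "m ^ k" P c' V w] PV m nm(2)
      by (simp add: X_def F_def)
    have L: "1 \<le> L" "K \<le> L" by (simp_all add: L_def)
    have ca1: "1 \<le> c\<^sub>a (n, m)" using ca by blast
    have "K * c\<^sub>a (n, m) \<le> L * c\<^sub>a (n, m)" using L ca1 by (intro mult_right_mono) auto
    then have c': "real c' + 1 \<le> (L + 1) * c\<^sub>a (n, m)" using PV(2) ca1 unfolding distrib_right by linarith
    \<comment> \<open>The sign of \<open>c\<^sub>v\<close> comes from the bound itself: m >= 1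
      forces w >= 1, hence \<open>K * c\<^sub>v\<close> is positive, and \<open>K\<close> is
      positive by the annotation bound.\<close>
    have "0 < w" using bound m by (cases w) auto
    then have "0 < K * c\<^sub>v (n, m)" using PV(4) by linarith
    moreover have "0 < K"
    proof (rule ccontr)
      assume "\<not> 0 < K"
      then have "K * c\<^sub>a (n, m) \<le> 0" using ca1 by (simp add: mult_nonpos_nonneg)
      moreover have "0 \<le> K * c\<^sub>a (n, m)" using PV(2) by linarith
      ultimately have "K * c\<^sub>a (n, m) = 0" by linarith
      then have "K = 0" using ca1 by simp
      then show False using \<open>0 < K * c\<^sub>v (n, m)\<close> by simp
    qed
    ultimately have "0 < c\<^sub>v (n, m)" by (simp add: zero_less_mult_iff)
    then have "K * c\<^sub>v (n, m) \<le> L * c\<^sub>v (n, m)" using L by (intro mult_right_mono) auto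
    then have w: "real w \<le> L * c\<^sub>v (n, m)" using PV(4) by linarith
    have "real m \<le> real (10000 * (w * (c' + 1)))" using bound by (simp only: of_nat_le_iff)
    also have "\<dots> = 10000 * (real w * (real c' + 1))" by (simp add: distrib_left)
    also have "\<dots> \<le> 10000 * ((L * c\<^sub>v (n, m)) * ((L + 1) * c\<^sub>a (n, m)))"
      using w c' L \<open>0 < c\<^sub>v (n, m)\<close> by (intro mult_left_mono mult_mono) auto
    also have "\<dots> = (10000 * (L * (L + 1))) * (c\<^sub>a (n, m) * c\<^sub>v (n, m))" by (simp only: mult_ac)
    finally show "1 / (10000 * (L * (L + 1))) * real m \<le> c\<^sub>a (n, m) * c\<^sub>v (n, m)"
      using L by (simp add: divide_le_eq mult_ac add_pos_pos)
  qed
qed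

end
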